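(* Let $N,n\ge 1$, let $K_1,\dots,K_N\in\mathbb C$, and let $z_1,\dots,z_n\in\mathbb C$ be pairwise distinct. Let $\Psi(u,x)=1+\sum_{i,j\ge1}\Psi_{ij}u^{-j}x^{-i}$ be the generating series of the Bethe algebra of $V^{\otimes n}$ (defined in the context), and let $H_1,\dots,H_n$ be the classical Gaudin Hamiltonians. Then the Bethe algebra of $\otimes_{a=1}^n V(z_a)$ (the unital subalgebra of $\mathrm{End}(V^{\otimes n})$ generated by the $B_{ij}$, $i=1,\dots,N$, $j\ge1$) is generated by $H_1,\dots,H_n$. More precisely, $$\Psi(u,x)=\psi(u,x,z_1,\dots,z_n,H_1,\dots,H_n),$$ i.e. $\Psi_{ij}=\psi_{ij}(z_1,\dots,z_n,H_1,\dots,H_n)$ for all $i,j\ge1$. In particular, $$\psi_{\dagger}(x,z_1,\dots,z_n,H_1,\dots,H_n)=\sum_{i=1}^N\sum_{a=1}^n\frac{e_{ii}^{(a)}}{x-K_i}.$$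
   Context: Let $e_{ij}$, $i,j=1,\dots,N$, be the standard generators of $\mathfrak{gl}_N$, $[e_{ij},e_{sk}]=\delta_{js}e_{ik}-\delta_{ik}e_{sj}$, and let $V=\oplus_{i=1}^N\mathbb C v_i$ be the vector representation, $e_{ij}v_k=\delta_{jk}v_i$. On $V^{\otimes n}$ let $e_{ij}^{(a)}$ denote the action of $e_{ij}$ on the $a$-th factor. Put $e_{ij}(u)=\sum_{a=1}^n e_{ij}^{(a)}(u-z_a)^{-1}$ (this is the action of $\sum_{s\ge0}(e_{ij}\otimes t^s)u^{-s-1}$ on the tensor product $\otimes_a V(z_a)$ of evaluation $\mathfrak{gl}_N[t]$-modules). Let $\mathcal D=\sum_{\sigma\in S_N}(-1)^\sigma m_{1\sigma(1)}m_{2\sigma(2)}\cdots m_{N\sigma(N)}$ (row determinant, products taken in the given order as compositions of differential operators in $u$ with $\mathrm{End}(V^{\otimes n})$-valued rational coefficients), where $m_{ij}=\delta_{ij}(\partial_u-K_i)-e_{ji}(u)$. Write $\mathcal D=\partial_u^N+\sum_{i=1}^N B_i(u)\partial_u^{N-i}$ and expand $B_i(u)=\sum_{j\ge0}B_{ij}u^{-j}$ at $u=\infty$, $B_{ij}\in\mathrm{End}(V^{\otimes n})$. Define $\Psi(u,x)=\bigl(x^N+\sum_{i=1}^N B_i(u)x^{N-i}\bigr)\prod_{i=1}^N(x-K_i)^{-1}=1+\sum_{i\ge1}\sum_{j\ge1}\Psi_{ij}u^{-j}x^{-i}$. The classical Gaudin Hamiltonians are $H_a=\sum_{i=1}^N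 K_ie_{ii}^{(a)}+\sum_{i,j=1}^N\sum_{b\ne a}\frac{e_{ij}^{(a)}e_{ji}^{(b)}}{z_a-z_b}$, $a=1,\dots,n$; they pairwise commute. For variables $h_1,\dots,h_n$ let $Z=\mathrm{diag}(z_1,\dots,z_n)$ and let $Q$ be the $n\times n$ matrix with $Q_{aa}=h_a$ and $Q_{ab}=1/(z_b-z_a)$ for $a\ne b$. Set $\psi(u,x,z,h)=\det\bigl(1-(u-Z)^{-1}(x-Q)^{-1}\bigr)=1+\sum_{i,j\ge1}\psi_{ij}(z,h)u^{-j}x^{-i}$ (expansion at $u,x\to\infty$; each $\psi_{ij}$ is a polynomial in $h_1,\dots,h_n$ with coefficients rational in $z$), and $\psi_\dagger(x,z,h)=\mathrm{tr}\bigl((x-Q)^{-1}\bigr)$. Substituting $h_a=H_a$ is meaningful since the $H_a$ commute. *)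

theory Defs
  imports "HOL-Library.FuncSet" "HOL-Library.Function_Algebras"
    "HOL-Combinatorics.Permutations" "HOL-Computational_Algebra.Formal_Power_Series"
begin

(* Conventions: indices are 0-based.  Tensor factors a < n, basis indices i < N.
   A basis vector v_{f 0} \<otimes> ... \<otimes> v_{f (n-1)} of V^{\<otimes> n} is given by f \<in> Idx N n.
   An operator on V^{\<otimes> n} is given by its matrix entries A f g (f = row, g = column);
   only entries with f, g \<in> Idx N n are meaningful. *)

type_synonym op = "(nat \<Rightarrow> nat) \<Rightarrow> (nat \<Rightarrow> nat) \<Rightarrow> complex"

definition Idx :: "nat \<Rightarrow> nat \<Rightarrow> (nat \<Rightarrow> nat) set" where
  "Idx N n = PiE {..<n} (\<lambda>_. {..<N})"

definition oid :: op where
  "oid = (\<lambda>f g. if f = g then 1 else 0)"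

definition osc :: "complex \<Rightarrow> op \<Rightarrow> op" where
  "osc c A = (\<lambda>f g. c * A f g)"

definition ocomp :: "nat \<Rightarrow> nat \<Rightarrow> op \<Rightarrow> op \<Rightarrow> op" where
  "ocomp N n A B = (\<lambda>f g. \<Sum>h\<in>Idx N n. A f h * B h g)"

definition ores :: "nat \<Rightarrow> nat \<Rightarrow> op \<Rightarrow> op" where
  "ores N n A = (\<lambda>f g. if f \<in> Idx N n \<and> g \<in> Idx N n then A f g else 0)"

(* e_{ij}^{(a)} : e_{ij} acting on factor a;  e_{ij} v_k = \<delta>_{jk} v_i *)
definition Eop :: "nat \<Rightarrow> nat \<Rightarrow> nat \<Rightarrow> op" where
  "Eop a i j = (\<lambda>f g. if f a = i \<and> g a = j \<and> (\<forall>b. b \<noteq> a \<longrightarrow> f b = g b) then 1 else 0)"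

definition gaudinH :: "nat \<Rightarrow> nat \<Rightarrow> (nat \<Rightarrow> complex) \<Rightarrow> (nat \<Rightarrow> complex) \<Rightarrow> nat \<Rightarrow> op" where
  "gaudinH N n K z a =
     (\<Sum>i<N. osc (K i) (Eop a i i)) +
     (\<Sum>i<N. \<Sum>j<N. \<Sum>b\<in>{..<n} - {a}. osc (1 / (z a - z b)) (ocomp N n (Eop a i j) (Eop b j i)))"

(* ---------- operator-valued formal series in u^{-1}: A k = coefficient of u^{-k} ---------- *)
type_synonym user = "nat \<Rightarrow> op"

definition umul :: "nat \<Rightarrow> nat \<Rightarrow> user \<Rightarrow> user \<Rightarrow> user" where
  "umul N n A B = (\<lambda>k. \<Sum>p\<le>k. ocomp N n (A p) (B (k - p)))"

definition uscale :: "complex \<Rightarrow> user \<Rightarrow> user" where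
  "uscale c A = (\<lambda>k. osc c (A k))"

(* d/du of \<Sum>_k A_k u^{-k} = \<Sum>_k (-k) A_k u^{-k-1} *)
definition uder :: "user \<Rightarrow> user" where
  "uder A = (\<lambda>k. if k = 0 then 0 else osc (- of_nat (k - 1)) (A (k - 1)))"

definition uconst :: "op \<Rightarrow> user" where
  "uconst c = (\<lambda>k. if k = 0 then c else 0)"

(* e_{ij}(u) = \<Sum>_a e_{ij}^{(a)} / (u - z_a) = \<Sum>_{s\<ge>0} (\<Sum>_a z_a^s e_{ij}^{(a)}) u^{-s-1} *)
definition ecur :: "nat \<Rightarrow> (nat \<Rightarrow> complex) \<Rightarrow> nat \<Rightarrow> nat \<Rightarrow> user" where
  "ecur n z i j = (\<lambda>k. if k = 0 then 0 else (\<Sum>a<n. osc (z a ^ (k - 1)) (Eop a i j)))"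

(* ---------- differential operators \<Sum>_k P!k \<partial>_u^k, as coefficient lists ---------- *)
(* (A \<partial>^k)(B \<partial>^l) = \<Sum>_r (k choose r) A B^{(r)} \<partial>^{k+l-r} *)
definition dcomp :: "nat \<Rightarrow> nat \<Rightarrow> user list \<Rightarrow> user list \<Rightarrow> user list" where
  "dcomp N n P Q = map (\<lambda>m. \<Sum>k<length P. \<Sum>r\<le>k.
        if k \<le> m + r \<and> m + r - k < length Q
        then uscale (of_nat (k choose r)) (umul N n (P ! k) ((uder ^^ r) (Q ! (m + r - k))))
        else 0) [0..<length P + length Q - 1]"

definition dcoef :: "user list \<Rightarrow> nat \<Rightarrow> user" where
  "dcoef P k = (if k < length P then P ! k else 0)"

definition mop :: "nat \<Rightarrow> (nat \<Rightarrow> complex) \<Rightarrow> (nat \<Rightarrow> complex) \<Rightarrow> nat \<Rightarrow> nat \<Rightarrow> user list" where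
  "mop n K z i j =
     [uconst (if i = j then osc (- K i) oid else 0) - ecur n z j i,
      uconst (if i = j then oid else 0)]"

(* coefficient of \<partial>_u^k in the row determinant
   \<D> = \<Sum>_\<sigma> sign \<sigma> m_{0 \<sigma>0} \<circ> m_{1 \<sigma>1} \<circ> ... \<circ> m_{N-1 \<sigma>(N-1)} *)
definition Dcoef :: "nat \<Rightarrow> nat \<Rightarrow> (nat \<Rightarrow> complex) \<Rightarrow> (nat \<Rightarrow> complex) \<Rightarrow> nat \<Rightarrow> user" where
  "Dcoef N n K z k =
     (\<Sum>\<sigma>\<in>{\<sigma>. \<sigma> permutes {..<N}}.
        uscale (of_int (sign \<sigma>))
          (dcoef (foldr (dcomp N n) (map (\<lambda>i. mop n K z i (\<sigma> i)) [0..<N]) [uconst oid]) k))"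

(* B_{ij} (for 1 \<le> i \<le> N): coefficient of u^{-j} in B_i(u), where \<D> = \<partial>^N + \<Sum>_i B_i(u) \<partial>^{N-i} *)
definition Bethe :: "nat \<Rightarrow> nat \<Rightarrow> (nat \<Rightarrow> complex) \<Rightarrow> (nat \<Rightarrow> complex) \<Rightarrow> nat \<Rightarrow> nat \<Rightarrow> op" where
  "Bethe N n K z i j = Dcoef N n K z (N - i) j"

(* coefficients of x^N + \<Sum>_{i=1}^N B_i(u) x^{N-i}, i.e. B_0(u) = 1 *)
definition Bfull :: "nat \<Rightarrow> nat \<Rightarrow> (nat \<Rightarrow> complex) \<Rightarrow> (nat \<Rightarrow> complex) \<Rightarrow> nat \<Rightarrow> nat \<Rightarrow> op" where
  "Bfull N n K z i j = (if i = 0 then uconst oid j else Bethe N n K z i j)"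

(* x^N \<Prod>_i (x - K_i)^{-1} = \<Prod>_i (1 - K_i t)^{-1} with t = x^{-1}; hK k = coefficient of t^k *)
definition hK :: "nat \<Rightarrow> (nat \<Rightarrow> complex) \<Rightarrow> nat \<Rightarrow> complex" where
  "hK N K k = fps_nth (\<Prod>i<N. Abs_fps (\<lambda>t. K i ^ t)) k"

definition PsiC :: "nat \<Rightarrow> nat \<Rightarrow> (nat \<Rightarrow> complex) \<Rightarrow> (nat \<Rightarrow> complex) \<Rightarrow> nat \<Rightarrow> nat \<Rightarrow> op" where
  "PsiC N n K z i j = (\<Sum>l\<le>min i N. osc (hK N K (i - l)) (Bfull N n K z l j))"

type_synonym omat = "nat \<Rightarrow> nat \<Rightarrow> op"

definition mmul :: "nat \<Rightarrow> nat \<Rightarrow> omat \<Rightarrow> omat \<Rightarrow> omat" where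
  "mmul N n A B = (\<lambda>a b. \<Sum>c<n. ocomp N n (A a c) (B c b))"

definition mid :: omat where
  "mid = (\<lambda>a b. if a = b then oid else 0)"

definition mpow :: "nat \<Rightarrow> nat \<Rightarrow> omat \<Rightarrow> nat \<Rightarrow> omat" where
  "mpow N n A k = ((mmul N n A) ^^ k) mid"

(* Q with h_a := H_a substituted *)
definition Qmat :: "nat \<Rightarrow> nat \<Rightarrow> (nat \<Rightarrow> complex) \<Rightarrow> (nat \<Rightarrow> complex) \<Rightarrow> omat" where
  "Qmat N n K z = (\<lambda>a b. if a = b then gaudinH N n K z a else osc (1 / (z b - z a)) oid)"

(* bivariate series: S i j = coefficient of x^{-i} u^{-j} *)
type_synonym bser = "nat \<Rightarrow> nat \<Rightarrow> op"

definition bmul :: "nat \<Rightarrow> nat \<Rightarrow> bser \<Rightarrow> bser \<Rightarrow> bser" where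
  "bmul N n S T = (\<lambda>i j. \<Sum>i1\<le>i. \<Sum>j1\<le>j. ocomp N n (S i1 j1) (T (i - i1) (j - j1)))"

definition bone :: bser where
  "bone = (\<lambda>i j. if i = 0 \<and> j = 0 then oid else 0)"

(* entry (a,b) of (u - Z)^{-1} (x - Q)^{-1} = \<Sum>_{p,q\<ge>0} z_a^p (Q^q)_{ab} u^{-p-1} x^{-q-1} *)
definition Mser :: "nat \<Rightarrow> nat \<Rightarrow> (nat \<Rightarrow> complex) \<Rightarrow> (nat \<Rightarrow> complex) \<Rightarrow> nat \<Rightarrow> nat \<Rightarrow> bser" where
  "Mser N n K z a b = (\<lambda>i j. if 1 \<le> i \<and> 1 \<le> j
       then osc (z a ^ (j - 1)) (mpow N n (Qmat N n K z) (i - 1) a b) else 0)"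

(* \<psi>_{ij}(z, H): coefficient of x^{-i} u^{-j} of det(1 - (u-Z)^{-1}(x-Q)^{-1}) at h = H
   (Leibniz formula; the entries pairwise commute since the H_a commute) *)
definition psiC :: "nat \<Rightarrow> nat \<Rightarrow> (nat \<Rightarrow> complex) \<Rightarrow> (nat \<Rightarrow> complex) \<Rightarrow> nat \<Rightarrow> nat \<Rightarrow> op" where
  "psiC N n K z =
     (\<Sum>\<sigma>\<in>{\<sigma>. \<sigma> permutes {..<n}}.
        (\<lambda>i j. osc (of_int (sign \<sigma>))
           (foldr (bmul N n) (map (\<lambda>a. (if \<sigma> a = a then bone else 0) - Mser N n K z a (\<sigma> a)) [0..<n]) bone i j)))"

inductive_set genalg :: "nat \<Rightarrow> nat \<Rightarrow> op set \<Rightarrow> op set" for N n S where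
  gen_one: "ores N n oid \<in> genalg N n S"
| gen_gen: "A \<in> S \<Longrightarrow> ores N n A \<in> genalg N n S"
| gen_add: "A \<in> genalg N n S \<Longrightarrow> B \<in> genalg N n S \<Longrightarrow> A + B \<in> genalg N n S"
| gen_scale: "A \<in> genalg N n S \<Longrightarrow> osc c A \<in> genalg N n S"
| gen_mult: "A \<in> genalg N n S \<Longrightarrow> B \<in> genalg N n S \<Longrightarrow> ores N n (ocomp N n A B) \<in> genalg N n S"

end

theory Submission
  imports Defs "HOL-Library.Poly_Mapping" "Jordan_Normal_Form.Determinant"
begin

text \<open>Normal ordering the row determinant (a Capelli-type computation: derivative terms cancel
  contractions) writes \<open>\<Psi>\<close> as a sum over subsets \<open>B\<close> of tensor factors of
  \<open>(-1)\<^bsup>|B|\<^esup> \<Prod>\<^bsub>b\<in>B\<^esub> 1/(u - z\<^sub>b)\<close> times an antisymmetrizer on \<open>B\<close> and a product of the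
  \<open>(x - K\<^sub>i)\<^sup>-\<^sup>1\<close>.  Partial fractions in \<open>u\<close> give \<open>\<Psi> = 1 - \<Sum>\<^sub>a R\<^sub>a/(u - z\<^sub>a)\<close>, and the residues
  satisfy \<open>(x - Q) R = (1,\<dots>,1)\<^sup>T\<close> for the matrix \<open>Q\<close> at \<open>h = H\<close>, so
  \<open>\<Psi> = 1 - \<Sum>\<^sub>a\<^sub>b ((u - Z)\<^sup>-\<^sup>1 (x - Q)\<^sup>-\<^sup>1)\<^sub>a\<^sub>b\<close>.  Since \<open>[Q, Z] + 1\<close> is the rank one all-ones matrix, the
  determinant \<open>\<psi>\<close> has the same value.  The trace formula follows from
  \<open>tr (Q\<^sup>k [Q, Z]) = 0\<close>, which equates \<open>tr Q\<^sup>k\<close> with the sum of all entries of \<open>Q\<^sup>k\<close>.  Finally, the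
  coefficients of \<open>x\<^sup>-\<^sup>2\<close> in \<open>\<Psi>\<close> recover the \<open>H\<^sub>a\<close> by Lagrange interpolation.\<close>

text \<open>The obstacle is that both determinants have operator entries. For \<Psi> a column index
  \<open>g\<close> is fixed, so an operator becomes a scalar function of the row index
  \<open>f\<close>, a row of the determinant becomes a linear map on such functions, and all series
  lie in commutative rings. For \<psi> operators are represented by polynomials in commuting
  variables; this needs the commutation of the H_a, which rests on the three-term relation for
  1/(z_a - z_b). The equation for R is checked by comparing coefficients of the products of 1/(x -
  K) over a set of factors. Sets that contain a cancel by a double pole identity; the others are
  handled by a recursion for antisymmetrizers. As a series in x^(-1) the equation is the recursion
  R_(k+1) = Q R_k with R_1 = (1,...,1), so it determines R. The Hamiltonians are read off at x^(-2)
  because the coefficient of x^(-1) in \<Psi> involves only row sums of Q^0 and is scalar.\<close>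

no_notation vec_index (infixl "$" 100)
unbundle fps_syntax

section \<open>Sums over subsets and signed sums over permutations\<close>

text \<open>Pairs of a set B and a point a of it are recounted by a and B - {a}. This moves between
  sums over the set of factors acted on and sums with one distinguished factor.\<close>

lemma sum_Pow_pick:
  fixes h :: "'a \<Rightarrow> 'a set \<Rightarrow> 'b::comm_monoid_add"
  assumes "finite A"
  shows "(\<Sum>B\<in>Pow A. \<Sum>a\<in>B. h a B) = (\<Sum>a\<in>A. \<Sum>B\<in>Pow (A - {a}). h a (insert a B))"
proof -
  have "(\<Sum>B\<in>Pow A. \<Sum>a\<in>B. h a B) = (\<Sum>(B,a)\<in>Sigma (Pow A) (\<lambda>B. B). h a B)"
    using assms by (subst sum.Sigma) (auto intro: finite_subset)
  also have "\<dots> = (\<Sum>(a,B)\<in>Sigma A (\<lambda>a. Pow (A - {a})). h a (insert a B))"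
    by (rule sum.reindex_bij_witness[where j = "\<lambda>(B,a). (a, B - {a})" and i = "\<lambda>(a,B). (insert a B, a)"])
       (auto simp: insert_absorb)
  also have "\<dots> = (\<Sum>a\<in>A. \<Sum>B\<in>Pow (A - {a}). h a (insert a B))"
    using assms by (subst sum.Sigma) auto
  finally show ?thesis .
qed

lemma sum_Pow_split:
  fixes h :: "'a set \<Rightarrow> 'b::comm_monoid_add"
  assumes "a \<in> A" "finite A"
  shows "(\<Sum>B\<in>Pow A. h B) = (\<Sum>B\<in>Pow (A - {a}). h B) + (\<Sum>B\<in>Pow (A - {a}). h (insert a B))"
proof -
  have 1: "Pow A = Pow (A - {a}) \<union> insert a ` Pow (A - {a})"
    using Pow_insert[of a "A - {a}"] assms(1) by (simp add: insert_absorb)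
  have 2: "inj_on (insert a) (Pow (A - {a}))" by (auto simp: inj_on_def)
  have 3: "Pow (A - {a}) \<inter> insert a ` Pow (A - {a}) = {}" by auto
  show ?thesis unfolding 1 using assms(2) by (simp add: sum.union_disjoint[OF _ _ 3] sum.reindex[OF 2])
qed

text \<open>The (f, g) entry of the unnormalised antisymmetrizer on the tensor factors in
  \<open>B\<close>: it sends the basis vector of g to the signed sum of those of g o \<pi>.\<close>

definition alt :: "nat set \<Rightarrow> (nat \<Rightarrow> nat) \<Rightarrow> (nat \<Rightarrow> nat) \<Rightarrow> int" where
  "alt B f g = (\<Sum>\<pi>\<in>{\<pi>. \<pi> permutes B}. if f = g \<circ> \<pi> then sign \<pi> else 0)"

lemma sum_sign_flip:
  fixes F :: "(nat \<Rightarrow> nat) \<Rightarrow> 'r::comm_ring_1"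
  assumes "i \<in> A" "k \<in> A" "i \<noteq> k" "finite A"
  shows "(\<Sum>\<sigma>\<in>{\<sigma>. \<sigma> permutes A}. of_int (sign \<sigma>) * F (\<sigma> \<circ> transpose i k))
       = - (\<Sum>\<sigma>\<in>{\<sigma>. \<sigma> permutes A}. of_int (sign \<sigma>) * F \<sigma>)"
proof -
  have p: "transpose i k permutes A" using assms by (simp add: permutes_swap_id)
  have s: "sign (\<sigma> \<circ> transpose i k) = - sign \<sigma>" if "\<sigma> permutes A" for \<sigma>
    using that assms p by (subst sign_compose) (auto intro: permutes_imp_permutation simp: sign_swap_id)
  have "(\<Sum>\<sigma>\<in>{\<sigma>. \<sigma> permutes A}. of_int (sign \<sigma>) * F \<sigma>)
      = (\<Sum>\<sigma>\<in>{\<sigma>. \<sigma> permutes A}. of_int (sign (\<sigma> \<circ> transpose i k)) * F (\<sigma> \<circ> transpose i k))"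
    by (rule sum.reindex_bij_witness[where i = "\<lambda>\<sigma>. \<sigma> \<circ> transpose i k" and j = "\<lambda>\<sigma>. \<sigma> \<circ> transpose i k"])
       (auto simp: comp_assoc intro: permutes_compose[OF p])
  also have "\<dots> = - (\<Sum>\<sigma>\<in>{\<sigma>. \<sigma> permutes A}. of_int (sign \<sigma>) * F (\<sigma> \<circ> transpose i k))"
    by (simp add: s sum_negf)
  finally show ?thesis by simp
qed

text \<open>If g agrees at a and b, then g o (a b) = g, so multiplying \<pi> by this transposition
  on the left keeps the condition and flips the sign: the sum is its own negative.\<close>

lemma alt_eq_0_if_not_inj:
  assumes fin: "finite B" and "\<not> inj_on g B"
  shows "alt B f g = 0"
proof -
  from assms(2) obtain a b where ab: "a \<in> B" "b \<in> B" "a \<noteq> b" "g a = g b" by (auto simp: inj_on_def)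
  have gt: "g \<circ> transpose a b = g" using ab by (auto simp: fun_eq_iff transpose_def)
  have tp: "transpose a b permutes B" using ab by (simp add: permutes_swap_id)
  have "alt B f g = (\<Sum>\<pi>\<in>{\<pi>. \<pi> permutes B}. if f = g \<circ> (transpose a b \<circ> \<pi>) then sign (transpose a b \<circ> \<pi>) else 0)"
    unfolding alt_def
    by (rule sum.reindex_bij_witness[where i = "\<lambda>\<sigma>. transpose a b \<circ> \<sigma>" and j = "\<lambda>\<sigma>. transpose a b \<circ> \<sigma>"])
       (auto simp: comp_assoc[symmetric] intro: permutes_compose[OF _ tp])
  also have "\<dots> = (\<Sum>\<pi>\<in>{\<pi>. \<pi> permutes B}. - (if f = g \<circ> \<pi> then sign \<pi> else 0))"
    using fin ab(3) tp
    by (intro sum.cong refl)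
       (auto simp: comp_assoc[symmetric] gt sign_compose permutes_imp_permutation sign_swap_id permutation_swap_id)
  also have "\<dots> = - alt B f g" by (simp add: alt_def sum_negf)
  finally show ?thesis by simp
qed

section \<open>Normal ordering of the row determinant\<close>

text \<open>With \<open>y = x\<^sup>-\<^sup>1\<close>, \<open>\<xi>\<^sub>i = 1 - K\<^sub>i y\<close> and \<open>r\<^sub>a = 1/(u - z\<^sub>a)\<close>, the operator \<open>row i j\<close> below is left composition
  with \<open>m\<^sub>i\<^sub>j\<close> on symbols of differential operators, rescaled by \<open>y\<close>; matrix entries are taken in a
  fixed column \<open>g\<close>.\<close>

locale capelli =
  fixes d :: "'r::comm_ring_1 \<Rightarrow> 'r" and y :: 'r and \<xi> r :: "nat \<Rightarrow> 'r"
    and N n :: nat and g :: "nat \<Rightarrow> nat"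
  assumes d_add: "d (p + q) = d p + d q"
    and d_mult: "d (p * q) = d p * q + p * d q"
    and d_y: "d y = 0" and d_xi: "d (\<xi> i) = 0" and d_r: "d (r a) = - (r a * r a)"
begin

lemma d_0: "d 0 = 0"
  using d_add[of 0 0] by simp

lemma d_1: "d 1 = 0"
  using d_mult[of 1 1] by simp

lemma d_uminus: "d (- p) = - d p"
  using d_add[of p "- p"] d_0 by (simp add: eq_neg_iff_add_eq_0 add.commute)

lemma d_sum: "d (sum h A) = (\<Sum>a\<in>A. d (h a))"
  by (induction A rule: infinite_finite_induct) (simp_all add: d_0 d_add)

lemma d_prod_xi: "d (\<Prod>k\<in>A. \<xi> k) = 0"
  by (induction A rule: infinite_finite_induct) (simp_all add: d_1 d_mult d_xi)

lemma d_prod_r: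
  "finite B \<Longrightarrow> d (\<Prod>b\<in>B. - (y * r b)) = (\<Sum>a\<in>B. - r a) * (\<Prod>b\<in>B. - (y * r b))"
  by (induction B rule: finite_induct) (simp_all add: d_1 d_mult d_uminus d_y d_r algebra_simps)

text \<open>Left composition with d/du turns a symbol p into x p + p', hence the derivative term
  after rescaling by y. The entry m_ij contains e_ji, with exchanged indices, so factor a in state j
  is read off from F with that factor in state i.\<close>

definition row :: "nat \<Rightarrow> nat \<Rightarrow> ((nat \<Rightarrow> nat) \<Rightarrow> 'r) \<Rightarrow> (nat \<Rightarrow> nat) \<Rightarrow> 'r" where
  "row i j F f = (if i = j then \<xi> i * F f + y * d (F f) else 0)
      - (\<Sum>a<n. if f a = j then y * r a * F (f(a := i)) else 0)"

definition rows :: "nat \<Rightarrow> (nat \<Rightarrow> nat) \<Rightarrow> ((nat \<Rightarrow> nat) \<Rightarrow> 'r) \<Rightarrow> (nat \<Rightarrow> nat) \<Rightarrow> 'r" where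
  "rows i \<sigma> F = foldr (\<lambda>k. row k (\<sigma> k)) [0..<i] F"

lemma rows_0 [simp]: "rows 0 \<sigma> F = F"
  by (simp add: rows_def)

lemma rows_Suc: "rows (Suc i) \<sigma> F = rows i \<sigma> (row i (\<sigma> i) F)"
  by (simp add: rows_def)

text \<open>This locality is used in \<open>contr_cancel\<close>: a transposition of i with a larger
  index is invisible to the rows below i.\<close>

lemma rows_cong: "(\<And>k. k < i \<Longrightarrow> \<sigma> k = \<sigma>' k) \<Longrightarrow> rows i \<sigma> F = rows i \<sigma>' F"
  unfolding rows_def by (rule foldr_cong) auto

lemma row_add: "row i j (\<lambda>f. F f + G f) = (\<lambda>f. row i j F f + row i j G f)"
proof
  fix f
  have "(\<Sum>a<n. if f a = j then y * r a * (F (f(a := i)) + G (f(a := i))) else 0)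
    = (\<Sum>a<n. if f a = j then y * r a * F (f(a := i)) else 0) + (\<Sum>a<n. if f a = j then y * r a * G (f(a := i)) else 0)"
    by (subst sum.distrib[symmetric], rule sum.cong) (auto simp: distrib_left)
  then show "row i j (\<lambda>f. F f + G f) f = row i j F f + row i j G f"
    by (simp add: row_def d_add algebra_simps)
qed

lemma row_zero: "row i j (\<lambda>f. 0) = (\<lambda>f. 0)"
  by (rule ext) (simp add: row_def d_0 cong: if_cong)

lemma rows_add: "rows i \<sigma> (\<lambda>f. F f + G f) = (\<lambda>f. rows i \<sigma> F f + rows i \<sigma> G f)"
  by (induction i arbitrary: F G) (simp_all add: rows_Suc row_add)

lemma rows_zero: "rows i \<sigma> (\<lambda>f. 0) = (\<lambda>f. 0)"
  by (induction i) (simp_all add: rows_Suc row_zero)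

lemma rows_sum: "rows i \<sigma> (\<lambda>f. \<Sum>a\<in>A. F a f) = (\<lambda>f. \<Sum>a\<in>A. rows i \<sigma> (F a) f)"
  by (induction A rule: infinite_finite_induct) (simp_all add: rows_zero rows_add)

text \<open>Row k acts through e_{\<sigma> k, k}, which turns state k into state \<sigma> k. In
  normal order it meets the input state, so the factor b that it uses satisfies
  \<open>g b = k\<close>; injectivity says that no row is used twice.\<close>

definition valid :: "nat \<Rightarrow> (nat \<Rightarrow> nat) \<Rightarrow> nat set \<Rightarrow> (nat \<Rightarrow> nat) \<Rightarrow> bool" where
  "valid i \<sigma> B f \<longleftrightarrow> (\<forall>a. a \<notin> B \<longrightarrow> f a = g a) \<and> inj_on g B \<and> g ` B \<subseteq> {i..<N} \<and>
     (\<forall>b\<in>B. f b = \<sigma> (g b)) \<and> (\<forall>k\<in>{i..<N} - g ` B. \<sigma> k = k)"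

definition wt :: "nat \<Rightarrow> nat set \<Rightarrow> 'r" where
  "wt i B = (\<Prod>b\<in>B. - (y * r b)) * (\<Prod>k\<in>{i..<N} - g ` B. \<xi> k)"

text \<open>The normal ordered part, for the permutation \<open>\<sigma>\<close>, of the product of the rows \<open>i, \<dots>, N - 1\<close>: the
  rows in \<open>g ` B\<close> act on distinct tensor factors, the other rows contribute their diagonal term.\<close>

definition nrm :: "nat \<Rightarrow> (nat \<Rightarrow> nat) \<Rightarrow> (nat \<Rightarrow> nat) \<Rightarrow> 'r" where
  "nrm i \<sigma> f = (\<Sum>B\<in>Pow {..<n}. if valid i \<sigma> B f then wt i B else 0)"

text \<open>Each derivative falls on one pole, and r' = - r^2 duplicates it; so differentiation
  looks like one more action on a factor that is already in \<open>B\<close>.\<close>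

lemma d_wt: "finite B \<Longrightarrow> y * d (wt i B) = (\<Sum>a\<in>B. - (y * r a) * wt i B)"
  by (simp add: wt_def d_mult d_prod_r d_prod_xi sum_distrib_left sum_distrib_right algebra_simps)

lemma valid_skip:
  assumes "i < N" "i \<notin> g ` B"
  shows "valid i \<sigma> B f \<longleftrightarrow> \<sigma> i = i \<and> valid (Suc i) \<sigma> B f"
proof -
  have 1: "{i..<N} - g ` B = insert i ({Suc i..<N} - g ` B)" using assms by auto
  have "{i..<N} = insert i {Suc i..<N}" using assms by auto
  then have 2: "g ` B \<subseteq> {i..<N} \<longleftrightarrow> g ` B \<subseteq> {Suc i..<N}" using assms(2) by (simp add: subset_insert)
  show ?thesis unfolding valid_def 1 2 by auto
qed

lemma wt_skip:
  assumes "i < N" "i \<notin> g ` B"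
  shows "wt i B = \<xi> i * wt (Suc i) B"
proof -
  have 1: "{i..<N} - g ` B = insert i ({Suc i..<N} - g ` B)" using assms by auto
  show ?thesis unfolding wt_def 1 by (subst prod.insert) auto
qed

text \<open>Undoing the action of row i on factor a gives the state before it, which must be the
  untouched input at a because a lies outside \<open>B\<close>. This forces
  \<open>g a = i\<close>.\<close>

lemma valid_pick:
  assumes "i < N" "a \<notin> B"
  shows "g a = i \<and> valid i \<sigma> (insert a B) f \<longleftrightarrow> f a = \<sigma> i \<and> valid (Suc i) \<sigma> B (f(a := i))"
proof
  assume L: "g a = i \<and> valid i \<sigma> (insert a B) f"
  have nb: "g b \<noteq> i" if "b \<in> B" for b
    using L that assms(2) by (auto simp: valid_def inj_on_def)
  have 1: "{Suc i..<N} - g ` B = {i..<N} - g ` (insert a B)" using L by auto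
  have 2: "g ` B \<subseteq> {Suc i..<N}"
  proof
    fix k assume "k \<in> g ` B"
    then have "k \<noteq> i" "k \<in> {i..<N}" using L nb by (auto simp: valid_def)
    then show "k \<in> {Suc i..<N}" by auto
  qed
  have 3: "(f(a := i)) b = g b" if "b \<notin> B" for b
    using L that by (cases "b = a") (simp_all add: valid_def)
  have 4: "(f(a := i)) b = \<sigma> (g b)" if "b \<in> B" for b
  proof -
    have "b \<noteq> a" using that assms(2) by auto
    then show ?thesis using L that by (simp add: valid_def)
  qed
  have "inj_on g B" "f a = \<sigma> i" "\<forall>k\<in>{i..<N} - g ` (insert a B). \<sigma> k = k"
    using L by (simp_all add: valid_def)
  then show "f a = \<sigma> i \<and> valid (Suc i) \<sigma> B (f(a := i))"
    unfolding valid_def 1 using 2 3 4 by blast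
next
  assume R: "f a = \<sigma> i \<and> valid (Suc i) \<sigma> B (f(a := i))"
  have ga: "g a = i" using R assms(2) unfolding valid_def by (metis fun_upd_same)
  have 1: "{i..<N} - g ` (insert a B) = {Suc i..<N} - g ` B" using ga by auto
  have 2: "g ` insert a B \<subseteq> {i..<N}" "g a \<notin> g ` B"
    using R ga assms(1) by (auto simp: valid_def)
  then have "inj_on g (insert a B)" using R by (auto simp: valid_def)
  moreover have "f b = g b" if "b \<notin> insert a B" for b
    using R that by (simp add: valid_def) metis
  moreover have "f b = \<sigma> (g b)" if "b \<in> insert a B" for b
  proof (cases "b = a")
    case False
    moreover have "\<forall>b\<in>B. (f(a := i)) b = \<sigma> (g b)" using R unfolding valid_def by blast
    ultimately have "(f(a := i)) b = \<sigma> (g b)" using that by blast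
    then show ?thesis using False by simp
  qed (use R ga in simp)
  moreover have "\<forall>k\<in>{Suc i..<N} - g ` B. \<sigma> k = k" using R by (simp add: valid_def)
  ultimately show "g a = i \<and> valid i \<sigma> (insert a B) f"
    unfolding valid_def 1 using ga 2 by blast
qed

lemma wt_pick:
  assumes "g a = i" "a \<notin> B" "finite B"
  shows "wt i (insert a B) = - (y * r a) * wt (Suc i) B"
proof -
  have 1: "{i..<N} - g ` insert a B = {Suc i..<N} - g ` B" using assms by auto
  show ?thesis unfolding wt_def 1 using assms by (subst prod.insert) (auto simp: mult.assoc)
qed

text \<open>Composing \<open>\<sigma>\<close> with a transposition matches each derivative term with a contraction of opposite sign.\<close>

lemma valid_contract:
  assumes "i < N" "a \<in> B" "\<sigma> permutes {..<N}" "i < g a"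
  shows "\<sigma> i = i \<and> valid (Suc i) \<sigma> B f \<longleftrightarrow>
     f a = (\<sigma> \<circ> transpose i (g a)) i \<and> valid (Suc i) (\<sigma> \<circ> transpose i (g a)) B (f(a := i))"
proof -
  let ?\<tau> = "\<sigma> \<circ> transpose i (g a)"
  have t: "?\<tau> i = \<sigma> (g a)" "?\<tau> (g a) = \<sigma> i" by auto
  have o: "?\<tau> k = \<sigma> k" if "k \<noteq> i" "k \<noteq> g a" for k using that by (simp add: transpose_apply_other)
  have "(\<forall>b\<in>B. (f(a := i)) b = ?\<tau> (g b)) \<and> f a = ?\<tau> i \<longleftrightarrow> \<sigma> i = i \<and> (\<forall>b\<in>B. f b = \<sigma> (g b))"
    if I: "inj_on g B" and S: "g ` B \<subseteq> {Suc i..<N}"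
  proof -
    have *: "?\<tau> (g b) = \<sigma> (g b)" if "b \<in> B" "b \<noteq> a" for b
      using that I S assms(2) by (intro o) (auto simp: inj_on_def)
    show ?thesis using * t assms(2) by (auto split: if_splits)
  qed
  moreover have "(\<forall>k\<in>{Suc i..<N} - g ` B. ?\<tau> k = k) \<longleftrightarrow> (\<forall>k\<in>{Suc i..<N} - g ` B. \<sigma> k = k)"
    using o assms(2) by (intro ball_cong refl) (metis DiffE Suc_n_not_le_n atLeastLessThan_iff image_eqI)
  moreover have "(\<forall>b. b \<notin> B \<longrightarrow> (f(a := i)) b = g b) \<longleftrightarrow> (\<forall>b. b \<notin> B \<longrightarrow> f b = g b)"
    using assms(2) by auto
  ultimately show ?thesis unfolding valid_def by blast
qed

text \<open>Derivative terms of row i: the derivative duplicates the pole of a factor a used by a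
  row of larger index. \<open>contr2\<close> carries the same weight but arises when row i acts on
  such a factor; the relative sign will come from a transposition in \<sigma>.\<close>

definition contr1 :: "nat \<Rightarrow> nat \<Rightarrow> (nat \<Rightarrow> nat) \<Rightarrow> (nat \<Rightarrow> nat) \<Rightarrow> 'r" where
  "contr1 i a \<sigma> f = (\<Sum>B\<in>Pow ({..<n} - {a}). if \<sigma> i = i \<and> valid (Suc i) \<sigma> (insert a B) f
      then - (y * r a) * wt (Suc i) (insert a B) else 0)"

definition contr2 :: "nat \<Rightarrow> nat \<Rightarrow> (nat \<Rightarrow> nat) \<Rightarrow> (nat \<Rightarrow> nat) \<Rightarrow> 'r" where
  "contr2 i a \<sigma> f = (\<Sum>B\<in>Pow ({..<n} - {a}). if f a = \<sigma> i \<and> valid (Suc i) \<sigma> (insert a B) (f(a := i))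
      then - (y * r a) * wt (Suc i) (insert a B) else 0)"

text \<open>Row i is either idle, which forces \<sigma> i = i and contributes \<xi>, or it acts on a
  factor a, which is unique since g is injective on B.\<close>

lemma nrm_split:
  assumes "i < N"
  shows "nrm i \<sigma> f = (if \<sigma> i = i then \<xi> i * nrm (Suc i) \<sigma> f else 0)
     + (\<Sum>a<n. \<Sum>B\<in>Pow ({..<n} - {a}). if f a = \<sigma> i \<and> valid (Suc i) \<sigma> B (f(a := i))
          then - (y * r a) * wt (Suc i) B else 0)"
proof -
  have split: "(if valid i \<sigma> B f then wt i B else 0)
     = (if \<sigma> i = i \<and> valid (Suc i) \<sigma> B f then \<xi> i * wt (Suc i) B else 0)
       + (\<Sum>a\<in>B. if g a = i \<and> valid i \<sigma> B f then wt i B else 0)" if B: "B \<in> Pow {..<n}" for B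
  proof (cases "i \<in> g ` B")
    case False
    then have "(\<Sum>a\<in>B. if g a = i \<and> valid i \<sigma> B f then wt i B else 0) = 0"
      by (intro sum.neutral) auto
    then show ?thesis using False assms by (simp add: valid_skip wt_skip)
  next
    case True
    then have nv: "\<not> valid (Suc i) \<sigma> B f" by (auto simp: valid_def)
    show ?thesis
    proof (cases "valid i \<sigma> B f")
      case True
      obtain a where a: "a \<in> B" "g a = i" using \<open>i \<in> g ` B\<close> by auto
      have fin: "finite B" using B by (auto intro: finite_subset)
      have inj: "inj_on g B" using True by (simp add: valid_def)
      have "(\<Sum>c\<in>B. if g c = i \<and> valid i \<sigma> B f then wt i B else 0) = (\<Sum>c\<in>B. if c = a then wt i B else 0)"
        using True a inj by (intro sum.cong refl) (auto simp: inj_on_def)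
      then show ?thesis using nv True a fin by simp
    qed (use nv in simp)
  qed
  have "nrm i \<sigma> f = (\<Sum>B\<in>Pow {..<n}. if \<sigma> i = i \<and> valid (Suc i) \<sigma> B f then \<xi> i * wt (Suc i) B else 0)
       + (\<Sum>B\<in>Pow {..<n}. \<Sum>a\<in>B. if g a = i \<and> valid i \<sigma> B f then wt i B else 0)"
    unfolding nrm_def by (subst sum.distrib[symmetric], rule sum.cong[OF refl], rule split)
  also have "(\<Sum>B\<in>Pow {..<n}. if \<sigma> i = i \<and> valid (Suc i) \<sigma> B f then \<xi> i * wt (Suc i) B else 0)
      = (if \<sigma> i = i then \<xi> i * nrm (Suc i) \<sigma> f else 0)"
    by (auto simp: nrm_def sum_distrib_left intro!: sum.cong)
  also have "(\<Sum>B\<in>Pow {..<n}. \<Sum>a\<in>B. if g a = i \<and> valid i \<sigma> B f then wt i B else 0)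
      = (\<Sum>a<n. \<Sum>B\<in>Pow ({..<n} - {a}). if g a = i \<and> valid i \<sigma> (insert a B) f then wt i (insert a B) else 0)"
    by (rule sum_Pow_pick) simp
  also have "\<dots> = (\<Sum>a<n. \<Sum>B\<in>Pow ({..<n} - {a}). if f a = \<sigma> i \<and> valid (Suc i) \<sigma> B (f(a := i))
          then - (y * r a) * wt (Suc i) B else 0)"
  proof (intro sum.cong refl)
    fix a B assume "B \<in> Pow ({..<n} - {a})"
    then have B: "a \<notin> B" "finite B" by (auto intro: finite_subset)
    show "(if g a = i \<and> valid i \<sigma> (insert a B) f then wt i (insert a B) else 0)
        = (if f a = \<sigma> i \<and> valid (Suc i) \<sigma> B (f(a := i)) then - (y * r a) * wt (Suc i) B else 0)"
      using valid_pick[OF assms B(1), of \<sigma> f] wt_pick[OF _ B, of i] by auto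
  qed
  finally show ?thesis .
qed

text \<open>The diagonal term and the actions on fresh factors rebuild the normal ordered part; the
  derivative terms and the repeated actions remain.\<close>

lemma row_nrm:
  assumes "i < N"
  shows "row i (\<sigma> i) (nrm (Suc i) \<sigma>) f = nrm i \<sigma> f + (\<Sum>a<n. contr1 i a \<sigma> f + contr2 i a \<sigma> f)"
proof -
  have 1: "(if i = \<sigma> i then y * d (nrm (Suc i) \<sigma> f) else 0) = (\<Sum>a<n. contr1 i a \<sigma> f)"
  proof -
    have "(if i = \<sigma> i then y * d (nrm (Suc i) \<sigma> f) else 0)
        = (\<Sum>B\<in>Pow {..<n}. if \<sigma> i = i \<and> valid (Suc i) \<sigma> B f then y * d (wt (Suc i) B) else 0)"
      by (auto simp: nrm_def d_sum sum_distrib_left d_0 intro!: sum.cong)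
    also have "\<dots> = (\<Sum>B\<in>Pow {..<n}. \<Sum>a\<in>B. if \<sigma> i = i \<and> valid (Suc i) \<sigma> B f then - (y * r a) * wt (Suc i) B else 0)"
      by (intro sum.cong refl) (auto simp: d_wt finite_subset[of _ "{..<n}"])
    also have "\<dots> = (\<Sum>a<n. contr1 i a \<sigma> f)"
      unfolding contr1_def by (rule sum_Pow_pick) simp
    finally show ?thesis .
  qed
  have 2: "- (if f a = \<sigma> i then y * r a * nrm (Suc i) \<sigma> (f(a := i)) else 0)
      = (\<Sum>B\<in>Pow ({..<n} - {a}). if f a = \<sigma> i \<and> valid (Suc i) \<sigma> B (f(a := i))
          then - (y * r a) * wt (Suc i) B else 0) + contr2 i a \<sigma> f" if "a < n" for a
  proof -
    have "- (if f a = \<sigma> i then y * r a * nrm (Suc i) \<sigma> (f(a := i)) else 0)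
        = (\<Sum>B\<in>Pow {..<n}. if f a = \<sigma> i \<and> valid (Suc i) \<sigma> B (f(a := i)) then - (y * r a) * wt (Suc i) B else 0)"
      by (auto simp: nrm_def sum_distrib_left simp flip: sum_negf intro!: sum.cong)
    \<comment> \<open>Sets that avoid a belong to the normal ordered part; sets that contain a are
      the contractions.\<close>
    then show ?thesis using that by (simp only: sum_Pow_split[of a "{..<n}"] contr2_def lessThan_iff finite_lessThan)
  qed
  have "row i (\<sigma> i) (nrm (Suc i) \<sigma>) f = (if \<sigma> i = i then \<xi> i * nrm (Suc i) \<sigma> f else 0)
     + (if i = \<sigma> i then y * d (nrm (Suc i) \<sigma> f) else 0)
     + (\<Sum>a<n. - (if f a = \<sigma> i then y * r a * nrm (Suc i) \<sigma> (f(a := i)) else 0))"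
    unfolding row_def by (auto simp: sum_negf)
  also have "(\<Sum>a<n. - (if f a = \<sigma> i then y * r a * nrm (Suc i) \<sigma> (f(a := i)) else 0))
    = (\<Sum>a<n. (\<Sum>B\<in>Pow ({..<n} - {a}). if f a = \<sigma> i \<and> valid (Suc i) \<sigma> B (f(a := i))
          then - (y * r a) * wt (Suc i) B else 0) + contr2 i a \<sigma> f)"
    by (rule sum.cong[OF refl], rule 2) simp
  finally show ?thesis unfolding 1 nrm_split[OF assms, of \<sigma> f] by (simp add: sum.distrib algebra_simps)
qed

lemma contr_cancel:
  assumes "i < N"
  shows "(\<Sum>\<sigma>\<in>{\<sigma>. \<sigma> permutes {..<N}}. of_int (sign \<sigma>) * rows i \<sigma> (contr1 i a \<sigma>) f)
   + (\<Sum>\<sigma>\<in>{\<sigma>. \<sigma> permutes {..<N}}. of_int (sign \<sigma>) * rows i \<sigma> (contr2 i a \<sigma>) f) = 0"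
proof (cases "Suc i \<le> g a \<and> g a < N")
  \<comment> \<open>A contraction on a needs a later row that uses a, that is, i < g a < N.
    Otherwise both families vanish.\<close>
  case False
  then have nv: "\<not> valid (Suc i) \<sigma> (insert a B) f" for \<sigma> B f by (auto simp: valid_def)
  have "contr1 i a = (\<lambda>\<sigma> f. 0)" "contr2 i a = (\<lambda>\<sigma> f. 0)"
    unfolding contr1_def contr2_def by (auto simp: nv)
  then show ?thesis by (simp add: rows_zero)
next
  case True
  \<comment> \<open>The rows i and g a exchange their targets under \<sigma>.\<close>
  let ?t = "transpose i (g a)"
  have *: "rows i \<sigma> (contr1 i a \<sigma>) f = rows i (\<sigma> \<circ> ?t) (contr2 i a (\<sigma> \<circ> ?t)) f"
    if "\<sigma> permutes {..<N}" for \<sigma>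
  proof -
    have "contr1 i a \<sigma> = contr2 i a (\<sigma> \<circ> ?t)"
      unfolding contr1_def contr2_def
      by (rule ext, intro sum.cong refl if_cong valid_contract) (use assms True that in auto)
    moreover have "rows i \<sigma> F = rows i (\<sigma> \<circ> ?t) F" for F
      by (rule rows_cong) (use True in \<open>auto simp: transpose_apply_other\<close>)
    ultimately show ?thesis by simp
  qed
  have "(\<Sum>\<sigma>\<in>{\<sigma>. \<sigma> permutes {..<N}}. of_int (sign \<sigma>) * rows i \<sigma> (contr1 i a \<sigma>) f)
     = (\<Sum>\<sigma>\<in>{\<sigma>. \<sigma> permutes {..<N}}. of_int (sign \<sigma>) * rows i (\<sigma> \<circ> ?t) (contr2 i a (\<sigma> \<circ> ?t)) f)"
    by (intro sum.cong refl) (simp add: *)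
  also have "\<dots> = - (\<Sum>\<sigma>\<in>{\<sigma>. \<sigma> permutes {..<N}}. of_int (sign \<sigma>) * rows i \<sigma> (contr2 i a \<sigma>) f)"
    using True assms by (intro sum_sign_flip[where F = "\<lambda>\<sigma>. rows i \<sigma> (contr2 i a \<sigma>) f"]) auto
  finally show ?thesis by simp
qed

text \<open>Absorbs one more row into the normal ordered part. The extra terms cancel only after the
  signed sum over \<sigma>.\<close>

lemma sum_rows_nrm_step:
  assumes "i < N"
  shows "(\<Sum>\<sigma>\<in>{\<sigma>. \<sigma> permutes {..<N}}. of_int (sign \<sigma>) * rows (Suc i) \<sigma> (nrm (Suc i) \<sigma>) f)
       = (\<Sum>\<sigma>\<in>{\<sigma>. \<sigma> permutes {..<N}}. of_int (sign \<sigma>) * rows i \<sigma> (nrm i \<sigma>) f)"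
proof -
  have e: "rows (Suc i) \<sigma> (nrm (Suc i) \<sigma>) f = rows i \<sigma> (nrm i \<sigma>) f
      + (\<Sum>a<n. rows i \<sigma> (contr1 i a \<sigma>) f + rows i \<sigma> (contr2 i a \<sigma>) f)" for \<sigma>
  proof -
    have "row i (\<sigma> i) (nrm (Suc i) \<sigma>) = (\<lambda>f. nrm i \<sigma> f + (\<Sum>a<n. contr1 i a \<sigma> f + contr2 i a \<sigma> f))"
      using row_nrm[OF assms] by blast
    then show ?thesis by (simp add: rows_Suc rows_add rows_sum)
  qed
  have "(\<Sum>\<sigma>\<in>{\<sigma>. \<sigma> permutes {..<N}}. of_int (sign \<sigma>) *
         (\<Sum>a<n. rows i \<sigma> (contr1 i a \<sigma>) f + rows i \<sigma> (contr2 i a \<sigma>) f))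
      = (\<Sum>a<n. (\<Sum>\<sigma>\<in>{\<sigma>. \<sigma> permutes {..<N}}. of_int (sign \<sigma>) * rows i \<sigma> (contr1 i a \<sigma>) f)
   + (\<Sum>\<sigma>\<in>{\<sigma>. \<sigma> permutes {..<N}}. of_int (sign \<sigma>) * rows i \<sigma> (contr2 i a \<sigma>) f))"
    by (subst sum.distrib[symmetric], subst sum.swap) (simp add: sum_distrib_left distrib_left)
  also have "\<dots> = 0" by (simp add: contr_cancel[OF assms])
  finally show ?thesis by (simp add: e distrib_left sum.distrib)
qed

lemma nrm_top: "nrm N \<sigma> f = (if f = g then 1 else 0)"
proof -
  have "valid N \<sigma> B f \<longleftrightarrow> B = {} \<and> f = g" for B by (auto simp: valid_def)
  then have "nrm N \<sigma> f = (\<Sum>B\<in>Pow {..<n}. if B = {} then (if f = g then 1 else 0) else 0)"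
    unfolding nrm_def by (intro sum.cong refl) (auto simp: wt_def)
  then show ?thesis by simp
qed

text \<open>Relabelling by g turns permutations \<pi> of the factors in B into permutations \<sigma>
  of the row indices g(B) that fix all other rows, and it preserves signs. If g is not injective on
  B, no \<sigma> is valid and the antisymmetrizer vanishes too.\<close>

lemma sum_sign_valid:
  assumes "B \<subseteq> {..<n}" "g ` {..<n} \<subseteq> {..<N}"
  shows "(\<Sum>\<sigma>\<in>{\<sigma>. \<sigma> permutes {..<N}}. if valid 0 \<sigma> B f then sign \<sigma> else 0) = alt B f g"
proof (cases "inj_on g B")
  case True
  have fin: "finite B" using assms by (auto intro: finite_subset)
  let ?m = "map_permutation B g"
  let ?m' = "map_permutation (g ` B) (inv_into B g)"
  have gB: "g ` B \<subseteq> {..<N}" using assms by auto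
  have bij: "bij_betw g B (g ` B)" "bij_betw (inv_into B g) (g ` B) B"
    using True by (auto simp: bij_betw_def inj_on_inv_into)
  have perm: "?m \<pi> permutes {..<N}" "valid 0 (?m \<pi>) B f" "?m' (?m \<pi>) = \<pi>"
     if p: "\<pi> permutes B" and f: "f = g \<circ> \<pi>" for \<pi>
  proof -
    have mp: "?m \<pi> permutes (g ` B)" by (rule map_permutation_permutes[OF bij(1) p])
    then show "?m \<pi> permutes {..<N}" using gB by (rule permutes_subset)
    show "valid 0 (?m \<pi>) B f" unfolding valid_def
      using True gB f permutes_not_in[OF p] permutes_not_in[OF mp]
      by (auto simp: map_permutation_apply[OF True])
    show "?m' (?m \<pi>) = \<pi>"
      by (rule map_permutation_compose_inv[OF bij(1) p]) (use True in auto)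
  qed
  have bk: "?m' \<sigma> permutes B" "f = g \<circ> ?m' \<sigma>" "?m (?m' \<sigma>) = \<sigma>"
    if s: "\<sigma> permutes {..<N}" and vl: "valid 0 \<sigma> B f" for \<sigma>
  proof -
    have sB: "\<sigma> permutes (g ` B)"
    proof (rule permutes_superset[OF s])
      show "\<sigma> k = k" if "k \<in> {..<N} - g ` B" for k using vl that by (auto simp: valid_def)
    qed
    show pm: "?m' \<sigma> permutes B" by (rule map_permutation_permutes[OF bij(2) sB])
    show "?m (?m' \<sigma>) = \<sigma>"
      by (rule map_permutation_compose_inv[OF bij(2) sB]) (auto simp: f_inv_into_f)
    show "f = g \<circ> ?m' \<sigma>"
    proof
      fix b show "f b = (g \<circ> ?m' \<sigma>) b"
      proof (cases "b \<in> B")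
        case b: True
        have "?m' \<sigma> (inv_into B g (g b)) = inv_into B g (\<sigma> (g b))"
          by (rule map_permutation_apply) (use b in \<open>auto simp: inj_on_inv_into\<close>)
        moreover have "inv_into B g (g b) = b" using True b by simp
        moreover have "\<sigma> (g b) \<in> g ` B" using permutes_in_image[OF sB] b by blast
        ultimately show ?thesis using vl b by (simp add: valid_def f_inv_into_f)
      next
        case False
        then show ?thesis using vl permutes_not_in[OF pm False] by (simp add: valid_def)
      qed
    qed
  qed
  have sg: "sign (?m \<pi>) = sign \<pi>" if "\<pi> permutes B" for \<pi>
    by (rule sign_map_permutation[OF True that fin])
  have "(\<Sum>\<sigma>\<in>{\<sigma>. \<sigma> permutes {..<N}}. if valid 0 \<sigma> B f then sign \<sigma> else 0)
      = (\<Sum>\<sigma>\<in>{\<sigma>. \<sigma> permutes {..<N} \<and> valid 0 \<sigma> B f}. sign \<sigma>)"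
    by (simp add: sum.If_cases finite_permutations Collect_conj_eq)
  also have "\<dots> = (\<Sum>\<pi>\<in>{\<pi>. \<pi> permutes B \<and> f = g \<circ> \<pi>}. sign \<pi>)"
    by (rule sum.reindex_bij_witness[where j = ?m' and i = ?m])
       (use perm bk sg in \<open>auto simp: sg[symmetric]\<close>)
  also have "\<dots> = alt B f g"
    unfolding alt_def by (simp add: sum.If_cases finite_permutations[OF fin] Collect_conj_eq)
  finally show ?thesis .
next
  case False
  have "finite B" using assms by (auto intro: finite_subset)
  then have "alt B f g = 0" using False by (rule alt_eq_0_if_not_inj)
  moreover have "\<not> valid 0 \<sigma> B f" for \<sigma> using False by (simp add: valid_def)
  ultimately show ?thesis by simp
qed

theorem sum_rows_eq:
  assumes "g ` {..<n} \<subseteq> {..<N}"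
  shows "(\<Sum>\<sigma>\<in>{\<sigma>. \<sigma> permutes {..<N}}. of_int (sign \<sigma>) * rows N \<sigma> (\<lambda>f. if f = g then 1 else 0) f)
     = (\<Sum>B\<in>Pow {..<n}. of_int (alt B f g) * wt 0 B)"
proof -
  \<comment> \<open>At i = N this is the row determinant itself, at i = 0 everything is normal
    ordered.\<close>
  have "i \<le> N \<Longrightarrow> (\<Sum>\<sigma>\<in>{\<sigma>. \<sigma> permutes {..<N}}. of_int (sign \<sigma>) * rows i \<sigma> (nrm i \<sigma>) f)
       = (\<Sum>\<sigma>\<in>{\<sigma>. \<sigma> permutes {..<N}}. of_int (sign \<sigma>) * nrm 0 \<sigma> f)" for i
    by (induction i) (simp_all add: sum_rows_nrm_step)
  from this[of N] have "(\<Sum>\<sigma>\<in>{\<sigma>. \<sigma> permutes {..<N}}. of_int (sign \<sigma>) * rows N \<sigma> (nrm N \<sigma>) f)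
       = (\<Sum>\<sigma>\<in>{\<sigma>. \<sigma> permutes {..<N}}. of_int (sign \<sigma>) * nrm 0 \<sigma> f)" by simp
  moreover have "nrm N \<sigma> = (\<lambda>f. if f = g then 1 else 0)" for \<sigma> using nrm_top by blast
  ultimately have "(\<Sum>\<sigma>\<in>{\<sigma>. \<sigma> permutes {..<N}}. of_int (sign \<sigma>) * rows N \<sigma> (\<lambda>f. if f = g then 1 else 0) f)
       = (\<Sum>\<sigma>\<in>{\<sigma>. \<sigma> permutes {..<N}}. of_int (sign \<sigma>) * nrm 0 \<sigma> f)" by simp
  also have "\<dots> = (\<Sum>B\<in>Pow {..<n}. \<Sum>\<sigma>\<in>{\<sigma>. \<sigma> permutes {..<N}}.
       of_int (if valid 0 \<sigma> B f then sign \<sigma> else 0) * wt 0 B)"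
    unfolding nrm_def sum_distrib_left
    by (subst sum.swap, intro sum.cong refl) auto
  also have "\<dots> = (\<Sum>B\<in>Pow {..<n}. of_int (alt B f g) * wt 0 B)"
  proof (intro sum.cong refl)
    fix B assume "B \<in> Pow {..<n}"
    then have "of_int (alt B f g) = (\<Sum>\<sigma>\<in>{\<sigma>. \<sigma> permutes {..<N}}. of_int (if valid 0 \<sigma> B f then sign \<sigma> else 0) :: 'r)"
      using sum_sign_valid[OF _ assms, of B f] by (subst of_int_sum[symmetric]) simp
    then show "(\<Sum>\<sigma>\<in>{\<sigma>. \<sigma> permutes {..<N}}. of_int (if valid 0 \<sigma> B f then sign \<sigma> else 0) * wt 0 B)
       = of_int (alt B f g) * wt 0 B"
      by (simp only: sum_distrib_right)
  qed
  finally show ?thesis .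
qed

end

section \<open>Partial fractions\<close>

text \<open>For a in B, the residue at u = z_a of the product of the 1/(u - z_b) over B.\<close>

definition pfc :: "(nat \<Rightarrow> complex) \<Rightarrow> nat \<Rightarrow> nat set \<Rightarrow> complex" where
  "pfc z a B = (\<Prod>b\<in>B - {a}. 1 / (z a - z b))"

lemma pfc_insert:
  assumes "finite B" "e \<notin> B" "a \<noteq> e"
  shows "pfc z a (insert e B) = pfc z a B / (z a - z e)"
proof -
  have "insert e B - {a} = insert e (B - {a})" using assms by auto
  then show ?thesis using assms by (simp add: pfc_def)
qed

lemma pfc_insert_self: "e \<notin> B \<Longrightarrow> pfc z e (insert e B) = (\<Prod>b\<in>B. 1 / (z e - z b))"
  by (simp add: pfc_def)

lemma divide_diff_swap: "(x::complex) / (p - q) = - (x / (q - p))"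
  by (subst minus_diff_eq[symmetric]) (rule divide_minus_right)

text \<open>Multiplying the expansion for B by 1/(u - z_e) and splitting each product leaves a
  constant that is the same expansion at u = z_e; this is why the induction keeps u
  arbitrary.\<close>

lemma partial_fractions:
  assumes "finite B" "B \<noteq> {}" "inj_on z B" "u \<notin> z ` B"
  shows "(\<Prod>b\<in>B. 1 / (u - z b)) = (\<Sum>a\<in>B. pfc z a B / (u - z a))"
  using assms
proof (induction B arbitrary: u rule: finite_ne_induct)
  case (singleton x)
  then show ?case by (simp add: pfc_def)
next
  case (insert e B)
  have u: "u \<noteq> z e" "u \<notin> z ` B" and ze: "z e \<notin> z ` B" and inj: "inj_on z B" using insert by auto
  have *: "pfc z a B / (z a - z e) / (u - z a)
      = (pfc z a B / (u - z a) - pfc z a B / (z e - z a)) / (u - z e)" if "a \<in> B" for a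
  proof -
    have "z a \<noteq> z e" "u \<noteq> z a" using that ze u by (auto simp: image_iff)
    then show ?thesis using u by (simp add: divide_simps) (simp add: algebra_simps)
  qed
  have "(\<Sum>a\<in>insert e B. pfc z a (insert e B) / (u - z a))
      = (\<Prod>b\<in>B. 1 / (z e - z b)) / (u - z e) + (\<Sum>a\<in>B. pfc z a (insert e B) / (u - z a))"
    using insert by (simp add: pfc_insert_self)
  also have "(\<Sum>a\<in>B. pfc z a (insert e B) / (u - z a)) = (\<Sum>a\<in>B. pfc z a B / (z a - z e) / (u - z a))"
    using insert by (intro sum.cong refl) (subst pfc_insert, auto)
  also have "\<dots> = ((\<Sum>a\<in>B. pfc z a B / (u - z a)) - (\<Sum>a\<in>B. pfc z a B / (z e - z a))) / (u - z e)"
    by (simp only: * sum_divide_distrib[symmetric] sum_subtractf cong: sum.cong)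
  also have "(\<Sum>a\<in>B. pfc z a B / (u - z a)) = (\<Prod>b\<in>B. 1 / (u - z b))"
    using insert.IH[OF inj u(2)] by simp
  also have "(\<Sum>a\<in>B. pfc z a B / (z e - z a)) = (\<Prod>b\<in>B. 1 / (z e - z b))"
    using insert.IH[OF inj ze] by simp
  finally show ?case using insert u by (simp add: diff_divide_distrib)
qed

text \<open>Formally the negated derivative of \<open>partial_fractions\<close> in u. The induction
  is algebraic and uses that lemma both at u and at z_e.\<close>

lemma partial_fractions_double:
  assumes "finite B" "B \<noteq> {}" "inj_on z B" "u \<notin> z ` B"
  shows "(\<Sum>a\<in>B. pfc z a B / (u - z a)\<^sup>2) = (\<Prod>b\<in>B. 1 / (u - z b)) * (\<Sum>b\<in>B. 1 / (u - z b))"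
  using assms
proof (induction B arbitrary: u rule: finite_ne_induct)
  case (singleton x)
  then show ?case by (simp add: pfc_def power2_eq_square)
next
  case (insert e B)
  have u: "u \<noteq> z e" "u \<notin> z ` B" and ze: "z e \<notin> z ` B" and inj: "inj_on z B" using insert by auto
  let ?v = "1 / (u - z e)" and ?p = "\<Prod>b\<in>B. 1 / (u - z b)" and ?q = "\<Prod>b\<in>B. 1 / (z e - z b)"
  have *: "pfc z a B / (z a - z e) / (u - z a)\<^sup>2
      = ?v * (pfc z a B / (u - z a)\<^sup>2) + ?v\<^sup>2 * (pfc z a B / (u - z a)) - ?v\<^sup>2 * (pfc z a B / (z e - z a))"
    if "a \<in> B" for a
  proof -
    have ne: "z a - z e \<noteq> 0" "u - z a \<noteq> 0" "u - z e \<noteq> 0" "z e - z a \<noteq> 0"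
      using that ze u by (auto simp: image_iff)
    have "inverse (u - z a) * inverse (z a - z e) = inverse (u - z e) * (inverse (z a - z e) + inverse (u - z a))"
      using ne by (simp add: inverse_add)
    moreover have "inverse (z e - z a) = - inverse (z a - z e)"
      using inverse_minus_eq[of "z a - z e"] by simp
    \<comment> \<open>P, Q, R, V stand for the inverses of u - z_a, z_a - z_e, z_e - z_a and u -
      z_e.\<close>
    moreover have "c * Q * P\<^sup>2 = V * (c * P\<^sup>2) + V\<^sup>2 * (c * P) - V\<^sup>2 * (c * R)"
      if "P * Q = V * (Q + P)" "R = - Q" for c P Q R V :: complex
    proof -
      have "c * Q * P\<^sup>2 = c * P * (P * Q)" by (simp add: power2_eq_square)
      also have "\<dots> = c * P * (V * (Q + P))" by (simp only: that(1))
      also have "\<dots> = V * (c * P\<^sup>2) + V * c * (P * Q)" by (simp add: algebra_simps power2_eq_square)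
      also have "V * c * (P * Q) = V\<^sup>2 * (c * P) - V\<^sup>2 * (c * R)"
        unfolding that by (simp add: algebra_simps power2_eq_square)
      finally show ?thesis by simp
    qed
    ultimately show ?thesis unfolding divide_inverse power_inverse[symmetric] mult_1_left by blast
  qed
  have "(\<Sum>a\<in>insert e B. pfc z a (insert e B) / (u - z a)\<^sup>2)
      = ?q * ?v\<^sup>2 + (\<Sum>a\<in>B. pfc z a (insert e B) / (u - z a)\<^sup>2)"
    using insert by (simp add: pfc_insert_self power_divide)
  also have "(\<Sum>a\<in>B. pfc z a (insert e B) / (u - z a)\<^sup>2) = (\<Sum>a\<in>B. pfc z a B / (z a - z e) / (u - z a)\<^sup>2)"
    using insert by (intro sum.cong refl) (subst pfc_insert, auto)
  also have "\<dots> = ?v * (\<Sum>a\<in>B. pfc z a B / (u - z a)\<^sup>2) + ?v\<^sup>2 * (\<Sum>a\<in>B. pfc z a B / (u - z a))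
      - ?v\<^sup>2 * (\<Sum>a\<in>B. pfc z a B / (z e - z a))"
    by (simp only: * sum_distrib_left sum_subtractf sum.distrib cong: sum.cong)
  also have "(\<Sum>a\<in>B. pfc z a B / (u - z a)\<^sup>2) = ?p * (\<Sum>b\<in>B. 1 / (u - z b))"
    using insert.IH[OF inj u(2)] .
  also have "(\<Sum>a\<in>B. pfc z a B / (u - z a)) = ?p"
    using partial_fractions[OF insert.hyps(1,2) inj u(2)] by simp
  also have "(\<Sum>a\<in>B. pfc z a B / (z e - z a)) = ?q"
    using partial_fractions[OF insert.hyps(1,2) inj ze] by simp
  finally have "(\<Sum>a\<in>insert e B. pfc z a (insert e B) / (u - z a)\<^sup>2)
      = ?v * (?p * (\<Sum>b\<in>B. 1 / (u - z b))) + ?v\<^sup>2 * ?p" by simp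
  also have "\<dots> = (?v * ?p) * (?v + (\<Sum>b\<in>B. 1 / (u - z b)))"
    by (simp only: power2_eq_square distrib_left ac_simps)
  finally show ?case using insert.hyps(1,3) by simp
qed

text \<open>These are all residues of a rational function that is O(u^(-2)) at infinity, as there
  are at least two poles. Concretely, the expansion over B at u = z_e yields the residue at
  z_e.\<close>

lemma pfc_sum_eq_0:
  assumes "finite B" "B \<noteq> {}" "inj_on z (insert e B)" "e \<notin> B"
  shows "(\<Sum>a\<in>insert e B. pfc z a (insert e B)) = 0"
proof -
  have ze: "z e \<notin> z ` B" "inj_on z B" using assms by auto
  have "(\<Sum>a\<in>insert e B. pfc z a (insert e B)) = (\<Prod>b\<in>B. 1 / (z e - z b)) + (\<Sum>a\<in>B. pfc z a B / (z a - z e))"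
    using assms by (simp add: pfc_insert_self) (intro sum.cong refl, subst pfc_insert, auto)
  also have "(\<Prod>b\<in>B. 1 / (z e - z b)) = (\<Sum>a\<in>B. pfc z a B / (z e - z a))"
    by (rule partial_fractions) (use assms ze in auto)
  also have "\<dots> = - (\<Sum>a\<in>B. pfc z a B / (z a - z e))"
    unfolding sum_negf[symmetric] by (intro sum.cong refl divide_diff_swap)
  finally show ?thesis by simp
qed

text \<open>This cancellation is the equality of the two expressions for the derivative at \<open>u = z a\<close>
  of the product of the \<open>1 / (u - z b)\<close>, before and after partial fraction expansion.\<close>

lemma pfc_pair_sum_eq_0:
  assumes "finite C" "inj_on z (insert a C)" "a \<notin> C"
  shows "(\<Sum>b\<in>C. (pfc z a (insert a C) + pfc z b (insert a C)) / (z a - z b)) = 0"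
proof (cases "C = {}")
  case False
  have za: "z a \<notin> z ` C" "inj_on z C" using assms by auto
  have "(\<Sum>b\<in>C. (pfc z a (insert a C) + pfc z b (insert a C)) / (z a - z b))
      = (\<Sum>b\<in>C. (\<Prod>b\<in>C. 1 / (z a - z b)) * (1 / (z a - z b)) - pfc z b C / (z a - z b)\<^sup>2)"
  proof (intro sum.cong refl)
    fix b assume b: "b \<in> C"
    then have "z b \<noteq> z a" "b \<noteq> a" using za assms(3) by (auto simp: image_iff)
    then have "pfc z b (insert a C) / (z a - z b) = - (pfc z b C / (z a - z b)\<^sup>2)"
      using assms by (simp add: pfc_insert power2_eq_square divide_diff_swap[of _ "z b" "z a"])
    then show "(pfc z a (insert a C) + pfc z b (insert a C)) / (z a - z b)
       = (\<Prod>b\<in>C. 1 / (z a - z b)) * (1 / (z a - z b)) - pfc z b C / (z a - z b)\<^sup>2"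
      by (simp add: add_divide_distrib pfc_insert_self[OF assms(3)])
  qed
  also have "\<dots> = 0"
    using partial_fractions_double[OF assms(1) False za(2,1)] by (simp add: sum_subtractf sum_distrib_left)
  finally show ?thesis .
qed simp

text \<open>The later series are formal in u^(-1), so no complex value of u is at hand. Here r
  stands for the poles, \<kappa> embeds the constants, and the rule for a product of two poles
  drives the expansion.\<close>

lemma prod_partial_fractions:
  fixes r :: "nat \<Rightarrow> 'r::comm_ring_1" and \<kappa> :: "complex \<Rightarrow> 'r"
  assumes "finite B" "B \<noteq> {}" "inj_on z B"
    and add: "\<And>x y. \<kappa> (x + y) = \<kappa> x + \<kappa> y" and mult: "\<And>x y. \<kappa> (x * y) = \<kappa> x * \<kappa> y" and one: "\<kappa> 1 = 1"
    and rr: "\<And>a b. a \<in> B \<Longrightarrow> b \<in> B \<Longrightarrow> a \<noteq> b \<Longrightarrow> r a * r b = \<kappa> (1 / (z a - z b)) * (r a - r b)"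
  shows "(\<Prod>b\<in>B. r b) = (\<Sum>a\<in>B. \<kappa> (pfc z a B) * r a)"
  using assms(1,2,3) rr
proof (induction B rule: finite_ne_induct)
  case (singleton x)
  then show ?case by (simp add: pfc_def one)
next
  case (insert e B)
  have ze: "z e \<notin> z ` B" and inj: "inj_on z B" using insert by auto
  have zero: "\<kappa> 0 = 0" using add[of 0 0] by simp
  have neg: "\<kappa> (- x) = - \<kappa> x" for x using add[of x "- x"] zero by (simp add: eq_neg_iff_add_eq_0 add.commute)
  have sm: "\<kappa> (sum h A) = (\<Sum>a\<in>A. \<kappa> (h a))" for h and A :: "nat set"
    by (induction A rule: infinite_finite_induct) (simp_all add: zero add)
  have *: "\<kappa> (pfc z a B) * r a * r e = \<kappa> (pfc z a (insert e B)) * r a + \<kappa> (pfc z a B / (z e - z a)) * r e"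
    if "a \<in> B" for a
  proof -
    have ae: "a \<noteq> e" using that insert by auto
    have "\<kappa> (pfc z a B) * r a * r e = \<kappa> (pfc z a B * (1 / (z a - z e))) * (r a - r e)"
      unfolding mult using insert.prems(2)[of a e] that ae by (simp add: mult.assoc)
    also have "pfc z a B * (1 / (z a - z e)) = pfc z a (insert e B)"
      using insert ae by (simp add: pfc_insert)
    finally have 1: "\<kappa> (pfc z a B) * r a * r e = \<kappa> (pfc z a (insert e B)) * r a - \<kappa> (pfc z a (insert e B)) * r e"
      by (simp only: right_diff_distrib)
    have "\<kappa> (pfc z a (insert e B)) = - \<kappa> (pfc z a B / (z e - z a))"
      using insert ae unfolding neg[symmetric] by (simp add: pfc_insert divide_diff_swap[of _ "z a" "z e"])
    then have 2: "\<kappa> (pfc z a (insert e B)) * r e = - (\<kappa> (pfc z a B / (z e - z a)) * r e)" by simp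
    show ?thesis unfolding 1 2 by simp
  qed
  have "(\<Prod>b\<in>insert e B. r b) = (\<Sum>a\<in>B. \<kappa> (pfc z a B) * r a) * r e"
    using insert.IH[OF inj] insert.prems(2) insert.hyps by (simp add: mult.commute)
  also have "\<dots> = (\<Sum>a\<in>B. \<kappa> (pfc z a (insert e B)) * r a) + \<kappa> (\<Sum>a\<in>B. pfc z a B / (z e - z a)) * r e"
    by (simp add: sum_distrib_right * sum.distrib sm)
  also have "(\<Sum>a\<in>B. pfc z a B / (z e - z a)) = pfc z e (insert e B)"
    using partial_fractions[OF insert.hyps(1,2) inj ze] insert.hyps(3) by (simp add: pfc_insert_self)
  finally show ?case using insert.hyps by (simp add: add.commute)
qed

section \<open>Symmetry and recursion of the antisymmetrizers\<close>

lemma alt_empty: "alt {} f g = (if f = g then 1 else 0)"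
  by (simp add: alt_def sign_id cong: if_cong)

lemma comp_transpose_cancel [simp]: "f \<circ> transpose a b \<circ> transpose a b = f"
  by (simp add: comp_assoc)

lemma comp_transpose_eq_iff: "f \<circ> transpose a b = h \<circ> transpose a b \<longleftrightarrow> f = h"
proof
  assume "f \<circ> transpose a b = h \<circ> transpose a b"
  then have "f \<circ> transpose a b \<circ> transpose a b = h \<circ> transpose a b \<circ> transpose a b"
    by (rule arg_cong[where f = "\<lambda>k. k \<circ> transpose a b"])
  then show "f = h" by (simp only: comp_transpose_cancel)
qed simp

lemma alt_transpose:
  assumes "a \<in> B" "b \<in> B" "a \<noteq> b" "finite B"
  shows "alt B (f \<circ> transpose a b) g = - alt B f g"
proof -
  let ?t = "transpose a b"
  have p: "?t permutes B" using assms by (simp add: permutes_swap_id)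
  have s: "sign (\<pi> \<circ> ?t) = - sign \<pi>" if "\<pi> permutes B" for \<pi>
    using that assms p by (subst sign_compose) (auto intro: permutes_imp_permutation simp: sign_swap_id)
  have "alt B (f \<circ> ?t) g = (\<Sum>\<pi>\<in>{\<pi>. \<pi> permutes B}. if f \<circ> ?t = g \<circ> (\<pi> \<circ> ?t) then sign (\<pi> \<circ> ?t) else 0)"
    unfolding alt_def
    by (rule sum.reindex_bij_witness[where i = "\<lambda>\<pi>. \<pi> \<circ> ?t" and j = "\<lambda>\<pi>. \<pi> \<circ> ?t"])
       (auto intro: permutes_compose[OF p])
  also have "\<dots> = (\<Sum>\<pi>\<in>{\<pi>. \<pi> permutes B}. - (if f = g \<circ> \<pi> then sign \<pi> else 0))"
  proof (intro sum.cong refl)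
    fix \<pi> assume "\<pi> \<in> {\<pi>. \<pi> permutes B}"
    moreover have "f \<circ> ?t = g \<circ> (\<pi> \<circ> ?t) \<longleftrightarrow> f = g \<circ> \<pi>"
      unfolding comp_assoc[symmetric] by (rule comp_transpose_eq_iff)
    ultimately show "(if f \<circ> ?t = g \<circ> (\<pi> \<circ> ?t) then sign (\<pi> \<circ> ?t) else 0) = - (if f = g \<circ> \<pi> then sign \<pi> else 0)"
      by (simp add: s)
  qed
  also have "\<dots> = - alt B f g" by (simp add: alt_def sum_negf)
  finally show ?thesis .
qed

lemma permutes_conj_transpose:
  assumes "q permutes C" "b \<in> C" "a \<notin> C"
  shows "transpose a b \<circ> q \<circ> transpose a b permutes insert a (C - {b})"
proof -
  let ?t = "transpose a b"
  have t: "?t permutes insert a C" using assms(2) by (intro permutes_swap_id) auto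
  have "q permutes insert a C" by (rule permutes_subset[OF assms(1)]) auto
  then have "?t \<circ> q \<circ> ?t permutes insert a C" by (intro permutes_compose t)
  then show ?thesis
  proof (rule permutes_superset)
    fix x assume "x \<in> insert a C - insert a (C - {b})"
    then have "x = b" using assms by auto
    then show "(?t \<circ> q \<circ> ?t) x = x" using permutes_not_in[OF assms(1,3)] by simp
  qed
qed

text \<open>Every permutation of \<open>insert a C\<close> is uniquely (a b) o q with q permuting C.
  For b in C, conjugation by (a b) moves q to the set in which a replaces b, at the cost of one
  sign.\<close>

lemma alt_insert:
  assumes "finite C" "a \<notin> C"
  shows "alt (insert a C) f g = alt C f g - (\<Sum>b\<in>C. alt (insert a (C - {b})) (f \<circ> transpose a b) g)"
proof -
  let ?h = "\<lambda>\<pi>. if f = g \<circ> \<pi> then sign \<pi> else 0"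
  have b: "(\<Sum>q\<in>{q. q permutes C}. ?h (transpose a b \<circ> q)) = - alt (insert a (C - {b})) (f \<circ> transpose a b) g"
    if b: "b \<in> C" for b
  proof -
    let ?t = "transpose a b" and ?C = "insert a (C - {b})"
    have ab: "a \<noteq> b" using b assms by auto
    have bk: "?t \<circ> \<pi> \<circ> ?t permutes C" if "\<pi> permutes ?C" for \<pi>
    proof -
      have "transpose b a \<circ> \<pi> \<circ> transpose b a permutes insert b (?C - {a})"
        by (rule permutes_conj_transpose[OF that]) (use ab in auto)
      moreover have "insert b (?C - {a}) = C" using b assms by auto
      ultimately show ?thesis by (simp only: transpose_commute[of b a])
    qed
    have invol: "?t \<circ> (?t \<circ> \<pi> \<circ> ?t) \<circ> ?t = \<pi>" for \<pi> by (simp add: fun_eq_iff)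
    have "(\<Sum>q\<in>{q. q permutes C}. ?h (?t \<circ> q)) =
      (\<Sum>\<pi>\<in>{\<pi>. \<pi> permutes ?C}. - (if f \<circ> ?t = g \<circ> \<pi> then sign \<pi> else 0))"
    proof (rule sum.reindex_bij_witness[where i = "\<lambda>\<pi>. ?t \<circ> \<pi> \<circ> ?t" and j = "\<lambda>\<pi>. ?t \<circ> \<pi> \<circ> ?t"])
      fix q assume "q \<in> {q. q permutes C}"
      then have q: "q permutes C" by simp
      then have pq: "permutation q" using assms(1) by (rule permutes_imp_permutation[rotated])
      show "?t \<circ> q \<circ> ?t \<in> {\<pi>. \<pi> permutes ?C}" using permutes_conj_transpose[OF q b assms(2)] by simp
      have s: "sign (?t \<circ> q) = - sign q" "sign (?t \<circ> q \<circ> ?t) = sign q"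
        using pq ab by (simp_all add: sign_compose permutation_compose permutation_swap_id sign_swap_id)
      have "f \<circ> ?t = g \<circ> (?t \<circ> q \<circ> ?t) \<longleftrightarrow> f = g \<circ> (?t \<circ> q)"
        unfolding comp_assoc[symmetric] by (rule comp_transpose_eq_iff)
      then show "- (if f \<circ> ?t = g \<circ> (?t \<circ> q \<circ> ?t) then sign (?t \<circ> q \<circ> ?t) else 0) = ?h (?t \<circ> q)"
        by (simp add: s)
    qed (use bk invol in auto)
    then show ?thesis by (simp add: alt_def sum_negf)
  qed
  have "alt (insert a C) f g = (\<Sum>b\<in>insert a C. \<Sum>q\<in>{q. q permutes C}. ?h (transpose a b \<circ> q))"
    unfolding alt_def by (rule sum_over_permutations_insert[OF assms])
  also have "\<dots> = alt C f g + (\<Sum>b\<in>C. - alt (insert a (C - {b})) (f \<circ> transpose a b) g)"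
    using assms b by (simp add: alt_def cong: if_cong)
  finally show ?thesis by (simp add: sum_negf)
qed

section \<open>The residues of the normal ordered determinant\<close>

text \<open>The expansion of \<open>1/(x - k)\<close> in \<open>y = x\<^sup>-\<^sup>1\<close>.\<close>

definition geo :: "complex \<Rightarrow> complex fps" where
  "geo k = Abs_fps (\<lambda>m. if m = 0 then 0 else k ^ (m - 1))"

lemma geo_eq: "geo k = fps_X * (1 + fps_const k * geo k)"
  by (rule fps_ext) (auto simp: geo_def fps_nth_Abs_fps power_eq_if)

lemma sum_fps_const: "(\<Sum>a\<in>A. fps_const (h a)) = fps_const (sum h A)"
  by (induction A rule: infinite_finite_induct) simp_all

text \<open>The (f, g) entry of R_a, collecting the residues at z_a of the terms with B =
  \<open>insert a C\<close>. The minus sign in front of the R_a in \<Psi> turns (-1)^|B| into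
  (-1)^|C|.\<close>

definition resid :: "nat \<Rightarrow> (nat \<Rightarrow> complex) \<Rightarrow> (nat \<Rightarrow> complex) \<Rightarrow> (nat \<Rightarrow> nat) \<Rightarrow> nat \<Rightarrow> (nat \<Rightarrow> nat) \<Rightarrow> complex fps" where
  "resid n K z g a f = (\<Sum>C\<in>Pow ({..<n} - {a}).
     fps_const ((- 1) ^ card C * pfc z a (insert a C) * of_int (alt (insert a C) f g)) * (\<Prod>b\<in>insert a C. geo (K (f b))))"

lemma prod_geo_transpose_mem:
  assumes "a \<in> B" "b \<in> B"
  shows "(\<Prod>c\<in>B. geo (K ((f \<circ> transpose a b) c))) = (\<Prod>c\<in>B. geo (K (f c)))"
proof -
  have "transpose a b permutes B" using assms by (rule permutes_swap_id)
  from prod.permute[OF this, of "\<lambda>c. geo (K (f c))"] show ?thesis by (simp add: comp_def)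
qed

lemma prod_geo_transpose_nmem:
  assumes "a \<notin> C" "b \<notin> C"
  shows "(\<Prod>c\<in>insert a C. geo (K ((f \<circ> transpose a b) c))) = (\<Prod>c\<in>insert b C. geo (K (f c)))"
proof -
  have "(\<Prod>c\<in>C. geo (K ((f \<circ> transpose a b) c))) = (\<Prod>c\<in>C. geo (K (f c)))"
    using assms by (intro prod.cong refl) (auto simp: transpose_def)
  then show ?thesis using assms by (cases "finite C") auto
qed

text \<open>Gathers in \<open>resid_eq\<close> the coefficients of a product over a set D without a:
  a point b of D arises from R_a by flipping a into b, and from R_b directly.
  \<open>alt_insert\<close> sums the flipped antisymmetrizers, partial fractions at u = z_a sum the
  rest, and the empty set supplies the inhomogeneous term.\<close>

lemma alt_sum_pfc:
  assumes "finite D" "a \<notin> D" "inj_on z (insert a D)"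
  shows "(\<Sum>b\<in>D. 1 / (z a - z b) * (pfc z a (insert a (D - {b})) * of_int (alt (insert a (D - {b})) (f \<circ> transpose a b) g)
       - pfc z b D * of_int (alt D f g)))
     = of_bool (D = {} \<and> f = g) - pfc z a (insert a D) * (of_int (alt (insert a D) f g) :: complex)"
proof (cases "D = {}")
  case True
  then show ?thesis using alt_insert[of "{}" a f g] by (simp add: alt_empty pfc_def)
next
  case False
  have za: "z a \<notin> z ` D" "inj_on z D" using assms by auto
  have 1: "1 / (z a - z b) * pfc z a (insert a (D - {b})) = pfc z a (insert a D)" if b: "b \<in> D" for b
  proof -
    have "insert a D = insert b (insert a (D - {b}))" using b by auto
    moreover have "a \<noteq> b" using b assms by auto
    ultimately show ?thesis using assms pfc_insert[of "insert a (D - {b})" b a z] by simp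
  qed
  have "(\<Sum>b\<in>D. 1 / (z a - z b) * (pfc z a (insert a (D - {b})) * of_int (alt (insert a (D - {b})) (f \<circ> transpose a b) g)
       - pfc z b D * of_int (alt D f g)))
     = (\<Sum>b\<in>D. pfc z a (insert a D) * of_int (alt (insert a (D - {b})) (f \<circ> transpose a b) g)
         - pfc z b D / (z a - z b) * of_int (alt D f g))"
    by (intro sum.cong refl) (simp only: 1[symmetric] right_diff_distrib mult.assoc, simp)
  also have "\<dots> = pfc z a (insert a D) * of_int (\<Sum>b\<in>D. alt (insert a (D - {b})) (f \<circ> transpose a b) g)
       - (\<Sum>b\<in>D. pfc z b D / (z a - z b)) * of_int (alt D f g)"
    by (simp only: sum_subtractf sum_distrib_left sum_distrib_right of_int_sum)
  also have "(\<Sum>b\<in>D. pfc z b D / (z a - z b)) = pfc z a (insert a D)"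
    using partial_fractions[OF assms(1) False za(2,1)] assms(2) by (simp add: pfc_insert_self)
  also have "(\<Sum>b\<in>D. alt (insert a (D - {b})) (f \<circ> transpose a b) g) = alt D f g - alt (insert a D) f g"
    using alt_insert[OF assms(1,2), of f g] by simp
  also have "pfc z a (insert a D) * of_int (alt D f g - alt (insert a D) f g) - pfc z a (insert a D) * of_int (alt D f g)
     = of_bool (D = {} \<and> f = g) - pfc z a (insert a D) * of_int (alt (insert a D) f g)"
    using False by (simp add: right_diff_distrib)
  finally show ?thesis .
qed

text \<open>\<open>H\<^sub>a\<close> on coordinate functions: \<open>\<Sum>\<^sub>i\<^sub>j e\<^sub>i\<^sub>j\<^bsup>(a)\<^esup> e\<^sub>j\<^sub>i\<^bsup>(b)\<^esup>\<close> is the flip of the factors \<open>a\<close> and \<open>b\<close>.\<close>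

definition hact :: "nat \<Rightarrow> (nat \<Rightarrow> complex) \<Rightarrow> (nat \<Rightarrow> complex) \<Rightarrow> nat \<Rightarrow> ((nat \<Rightarrow> nat) \<Rightarrow> complex) \<Rightarrow> (nat \<Rightarrow> nat) \<Rightarrow> complex" where
  "hact n K z a F f = K (f a) * F f + (\<Sum>b\<in>{..<n} - {a}. 1 / (z a - z b) * F (f \<circ> transpose a b))"

text \<open>Column \<open>g\<close> of \<open>(x - Q) R = (1,\<dots>,1)\<^sup>T\<close>, where \<open>fps_X\<close> stands for \<open>x\<^sup>-\<^sup>1\<close>.\<close>

lemma resid_eq:
  assumes "a < n" "inj_on z {..<n}"
  shows "resid n K z g a f = fps_X * (of_bool (f = g) + fps_const (K (f a)) * resid n K z g a f
     + (\<Sum>b\<in>{..<n} - {a}. fps_const (1 / (z a - z b)) * (resid n K z g a (f \<circ> transpose a b) - resid n K z g b f)))"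
proof -
  define S where "S = {..<n} - {a}"
  define G where "G = (\<lambda>B. \<Prod>b\<in>B. geo (K (f b)))"
  define \<alpha> where "\<alpha> = (\<lambda>B h. of_int (alt B h g) :: complex)"
  define e where "e = (\<lambda>C::nat set. (- 1 :: complex) ^ card C)"
  have finS: "finite S" by (simp add: S_def)
  have inj: "inj_on z (insert a D)" if "D \<subseteq> S" for D
    by (rule inj_on_subset[OF assms(2)]) (use assms(1) that in \<open>auto simp: S_def\<close>)
  let ?r = "resid n K z g"
  have r: "?r a h = (\<Sum>C\<in>Pow S. fps_const (e C * pfc z a (insert a C) * \<alpha> (insert a C) h) * (\<Prod>b\<in>insert a C. geo (K (h b))))" for h
    by (simp add: resid_def S_def e_def \<alpha>_def)
  \<comment> \<open>Only the geometric factor at a is expanded, which leaves products over C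
    alone.\<close>
  have left: "?r a f = fps_X * ((\<Sum>C\<in>Pow S. fps_const (e C * pfc z a (insert a C) * \<alpha> (insert a C) f) * G C)
      + fps_const (K (f a)) * ?r a f)"
  proof -
    have "(\<Prod>b\<in>insert a C. geo (K (f b))) = fps_X * (G C + fps_const (K (f a)) * (\<Prod>b\<in>insert a C. geo (K (f b))))"
      if "C \<in> Pow S" for C
    proof -
      have C: "finite C" "a \<notin> C" using that finS by (auto simp: S_def intro: finite_subset)
      have P: "(\<Prod>b\<in>insert a C. geo (K (f b))) = geo (K (f a)) * G C" using C by (simp add: G_def)
      have "geo (K (f a)) * G C = fps_X * (1 + fps_const (K (f a)) * geo (K (f a))) * G C"
        using arg_cong[OF geo_eq, of "\<lambda>x. x * G C"] .
      also have "\<dots> = fps_X * (G C + fps_const (K (f a)) * (geo (K (f a)) * G C))"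
        by (simp only: algebra_simps mult_1_left)
      finally show ?thesis unfolding P .
    qed
    then have "?r a f = (\<Sum>C\<in>Pow S. fps_const (e C * pfc z a (insert a C) * \<alpha> (insert a C) f) *
        (fps_X * (G C + fps_const (K (f a)) * (\<Prod>b\<in>insert a C. geo (K (f b))))))"
      unfolding r by (intro sum.cong refl arg_cong[of _ _ "\<lambda>x. _ * x"]) blast
    also have "\<dots> = fps_X * ((\<Sum>C\<in>Pow S. fps_const (e C * pfc z a (insert a C) * \<alpha> (insert a C) f) * G C)
      + fps_const (K (f a)) * ?r a f)"
      unfolding r sum_distrib_left sum.distrib[symmetric] by (intro sum.cong refl) (simp only: algebra_simps)
    finally show ?thesis .
  qed
  \<comment> \<open>The terms with D = \<open>insert b C\<close>, sorted by whether the product runs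
    over \<open>insert a D\<close> or over D. The factor \<open>- e D\<close> is the sign of
    C.\<close>
  define T where "T = (\<lambda>b D. fps_const (- e D / (z a - z b) * ((pfc z a (insert a D) + pfc z b (insert a D)) * \<alpha> (insert a D) f)) * G (insert a D)
       + fps_const (- e D * (1 / (z a - z b) * (pfc z a (insert a (D - {b})) * \<alpha> (insert a (D - {b})) (f \<circ> transpose a b)
           - pfc z b D * \<alpha> D f))) * G D)"
  have T: "fps_const (1 / (z a - z b)) * (?r a (f \<circ> transpose a b) - ?r b f) = (\<Sum>C\<in>Pow (S - {b}). T b (insert b C))"
    if b: "b \<in> S" for b
  proof -
    have ab: "a \<noteq> b" using b by (auto simp: S_def)
    let ?P = "Pow (S - {b})"
    have C: "finite C" "a \<notin> C" "b \<notin> C" if "C \<in> ?P" for C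
      using that finS by (auto simp: S_def intro: finite_subset)
    \<comment> \<open>If b lies in C, the flip stays inside the antisymmetrized set and only changes
      the sign; otherwise it moves the product from \<open>insert a C\<close> to
      \<open>insert b C\<close>.\<close>
    have 1: "?r a (f \<circ> transpose a b)
        = (\<Sum>C\<in>?P. fps_const (e C * pfc z a (insert a C) * \<alpha> (insert a C) (f \<circ> transpose a b)) * G (insert b C))
        + (\<Sum>C\<in>?P. fps_const (e C * pfc z a (insert a (insert b C)) * \<alpha> (insert a (insert b C)) f) * G (insert a (insert b C)))"
      unfolding r sum_Pow_split[OF b finS]
    proof (intro arg_cong2[of _ _ _ _ "(+)"] sum.cong refl)
      fix D assume D: "D \<in> ?P"
      show "fps_const (e D * pfc z a (insert a D) * \<alpha> (insert a D) (f \<circ> transpose a b)) *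
           (\<Prod>c\<in>insert a D. geo (K ((f \<circ> transpose a b) c)))
         = fps_const (e D * pfc z a (insert a D) * \<alpha> (insert a D) (f \<circ> transpose a b)) * G (insert b D)"
        unfolding G_def by (simp only: prod_geo_transpose_nmem[OF C(2,3)[OF D]])
      have "\<alpha> (insert a (insert b D)) (f \<circ> transpose a b) = - \<alpha> (insert a (insert b D)) f"
        unfolding \<alpha>_def using alt_transpose[of a "insert a (insert b D)" b f g] ab C(1)[OF D] by simp
      moreover have "e (insert b D) = - e D" using C[OF D] by (simp add: e_def)
      moreover have "(\<Prod>c\<in>insert a (insert b D). geo (K ((f \<circ> transpose a b) c))) = G (insert a (insert b D))"
        unfolding G_def by (rule prod_geo_transpose_mem) auto
      ultimately show "fps_const (e (insert b D) * pfc z a (insert a (insert b D)) * \<alpha> (insert a (insert b D)) (f \<circ> transpose a b)) *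
           (\<Prod>c\<in>insert a (insert b D). geo (K ((f \<circ> transpose a b) c)))
         = fps_const (e D * pfc z a (insert a (insert b D)) * \<alpha> (insert a (insert b D)) f) * G (insert a (insert b D))"
        by simp
    qed
    have aS: "a \<in> {..<n} - {b}" using assms ab by auto
    have Sb: "{..<n} - {b} - {a} = S - {b}" by (auto simp: S_def)
    have "?r b f = (\<Sum>C\<in>Pow ({..<n} - {b}). fps_const (e C * pfc z b (insert b C) * \<alpha> (insert b C) f) * G (insert b C))"
      by (simp add: resid_def e_def \<alpha>_def G_def)
    also have "\<dots> = (\<Sum>C\<in>?P. fps_const (e C * pfc z b (insert b C) * \<alpha> (insert b C) f) * G (insert b C))
        + (\<Sum>C\<in>?P. fps_const (e (insert a C) * pfc z b (insert b (insert a C)) * \<alpha> (insert b (insert a C)) f) * G (insert b (insert a C)))"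
      by (subst sum_Pow_split[OF aS]) (simp_all only: Sb finite_Diff finite_lessThan)
    finally have 2: "?r b f = (\<Sum>C\<in>?P. fps_const (e C * pfc z b (insert b C) * \<alpha> (insert b C) f) * G (insert b C))
        + (\<Sum>C\<in>?P. fps_const (e (insert a C) * pfc z b (insert b (insert a C)) * \<alpha> (insert b (insert a C)) f) * G (insert b (insert a C)))" .
    show ?thesis unfolding 1 2 sum.distrib[symmetric] sum_subtractf[symmetric] sum_distrib_left
    proof (intro sum.cong refl)
      fix D assume D: "D \<in> ?P"
      have s: "e (insert a D) = - e D" "e (insert b D) = - e D" "insert b (insert a D) = insert a (insert b D)"
          "insert b D - {b} = D"
        using C[OF D] by (auto simp: e_def)
      have c: "fps_const x * (fps_const p * u + fps_const q * v - (fps_const s * u + fps_const t * v))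
           = fps_const (x * (q - t)) * v + fps_const (x * (p - s)) * u" for x p q s t :: complex and u v
        by (simp add: algebra_simps flip: fps_const_mult fps_const_sub)
      have cong: "fps_const p * u + fps_const q * v = fps_const s * u + fps_const t * v"
        if "p = s" "q = t" for p q s t :: complex and u v
        using that by simp
      show "fps_const (1 / (z a - z b)) *
         (fps_const (e D * pfc z a (insert a D) * \<alpha> (insert a D) (f \<circ> transpose a b)) * G (insert b D) +
          fps_const (e D * pfc z a (insert a (insert b D)) * \<alpha> (insert a (insert b D)) f) * G (insert a (insert b D)) -
          (fps_const (e D * pfc z b (insert b D) * \<alpha> (insert b D) f) * G (insert b D) +
           fps_const (e (insert a D) * pfc z b (insert b (insert a D)) * \<alpha> (insert b (insert a D)) f) * G (insert b (insert a D))))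
        = T b (insert b D)"
        unfolding T_def s c
        by (rule cong) (simp_all add: algebra_simps add_divide_distrib diff_divide_distrib)
    qed
  qed
  have "(\<Sum>b\<in>S. fps_const (1 / (z a - z b)) * (?r a (f \<circ> transpose a b) - ?r b f))
      = (\<Sum>b\<in>S. \<Sum>C\<in>Pow (S - {b}). T b (insert b C))"
    by (intro sum.cong refl T)
  also have "\<dots> = (\<Sum>D\<in>Pow S. \<Sum>b\<in>D. T b D)"
    by (rule sum_Pow_pick[OF finS, symmetric])
  also have "\<dots> = (\<Sum>D\<in>Pow S. fps_const (e D * pfc z a (insert a D) * \<alpha> (insert a D) f) * G D - of_bool (D = {} \<and> f = g))"
  proof (intro sum.cong refl)
    fix D assume D: "D \<in> Pow S"
    then have fD: "finite D" "a \<notin> D" "inj_on z (insert a D)" using finS inj by (auto simp: S_def intro: finite_subset)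
    have fc: "(\<Sum>b\<in>D. fps_const (h b) * u) = fps_const (\<Sum>b\<in>D. h b) * u" for h and u :: "complex fps"
      unfolding sum_distrib_right[symmetric] sum_fps_const ..
    \<comment> \<open>Products over \<open>insert a D\<close> cancel altogether, by the double pole
      identity.\<close>
    have 1: "(\<Sum>b\<in>D. - e D / (z a - z b) * ((pfc z a (insert a D) + pfc z b (insert a D)) * \<alpha> (insert a D) f)) = 0"
    proof -
      have "(\<Sum>b\<in>D. - e D / (z a - z b) * ((pfc z a (insert a D) + pfc z b (insert a D)) * \<alpha> (insert a D) f))
         = (\<Sum>b\<in>D. (pfc z a (insert a D) + pfc z b (insert a D)) / (z a - z b)) * (- e D * \<alpha> (insert a D) f)"
        unfolding sum_distrib_right by (intro sum.cong refl) simp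
      then show ?thesis using pfc_pair_sum_eq_0[OF fD(1,3,2)] by simp
    qed
    have 2: "(\<Sum>b\<in>D. - e D * (1 / (z a - z b) * (pfc z a (insert a (D - {b})) * \<alpha> (insert a (D - {b})) (f \<circ> transpose a b)
           - pfc z b D * \<alpha> D f))) = - e D * (of_bool (D = {} \<and> f = g) - pfc z a (insert a D) * \<alpha> (insert a D) f)"
      unfolding sum_distrib_left[symmetric] \<alpha>_def by (subst alt_sum_pfc[OF fD]) (rule refl)
    show "(\<Sum>b\<in>D. T b D) = fps_const (e D * pfc z a (insert a D) * \<alpha> (insert a D) f) * G D - of_bool (D = {} \<and> f = g)"
      unfolding T_def sum.distrib fc 1 2
      by (cases "D = {} \<and> f = g") (auto simp: e_def G_def algebra_simps simp flip: fps_const_sub)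
  qed
  also have "\<dots> = (\<Sum>C\<in>Pow S. fps_const (e C * pfc z a (insert a C) * \<alpha> (insert a C) f) * G C) - of_bool (f = g)"
  proof -
    have "(\<Sum>D\<in>Pow S. of_bool (D = {} \<and> f = g)) = (\<Sum>D\<in>Pow S. if D = {} then of_bool (f = g) else (0::complex fps))"
      by (intro sum.cong refl) auto
    also have "\<dots> = of_bool (f = g)" using finS by (subst sum.delta) auto
    finally show ?thesis by (simp only: sum_subtractf)
  qed
  finally have "(\<Sum>C\<in>Pow S. fps_const (e C * pfc z a (insert a C) * \<alpha> (insert a C) f) * G C)
     = of_bool (f = g) + (\<Sum>b\<in>S. fps_const (1 / (z a - z b)) * (?r a (f \<circ> transpose a b) - ?r b f))" by simp
  then show ?thesis using left by (simp add: S_def algebra_simps)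
qed

lemma resid_nth_0: "resid n K z g a f $ 0 = 0"
  unfolding resid_def fps_sum_nth
proof (intro sum.neutral ballI)
  fix C assume "C \<in> Pow ({..<n} - {a})"
  then have "finite C" "a \<notin> C" by (auto intro: finite_subset)
  then show "(fps_const ((- 1) ^ card C * pfc z a (insert a C) * of_int (alt (insert a C) f g)) * (\<Prod>b\<in>insert a C. geo (K (f b)))) $ 0 = 0"
    by (simp add: geo_def)
qed

text \<open>With \<open>fps_X\<close> read as x^(-1), the resolvent equation becomes the recursion
  for \<Sum> Q^k x^(-k-1) applied to the all-ones vector; the inhomogeneous term enters at k = 0
  only.\<close>

lemma resid_nth_Suc:
  assumes "a < n" "inj_on z {..<n}"
  shows "resid n K z g a f $ Suc k = of_bool (k = 0 \<and> f = g) + hact n K z a (\<lambda>f. resid n K z g a f $ k) f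
     + (\<Sum>b\<in>{..<n} - {a}. 1 / (z b - z a) * resid n K z g b f $ k)"
proof -
  have *: "1 / (z a - z b) * (p - q) = 1 / (z a - z b) * p + 1 / (z b - z a) * q" for b p q
    unfolding divide_diff_swap[of 1 "z b" "z a"] by (simp add: diff_divide_distrib)
  have "resid n K z g a f $ Suc k = (fps_X * (of_bool (f = g) + fps_const (K (f a)) * resid n K z g a f
     + (\<Sum>b\<in>{..<n} - {a}. fps_const (1 / (z a - z b)) * (resid n K z g a (f \<circ> transpose a b) - resid n K z g b f)))) $ Suc k"
    by (subst resid_eq[OF assms]) (rule refl)
  also have "\<dots> = of_bool (k = 0 \<and> f = g) + K (f a) * resid n K z g a f $ k
     + (\<Sum>b\<in>{..<n} - {a}. 1 / (z a - z b) * (resid n K z g a (f \<circ> transpose a b) $ k - resid n K z g b f $ k))"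
    by (simp only: fps_X_mult_nth fps_add_nth fps_sum_nth fps_mult_left_const_nth fps_sub_nth) simp
  finally show ?thesis unfolding * by (simp add: hact_def sum.distrib)
qed

text \<open>After exchanging the sums, each B contributes the sum of all its residues, which
  vanishes once B has two elements. Only singletons survive, and their antisymmetrizers are the
  identity.\<close>

lemma sum_resid:
  assumes "inj_on z {..<n}"
  shows "(\<Sum>a<n. resid n K z g a f) = of_bool (f = g) * (\<Sum>a<n. geo (K (f a)))"
proof -
  define h where "h = (\<lambda>a B. fps_const ((- 1) ^ card (B - {a}) * pfc z a B * of_int (alt B f g)) * (\<Prod>b\<in>B. geo (K (f b))))"
  have "(\<Sum>a<n. resid n K z g a f) = (\<Sum>a<n. \<Sum>C\<in>Pow ({..<n} - {a}). h a (insert a C))"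
  proof -
    have "insert a C - {a} = C" if "C \<in> Pow ({..<n} - {a})" for a C using that by auto
    then show ?thesis unfolding resid_def h_def by (intro sum.cong refl) (simp only:)
  qed
  also have "\<dots> = (\<Sum>B\<in>Pow {..<n}. \<Sum>a\<in>B. h a B)" by (simp add: sum_Pow_pick)
  also have "\<dots> = (\<Sum>B\<in>Pow {..<n}. \<Sum>a\<in>B. if B = {a} then of_bool (f = g) * geo (K (f a)) else 0)"
  proof (rule sum.cong[OF refl])
    fix B assume "B \<in> Pow {..<n}"
    then have B: "finite B" "inj_on z B" using assms by (auto intro: finite_subset inj_on_subset)
    consider "B = {}" | b where "B = {b}" | b C where "B = insert b C" "b \<notin> C" "C \<noteq> {}"
    proof (cases "B = {}")
      case False
      then obtain b where "b \<in> B" by auto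
      then have "B = insert b (B - {b})" "b \<notin> B - {b}" by auto
      then show thesis using that(2)[of b] that(3)[of b "B - {b}"] by (cases "B - {b} = {}") auto
    qed
    then show "(\<Sum>a\<in>B. h a B) = (\<Sum>a\<in>B. if B = {a} then of_bool (f = g) * geo (K (f a)) else 0)"
    proof cases
      case 2
      then show ?thesis using alt_insert[of "{}" b f g] by (auto simp: h_def pfc_def alt_empty)
    next
      case 3
      have nb: "B \<noteq> {a}" for a using 3 by auto
      have "(\<Sum>a\<in>B. h a B) = (\<Sum>a\<in>B. fps_const (pfc z a B) * (fps_const ((- 1) ^ (card B - 1) * of_int (alt B f g)) * (\<Prod>b\<in>B. geo (K (f b)))))"
      proof (rule sum.cong[OF refl])
        fix a assume "a \<in> B"
        then have "card (B - {a}) = card B - 1" by simp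
        then show "h a B = fps_const (pfc z a B) * (fps_const ((- 1) ^ (card B - 1) * of_int (alt B f g)) * (\<Prod>b\<in>B. geo (K (f b))))"
          unfolding h_def by (simp only: fps_const_mult mult.assoc[symmetric]) (simp only: mult.commute[of "pfc z a B"])
      qed
      also have "\<dots> = fps_const (\<Sum>a\<in>B. pfc z a B) * (fps_const ((- 1) ^ (card B - 1) * of_int (alt B f g)) * (\<Prod>b\<in>B. geo (K (f b))))"
        unfolding sum_distrib_right[symmetric] sum_fps_const ..
      also have "(\<Sum>a\<in>B. pfc z a B) = 0"
        using pfc_sum_eq_0[of C z b] 3 B by simp
      finally show ?thesis using nb by simp
    qed simp
  qed
  also have "\<dots> = (\<Sum>a<n. \<Sum>C\<in>Pow ({..<n} - {a}). if insert a C = {a} then of_bool (f = g) * geo (K (f a)) else 0)"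
    by (rule sum_Pow_pick) simp
  also have "\<dots> = (\<Sum>a<n. of_bool (f = g) * geo (K (f a)))"
  proof (intro sum.cong refl)
    fix a
    have "(\<Sum>C\<in>Pow ({..<n} - {a}). if insert a C = {a} then of_bool (f = g) * geo (K (f a)) else 0)
      = (\<Sum>C\<in>Pow ({..<n} - {a}). if C = {} then of_bool (f = g) * geo (K (f a)) else 0)"
      by (intro sum.cong refl) auto
    then show "(\<Sum>C\<in>Pow ({..<n} - {a}). if insert a C = {a} then of_bool (f = g) * geo (K (f a)) else 0)
      = of_bool (f = g) * geo (K (f a))" by (simp add: sum.delta)
  qed
  finally show ?thesis by (simp add: sum_distrib_left)
qed

section \<open>Evaluation of polynomials at the Gaudin Hamiltonians\<close>

text \<open>A form that is symmetric in a and b up to identities between transpositions. The K-terms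
  with (a b) cancel, and the terms with a third index c become 3-cycles with a common
  coefficient.\<close>

lemma hact_hact:
  assumes "a < n" "b < n" "a \<noteq> b" "inj_on z {..<n}"
  defines "S \<equiv> {..<n} - {a, b}" and "w \<equiv> \<lambda>p q. 1 / (z p - z q)"
  shows "hact n K z a (hact n K z b F) f = K (f a) * K (f b) * F f + w a b * w b a * F f
     + (\<Sum>c\<in>S. K (f a) * w b c * F (f \<circ> transpose b c)) + (\<Sum>c\<in>S. K (f b) * w a c * F (f \<circ> transpose a c))
     + (\<Sum>c\<in>S. w a c * w b c * (F (f \<circ> (transpose a c \<circ> transpose a b)) + F (f \<circ> (transpose a c \<circ> transpose b c))))
     + (\<Sum>c\<in>S. \<Sum>d\<in>S - {c}. w a c * w b d * F (f \<circ> (transpose a c \<circ> transpose b d)))"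
proof -
  have S: "finite S" "a \<notin> S" "b \<notin> S" "{..<n} - {a} = insert b S" "{..<n} - {b} = insert a S"
    using assms by (auto simp: S_def)
  have zne: "z p \<noteq> z q" if "p < n" "q < n" "p \<noteq> q" for p q
    using assms(4) that by (auto simp: inj_on_def)
  have hb: "hact n K z b F h = K (h b) * F h + w b a * F (h \<circ> transpose a b) + (\<Sum>d\<in>S. w b d * F (h \<circ> transpose b d))" for h
    using S by (simp add: hact_def w_def transpose_commute[of b a])
  have wba: "w b a = - w a b" unfolding w_def by (rule divide_diff_swap)
  have tm: "w a c * hact n K z b F (f \<circ> transpose a c)
     = K (f b) * w a c * F (f \<circ> transpose a c)
     + w a c * w b a * F (f \<circ> (transpose a c \<circ> transpose a b)) + w a c * w b c * F (f \<circ> (transpose a c \<circ> transpose b c))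
     + (\<Sum>d\<in>S - {c}. w a c * w b d * F (f \<circ> (transpose a c \<circ> transpose b d)))" if c: "c \<in> S" for c
  proof -
    have "(f \<circ> transpose a c) b = f b" using c assms by (auto simp: S_def transpose_apply_other)
    then show ?thesis unfolding hb sum.remove[OF S(1) c] by (simp only: comp_assoc algebra_simps sum_distrib_left)
  qed
  have cyc: "transpose a b \<circ> transpose b c = transpose a c \<circ> transpose a b" if "c \<in> S" for c
    using that assms by (auto simp: S_def fun_eq_iff transpose_def)
  \<comment> \<open>The three-term relation for 1/(z_p - z_q), on which the commutation
    rests.\<close>
  have coef: "w a b * w b c + w a c * w b a = w a c * w b c" if "c \<in> S" for c
  proof -
    have "z a - z c \<noteq> 0" "z b - z c \<noteq> 0" "z a - z b \<noteq> 0"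
      using that assms zne by (auto simp: S_def)
    then show ?thesis unfolding wba by (simp add: w_def divide_simps)
  qed
  have "hact n K z a (hact n K z b F) f = K (f a) * hact n K z b F f + w a b * hact n K z b F (f \<circ> transpose a b)
      + (\<Sum>c\<in>S. w a c * hact n K z b F (f \<circ> transpose a c))"
    unfolding hact_def[of n K z a] S(4) using S(1,3) by (simp add: w_def)
  also have "hact n K z b F (f \<circ> transpose a b) = K (f a) * F (f \<circ> transpose a b) + w b a * F f
      + (\<Sum>d\<in>S. w b d * F (f \<circ> (transpose a d \<circ> transpose a b)))"
  proof -
    have "f \<circ> transpose a b \<circ> transpose b d = f \<circ> (transpose a d \<circ> transpose a b)" if "d \<in> S" for d
      using cyc[OF that] by (simp only: comp_assoc)
    then show ?thesis unfolding hb by simp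
  qed
  also have "(\<Sum>c\<in>S. w a c * hact n K z b F (f \<circ> transpose a c)) = (\<Sum>c\<in>S. K (f b) * w a c * F (f \<circ> transpose a c)
     + w a c * w b a * F (f \<circ> (transpose a c \<circ> transpose a b)) + w a c * w b c * F (f \<circ> (transpose a c \<circ> transpose b c))
     + (\<Sum>d\<in>S - {c}. w a c * w b d * F (f \<circ> (transpose a c \<circ> transpose b d))))"
    by (rule sum.cong[OF refl tm])
  also have "K (f a) * hact n K z b F f = K (f a) * K (f b) * F f + K (f a) * w b a * F (f \<circ> transpose a b)
      + (\<Sum>d\<in>S. K (f a) * w b d * F (f \<circ> transpose b d))"
    unfolding hb by (simp only: algebra_simps sum_distrib_left)
  also have "w a b * (K (f a) * F (f \<circ> transpose a b) + w b a * F f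
      + (\<Sum>d\<in>S. w b d * F (f \<circ> (transpose a d \<circ> transpose a b))))
     = K (f a) * w a b * F (f \<circ> transpose a b) + w a b * w b a * F f
      + (\<Sum>d\<in>S. w a b * w b d * F (f \<circ> (transpose a d \<circ> transpose a b)))"
    by (simp only: algebra_simps sum_distrib_left)
  finally have hh: "hact n K z a (hact n K z b F) f = K (f a) * K (f b) * F f + K (f a) * w b a * F (f \<circ> transpose a b)
      + (\<Sum>d\<in>S. K (f a) * w b d * F (f \<circ> transpose b d)) + (K (f a) * w a b * F (f \<circ> transpose a b) + w a b * w b a * F f
      + (\<Sum>d\<in>S. w a b * w b d * F (f \<circ> (transpose a d \<circ> transpose a b)))) + (\<Sum>c\<in>S. K (f b) * w a c * F (f \<circ> transpose a c)
     + w a c * w b a * F (f \<circ> (transpose a c \<circ> transpose a b)) + w a c * w b c * F (f \<circ> (transpose a c \<circ> transpose b c))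
     + (\<Sum>d\<in>S - {c}. w a c * w b d * F (f \<circ> (transpose a c \<circ> transpose b d))))" .
  have "hact n K z a (hact n K z b F) f = K (f a) * K (f b) * F f + w a b * w b a * F f
     + (\<Sum>c\<in>S. K (f a) * w b c * F (f \<circ> transpose b c)) + (\<Sum>c\<in>S. K (f b) * w a c * F (f \<circ> transpose a c))
     + (\<Sum>c\<in>S. (w a b * w b c + w a c * w b a) * F (f \<circ> (transpose a c \<circ> transpose a b)) + w a c * w b c * F (f \<circ> (transpose a c \<circ> transpose b c)))
     + (\<Sum>c\<in>S. \<Sum>d\<in>S - {c}. w a c * w b d * F (f \<circ> (transpose a c \<circ> transpose b d)))"
  proof -
    have lin: "x1 + p + x2 + (q + x3 + x4) + (x5 + x6 + x7 + x8) = x1 + x3 + x2 + x5 + (x4 + x6 + x7) + x8"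
      if "p + q = 0" for x1 x2 x3 x4 x5 x6 x7 x8 p q :: complex
      using that by (simp add: add_eq_0_iff)
    have "K (f a) * w b a * F (f \<circ> transpose a b) + K (f a) * w a b * F (f \<circ> transpose a b) = 0"
      by (simp only: wba mult_minus_left mult_minus_right left_minus)
    from lin[OF this] show ?thesis unfolding hh sum.distrib distrib_right .
  qed
  also have "(\<Sum>c\<in>S. (w a b * w b c + w a c * w b a) * F (f \<circ> (transpose a c \<circ> transpose a b)) + w a c * w b c * F (f \<circ> (transpose a c \<circ> transpose b c)))
     = (\<Sum>c\<in>S. w a c * w b c * (F (f \<circ> (transpose a c \<circ> transpose a b)) + F (f \<circ> (transpose a c \<circ> transpose b c))))"
    by (rule sum.cong[OF refl]) (simp only: coef distrib_left)
  finally show ?thesis .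
qed

lemma hact_commute:
  assumes "a < n" "b < n" "inj_on z {..<n}"
  shows "hact n K z a (hact n K z b F) = hact n K z b (hact n K z a F)"
proof (cases "a = b")
  case False
  show ?thesis
  proof
    fix f
    define S where "S = {..<n} - {a, b}"
    have S': "{..<n} - {b, a} = S" by (auto simp: S_def)
    have finS: "finite S" by (simp add: S_def)
    let ?w = "\<lambda>p q. 1 / (z p - z q)"
    have c1: "transpose a c \<circ> transpose a b = transpose b c \<circ> transpose a c" if "c \<in> S" for c
      using that False by (auto simp: S_def fun_eq_iff transpose_def)
    have c2: "transpose a c \<circ> transpose b c = transpose b c \<circ> transpose b a" if "c \<in> S" for c
      using that False by (auto simp: S_def fun_eq_iff transpose_def)
    have c3: "transpose a c \<circ> transpose b d = transpose b d \<circ> transpose a c" if "c \<in> S" "d \<in> S - {c}" for c d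
      using that False by (auto simp: S_def fun_eq_iff transpose_def)
    have triple: "(\<Sum>c\<in>S. ?w a c * ?w b c * (F (f \<circ> (transpose a c \<circ> transpose a b)) + F (f \<circ> (transpose a c \<circ> transpose b c))))
      = (\<Sum>c\<in>S. ?w b c * ?w a c * (F (f \<circ> (transpose b c \<circ> transpose b a)) + F (f \<circ> (transpose b c \<circ> transpose a c))))"
    proof (rule sum.cong[OF refl])
      fix c assume c: "c \<in> S"
      show "?w a c * ?w b c * (F (f \<circ> (transpose a c \<circ> transpose a b)) + F (f \<circ> (transpose a c \<circ> transpose b c)))
        = ?w b c * ?w a c * (F (f \<circ> (transpose b c \<circ> transpose b a)) + F (f \<circ> (transpose b c \<circ> transpose a c)))"
        unfolding c1[OF c] c2[OF c] by (simp only: add.commute mult.commute)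
    qed
    have "(\<Sum>c\<in>S. \<Sum>d\<in>S - {c}. ?w a c * ?w b d * F (f \<circ> (transpose a c \<circ> transpose b d)))
      = (\<Sum>c\<in>S. \<Sum>d\<in>S - {c}. ?w b d * ?w a c * F (f \<circ> (transpose b d \<circ> transpose a c)))"
      by (intro sum.cong refl) (simp only: c3 mult.commute)
    also have "\<dots> = (\<Sum>c\<in>S. \<Sum>d\<in>S. if c = d then 0 else ?w b d * ?w a c * F (f \<circ> (transpose b d \<circ> transpose a c)))"
      using finS by (intro sum.cong refl sum.mono_neutral_cong_left) auto
    also have "\<dots> = (\<Sum>d\<in>S. \<Sum>c\<in>S. if c = d then 0 else ?w b d * ?w a c * F (f \<circ> (transpose b d \<circ> transpose a c)))"
      by (rule sum.swap)
    also have "\<dots> = (\<Sum>d\<in>S. \<Sum>c\<in>S - {d}. ?w b d * ?w a c * F (f \<circ> (transpose b d \<circ> transpose a c)))"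
      using finS by (intro sum.cong refl sum.mono_neutral_cong_right) auto
    finally have dbl: "(\<Sum>c\<in>S. \<Sum>d\<in>S - {c}. ?w a c * ?w b d * F (f \<circ> (transpose a c \<circ> transpose b d)))
      = (\<Sum>d\<in>S. \<Sum>c\<in>S - {d}. ?w b d * ?w a c * F (f \<circ> (transpose b d \<circ> transpose a c)))" .
    show "hact n K z a (hact n K z b F) f = hact n K z b (hact n K z a F) f"
      unfolding hact_hact[OF assms(1,2) False assms(3)] hact_hact[OF assms(2,1) False[symmetric] assms(3)]
        S_def[symmetric] S' triple dbl by (simp only: ac_simps)
  qed
qed simp

section \<open>Polynomials in commuting linear maps\<close>

lemma poly_mapping_single_induct [case_names zero single add]:
  assumes "P 0" "\<And>m c. P (Poly_Mapping.single m c)" "\<And>p q. P p \<Longrightarrow> P q \<Longrightarrow> P (p + q)"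
  shows "P (p :: 'a \<Rightarrow>\<^sub>0 'b::comm_monoid_add)"
proof (induction p rule: update_induct)
  case (update p m c)
  have "Poly_Mapping.update m c p = p + Poly_Mapping.single m c"
    using update(1) by (intro poly_mapping_eqI) (auto simp: lookup_add lookup_single lookup_update in_keys_iff when_def)
  then show ?case using assms(2,3) update by simp
qed (rule assms(1))

locale commuting_linear =
  fixes H :: "'i \<Rightarrow> ('v \<Rightarrow> 'c::comm_ring_1) \<Rightarrow> 'v \<Rightarrow> 'c"
  assumes H_commute: "H a (H b F) = H b (H a F)"
    and H_add: "H a (\<lambda>f. F f + G f) = (\<lambda>f. H a F f + H a G f)"
    and H_scale: "H a (\<lambda>f. c * F f) = (\<lambda>f. c * H a F f)"
begin

sublocale comp_fun_commute H
  by standard (simp add: fun_eq_iff H_commute comp_def)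

text \<open>Monomials are multisets of indices, so the commutation of the maps is what makes
  \<open>fold_mset\<close> well behaved on them.\<close>

definition ev :: "('i multiset \<Rightarrow>\<^sub>0 'c) \<Rightarrow> ('v \<Rightarrow> 'c) \<Rightarrow> 'v \<Rightarrow> 'c" where
  "ev p F f = (\<Sum>m\<in>Poly_Mapping.keys p. Poly_Mapping.lookup p m * fold_mset H F m f)"

lemma fold_add: "fold_mset H (\<lambda>f. F f + G f) m = (\<lambda>f. fold_mset H F m f + fold_mset H G m f)"
  by (induction m) (simp_all add: H_add)

lemma fold_scale: "fold_mset H (\<lambda>f. c * F f) m = (\<lambda>f. c * fold_mset H F m f)"
  by (induction m) (simp_all add: H_scale)

lemma ev_superset: "finite A \<Longrightarrow> Poly_Mapping.keys p \<subseteq> A \<Longrightarrow> ev p F f = (\<Sum>m\<in>A. Poly_Mapping.lookup p m * fold_mset H F m f)"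
  unfolding ev_def by (rule sum.mono_neutral_left) (auto simp: in_keys_iff)

lemma ev_zero: "ev 0 F f = 0"
  by (simp add: ev_def)

lemma ev_single: "ev (Poly_Mapping.single m c) F f = c * fold_mset H F m f"
  by (simp add: ev_superset[of "{m}"])

lemma ev_one: "ev 1 F f = F f"
  unfolding single_one[symmetric] ev_single by simp

lemma ev_add: "ev (p + q) F f = ev p F f + ev q F f"
proof -
  let ?A = "Poly_Mapping.keys p \<union> Poly_Mapping.keys q"
  have "Poly_Mapping.keys (p + q) \<subseteq> ?A" by (rule keys_add)
  then show ?thesis by (simp add: ev_superset[of ?A] lookup_add distrib_right sum.distrib)
qed

lemma ev_uminus: "ev (- p) F f = - ev p F f"
  using ev_add[of "- p" p F f] by (simp add: ev_zero eq_neg_iff_add_eq_0)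

lemma ev_diff: "ev (p - q) F f = ev p F f - ev q F f"
  using ev_add[of p "- q" F f] by (simp add: ev_uminus)

lemma ev_sum: "ev (\<Sum>i\<in>A. p i) F f = (\<Sum>i\<in>A. ev (p i) F f)"
  by (induction A rule: infinite_finite_induct) (simp_all add: ev_zero ev_add)

lemma fold_zero: "fold_mset H (\<lambda>f. 0) m = (\<lambda>f. 0)"
  using fold_scale[of 0 "\<lambda>f. 0" m] by simp

lemma ev_single_mult: "ev (Poly_Mapping.single m c * q) F f = c * fold_mset H (ev q F) m f"
proof (induction q arbitrary: f rule: poly_mapping_single_induct)
  case zero
  have "ev 0 F = (\<lambda>f. 0)" by (simp add: fun_eq_iff ev_zero)
  then show ?case by (simp add: ev_zero fold_zero)
next
  case (single m' c')
  have "ev (Poly_Mapping.single m' c') F = (\<lambda>f. c' * fold_mset H F m' f)"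
    by (simp add: fun_eq_iff ev_single)
  then show ?case by (simp add: mult_single ev_single fold_scale mult.assoc add.commute[of m m'])
next
  case (add p q)
  have "ev (p + q) F = (\<lambda>f. ev p F f + ev q F f)" by (simp add: fun_eq_iff ev_add)
  then show ?case using add by (simp add: distrib_left ev_add fold_add)
qed

text \<open>This homomorphism property carries ring identities between polynomials over to
  operators; additivity reduces it to a monomial on the left.\<close>

lemma ev_mult: "ev (p * q) F f = ev p (ev q F) f"
  by (induction p rule: poly_mapping_single_induct)
     (simp_all add: ev_zero ev_single_mult ev_single distrib_right ev_add)

end

section \<open>Matrices acting on coordinate functions\<close>

definition vact :: "nat \<Rightarrow> nat \<Rightarrow> op \<Rightarrow> ((nat \<Rightarrow> nat) \<Rightarrow> complex) \<Rightarrow> (nat \<Rightarrow> nat) \<Rightarrow> complex" where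
  "vact N n A F f = (\<Sum>h\<in>Idx N n. A f h * F h)"

lemma finite_Idx [simp]: "finite (Idx N n)"
  by (simp add: Idx_def finite_PiE)

lemma vact_add: "vact N n (A + B) F f = vact N n A F f + vact N n B F f"
  by (simp add: vact_def distrib_right sum.distrib)

lemma vact_zero: "vact N n 0 F f = 0"
  by (simp add: vact_def)

lemma vact_uminus: "vact N n (- A) F f = - vact N n A F f"
  by (simp add: vact_def sum_negf)

lemma op_sum_apply: "(\<Sum>i\<in>I. (A i :: op)) f g = (\<Sum>i\<in>I. A i f g)"
  by (induction I rule: infinite_finite_induct) simp_all

lemma vact_sum: "vact N n (\<Sum>i\<in>I. A i) F f = (\<Sum>i\<in>I. vact N n (A i) F f)"
  unfolding vact_def op_sum_apply sum_distrib_right by (rule sum.swap)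

lemma vact_osc: "vact N n (osc c A) F f = c * vact N n A F f"
  by (simp add: vact_def osc_def sum_distrib_left mult.assoc)

lemma vact_oid: "f \<in> Idx N n \<Longrightarrow> vact N n oid F f = F f"
proof -
  assume f: "f \<in> Idx N n"
  have "vact N n oid F f = (\<Sum>h\<in>Idx N n. if f = h then F h else 0)"
    unfolding vact_def oid_def by (intro sum.cong refl) auto
  then show ?thesis using f by simp
qed

lemma vact_ocomp: "vact N n (ocomp N n A B) F f = vact N n A (vact N n B F) f"
  unfolding vact_def ocomp_def sum_distrib_left sum_distrib_right
  by (subst sum.swap) (simp add: mult.assoc)

lemma vact_cong: "(\<And>h. h \<in> Idx N n \<Longrightarrow> F h = G h) \<Longrightarrow> vact N n A F f = vact N n A G f"
  by (simp add: vact_def)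

lemma vact_delta: "g \<in> Idx N n \<Longrightarrow> vact N n A (\<lambda>h. of_bool (h = g)) f = A f g"
  by (simp add: vact_def)

lemma Idx_upd: "f \<in> Idx N n \<Longrightarrow> a < n \<Longrightarrow> i < N \<Longrightarrow> f(a := i) \<in> Idx N n"
  by (auto simp: Idx_def PiE_def extensional_def)

lemma Idx_less: "f \<in> Idx N n \<Longrightarrow> a < n \<Longrightarrow> f a < N"
  by (auto simp: Idx_def)

lemma vact_Eop:
  assumes "f \<in> Idx N n" "a < n" "j < N"
  shows "vact N n (Eop a i j) F f = (if f a = i then F (f(a := j)) else 0)"
proof -
  have "vact N n (Eop a i j) F f = (\<Sum>h\<in>Idx N n. if h = f(a := j) then (if f a = i then F h else 0) else 0)"
    unfolding vact_def Eop_def by (intro sum.cong refl) (auto simp: fun_eq_iff)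
  then show ?thesis using assms Idx_upd by simp
qed

text \<open>The double sum over i and j selects i = f a and j = f b, which leaves the exchange of
  two states. The matrix lives on \<open>Idx\<close>, while \<open>hact\<close> does not refer to N,
  so its commutation holds for every f.\<close>

lemma vact_gaudinH:
  assumes f: "f \<in> Idx N n" and a: "a < n"
  shows "vact N n (gaudinH N n K z a) F f = hact n K z a F f"
proof -
  have 1: "(\<Sum>i<N. K i * vact N n (Eop a i i) F f) = K (f a) * F f"
  proof -
    have "(\<Sum>i<N. K i * vact N n (Eop a i i) F f) = (\<Sum>i<N. if i = f a then K i * F f else 0)"
      by (intro sum.cong refl) (auto simp: vact_Eop f a)
    then show ?thesis using Idx_less[OF f a] by simp
  qed
  have 2: "(\<Sum>i<N. \<Sum>j<N. vact N n (ocomp N n (Eop a i j) (Eop b j i)) F f) = F (f \<circ> transpose a b)"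
    if b: "b \<in> {..<n} - {a}" for b
  proof -
    have "(\<Sum>i<N. \<Sum>j<N. vact N n (ocomp N n (Eop a i j) (Eop b j i)) F f)
        = (\<Sum>i<N. \<Sum>j<N. if j = f b then (if i = f a then F (f(a := j, b := i)) else 0) else 0)"
      using b a by (intro sum.cong refl) (auto simp: vact_ocomp vact_Eop Idx_upd f)
    also have "\<dots> = F (f(a := f b, b := f a))"
      using Idx_less[OF f] a b by simp
    also have "f(a := f b, b := f a) = f \<circ> transpose a b"
      by (auto simp: fun_eq_iff transpose_def)
    finally show ?thesis .
  qed
  have "vact N n (gaudinH N n K z a) F f = (\<Sum>i<N. K i * vact N n (Eop a i i) F f)
     + (\<Sum>i<N. \<Sum>j<N. \<Sum>b\<in>{..<n} - {a}. 1 / (z a - z b) * vact N n (ocomp N n (Eop a i j) (Eop b j i)) F f)"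
    by (simp only: gaudinH_def vact_add vact_sum vact_osc)
  also have "(\<Sum>i<N. \<Sum>j<N. \<Sum>b\<in>{..<n} - {a}. 1 / (z a - z b) * vact N n (ocomp N n (Eop a i j) (Eop b j i)) F f)
     = (\<Sum>b\<in>{..<n} - {a}. 1 / (z a - z b) * (\<Sum>i<N. \<Sum>j<N. vact N n (ocomp N n (Eop a i j) (Eop b j i)) F f))"
    unfolding sum_distrib_left by (subst sum.swap[of _ "{..<n} - {a}"], subst sum.swap[of _ "{..<n} - {a}"]) (rule refl)
  also have "\<dots> = (\<Sum>b\<in>{..<n} - {a}. 1 / (z a - z b) * F (f \<circ> transpose a b))"
    by (intro sum.cong refl arg_cong2[of _ _ _ _ "(*)"] 2)
  finally show ?thesis unfolding 1 hact_def .
qed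

section \<open>The determinant of the resolvents\<close>

text \<open>The bordered matrix X with blocks 1, V, W, 1 is multiplied by the unipotent L on either
  side: L X exposes the scalar 1 - w v and X L exposes the matrix 1 - v w, so both determinants
  equal that of X.\<close>

lemma det_one_minus_rank_one:
  fixes v w :: "nat \<Rightarrow> 'r::comm_ring_1"
  shows "det (mat n n (\<lambda>(a, b). (if a = b then 1 else 0) - v a * w b)) = 1 - (\<Sum>a<n. w a * v a)"
proof -
  define V where "V = mat n 1 (\<lambda>(a, b). v a)"
  define W where "W = mat 1 n (\<lambda>(a, b). w b)"
  define D where "D = mat 1 1 (\<lambda>(a, b). 1 - (\<Sum>a<n. w a * v a))"
  define X where "X = four_block_mat (1\<^sub>m n) V W (1\<^sub>m 1)"
  define L where "L = four_block_mat (1\<^sub>m n) (0\<^sub>m n 1) (- W) (1\<^sub>m 1)"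
  have c: "V \<in> carrier_mat n 1" "W \<in> carrier_mat 1 n" "- W \<in> carrier_mat 1 n" "D \<in> carrier_mat 1 1"
    by (auto simp: V_def W_def D_def)
  have X: "X \<in> carrier_mat (n + 1) (n + 1)" and L: "L \<in> carrier_mat (n + 1) (n + 1)"
    unfolding X_def L_def by (auto intro!: four_block_carrier_mat)
  have detL: "det L = 1"
    unfolding L_def by (subst det_four_block_mat_upper_right_zero_col[of _ n]) (use c in auto)
  have "L * X = four_block_mat (1\<^sub>m n) V (0\<^sub>m 1 n) D"
  proof -
    have "L * X = four_block_mat (1\<^sub>m n * 1\<^sub>m n + 0\<^sub>m n 1 * W) (1\<^sub>m n * V + 0\<^sub>m n 1 * 1\<^sub>m 1)
       (- W * 1\<^sub>m n + 1\<^sub>m 1 * W) (- W * V + 1\<^sub>m 1 * 1\<^sub>m 1)"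
      unfolding L_def X_def by (rule mult_four_block_mat) (use c in auto)
    also have "1\<^sub>m n * 1\<^sub>m n + 0\<^sub>m n 1 * W = 1\<^sub>m n" using c by simp
    also have "1\<^sub>m n * V + 0\<^sub>m n 1 * 1\<^sub>m 1 = V" using c by simp
    also have "- W * 1\<^sub>m n + 1\<^sub>m 1 * W = 0\<^sub>m 1 n" using c by simp
    also have "- W * V + 1\<^sub>m 1 * 1\<^sub>m 1 = D"
      by (rule eq_matI) (auto simp: W_def V_def D_def scalar_prod_def sum_negf atLeast0LessThan)
    finally show ?thesis .
  qed
  then have "det X = det (four_block_mat (1\<^sub>m n) V (0\<^sub>m 1 n) D)"
    using det_mult[OF L X] detL by simp
  \<comment> \<open>Transposing moves the zero block to the upper right, where the block determinant
    rule applies.\<close>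
  also have "\<dots> = det (transpose_mat (four_block_mat (1\<^sub>m n) V (0\<^sub>m 1 n) D))"
    by (rule det_transpose[symmetric, of _ "n + 1"]) (rule four_block_carrier_mat, simp, rule c)
  also have "transpose_mat (four_block_mat (1\<^sub>m n) V (0\<^sub>m 1 n) D)
      = four_block_mat (1\<^sub>m n) (0\<^sub>m n 1) (transpose_mat V) (transpose_mat D)"
    by (subst transpose_four_block_mat) (use c in auto)
  also have "det \<dots> = 1 - (\<Sum>a<n. w a * v a)"
    by (subst det_four_block_mat_upper_right_zero_col[of _ n])
       (use c in \<open>auto simp: D_def det_single\<close>)
  finally have dX: "det X = 1 - (\<Sum>a<n. w a * v a)" .
  let ?R = "mat n n (\<lambda>(a, b). (if a = b then 1 else 0) - v a * w b)"
  have "X * L = four_block_mat ?R V (0\<^sub>m 1 n) (1\<^sub>m 1)"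
  proof -
    have "X * L = four_block_mat (1\<^sub>m n * 1\<^sub>m n + V * (- W)) (1\<^sub>m n * 0\<^sub>m n 1 + V * 1\<^sub>m 1)
       (W * 1\<^sub>m n + 1\<^sub>m 1 * (- W)) (W * 0\<^sub>m n 1 + 1\<^sub>m 1 * 1\<^sub>m 1)"
      unfolding L_def X_def by (rule mult_four_block_mat) (use c in auto)
    also have "1\<^sub>m n * 1\<^sub>m n + V * (- W) = ?R"
      by (rule eq_matI) (auto simp: W_def V_def scalar_prod_def)
    also have "1\<^sub>m n * 0\<^sub>m n 1 + V * 1\<^sub>m 1 = V" using c by simp
    also have "W * 1\<^sub>m n + 1\<^sub>m 1 * (- W) = 0\<^sub>m 1 n"
      by (rule eq_matI) (auto simp: W_def scalar_prod_def)
    also have "W * 0\<^sub>m n 1 + 1\<^sub>m 1 * 1\<^sub>m 1 = 1\<^sub>m 1" using c by simp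
    finally show ?thesis .
  qed
  then have "det X = det (four_block_mat ?R V (0\<^sub>m 1 n) (1\<^sub>m 1))"
    using det_mult[OF X L] detL by simp
  also have "\<dots> = det (transpose_mat (four_block_mat ?R V (0\<^sub>m 1 n) (1\<^sub>m 1)))"
    by (rule det_transpose[symmetric, of _ "n + 1"]) (rule four_block_carrier_mat, simp_all)
  also have "transpose_mat (four_block_mat ?R V (0\<^sub>m 1 n) (1\<^sub>m 1))
      = four_block_mat (transpose_mat ?R) (0\<^sub>m n 1) (transpose_mat V) (1\<^sub>m 1)"
    by (subst transpose_four_block_mat) (use c in auto)
  also have "det \<dots> = det (transpose_mat ?R)"
    by (subst det_four_block_mat_upper_right_zero_col[of _ n]) (use c in auto)
  also have "\<dots> = det ?R" by (rule det_transpose[of _ n]) auto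
  finally show ?thesis using dX by simp
qed

primrec qpow :: "nat \<Rightarrow> (nat \<Rightarrow> nat \<Rightarrow> 'r::comm_ring_1) \<Rightarrow> nat \<Rightarrow> nat \<Rightarrow> nat \<Rightarrow> 'r" where
  "qpow n Q 0 a b = of_bool (a = b)"
| "qpow n Q (Suc k) a b = (\<Sum>c<n. Q a c * qpow n Q k c b)"

lemma qpow_Suc_right: "a < n \<Longrightarrow> b < n \<Longrightarrow> qpow n Q (Suc k) a b = (\<Sum>c<n. qpow n Q k a c * Q c b)"
proof (induction k arbitrary: a)
  case 0
  have "(\<Sum>c<n. Q a c * of_bool (c = b)) = Q a b" "(\<Sum>c<n. of_bool (a = c) * Q c b) = Q a b"
    using 0 by (simp_all add: of_bool_def if_distrib[of "\<lambda>x. _ * x"] if_distrib[of "\<lambda>x. x * _"] cong: if_cong)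
  then show ?case by simp
next
  case (Suc k)
  have "qpow n Q (Suc (Suc k)) a b = (\<Sum>c<n. Q a c * (\<Sum>e<n. qpow n Q k c e * Q e b))"
    using Suc by (simp del: qpow.simps(2) add: qpow.simps(2)[of n Q "Suc k"])
  also have "\<dots> = (\<Sum>e<n. (\<Sum>c<n. Q a c * qpow n Q k c e) * Q e b)"
    unfolding sum_distrib_left sum_distrib_right by (subst sum.swap) (simp add: mult.assoc)
  finally show ?case by simp
qed

text \<open>The hypothesis is [Q, Z] = J - 1 entry by entry. The vanishing trace is tr(Z Q^k Q) -
  tr(Z Q Q^k), where both products of powers are Q^(k+1).\<close>

lemma sum_qpow_eq_trace:
  fixes Q :: "nat \<Rightarrow> nat \<Rightarrow> 'r::comm_ring_1"
  assumes Q: "\<And>a b. a < n \<Longrightarrow> b < n \<Longrightarrow> (\<zeta> b - \<zeta> a) * Q a b = of_bool (a \<noteq> b)"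
  shows "(\<Sum>a<n. \<Sum>b<n. qpow n Q k a b) = (\<Sum>a<n. qpow n Q k a a)"
proof -
  have "(\<Sum>a<n. \<Sum>b<n. \<zeta> a * (qpow n Q k a b * Q b a)) = (\<Sum>a<n. \<zeta> a * qpow n Q (Suc k) a a)"
    by (intro sum.cong refl) (simp only: qpow_Suc_right sum_distrib_left lessThan_iff)
  also have "\<dots> = (\<Sum>a<n. \<Sum>b<n. \<zeta> a * (Q a b * qpow n Q k b a))"
    by (simp add: sum_distrib_left)
  also have "\<dots> = (\<Sum>a<n. \<Sum>b<n. \<zeta> b * (qpow n Q k a b * Q b a))"
    by (subst sum.swap) (simp add: mult.commute mult.left_commute)
  finally have "(\<Sum>a<n. \<Sum>b<n. qpow n Q k a b * ((\<zeta> a - \<zeta> b) * Q b a)) = 0"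
    by (simp add: algebra_simps sum_subtractf)
  moreover have "(\<Sum>a<n. \<Sum>b<n. qpow n Q k a b * ((\<zeta> a - \<zeta> b) * Q b a))
      = (\<Sum>a<n. (\<Sum>b<n. qpow n Q k a b) - qpow n Q k a a)"
  proof (rule sum.cong[OF refl])
    fix a assume a: "a \<in> {..<n}"
    have "(\<Sum>b<n. qpow n Q k a b * ((\<zeta> a - \<zeta> b) * Q b a)) = (\<Sum>b<n. qpow n Q k a b - (if b = a then qpow n Q k a b else 0))"
      by (rule sum.cong[OF refl]) (use Q a in auto)
    then show "(\<Sum>b<n. qpow n Q k a b * ((\<zeta> a - \<zeta> b) * Q b a)) = (\<Sum>b<n. qpow n Q k a b) - qpow n Q k a a"
      using a by (simp add: sum_subtractf)
  qed
  ultimately show ?thesis by (simp add: sum_subtractf)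
qed

lemma mat_mult_mat:
  fixes F G :: "nat \<Rightarrow> nat \<Rightarrow> 'r::comm_ring_1"
  shows "mat n n (\<lambda>(a, b). F a b) * mat n n (\<lambda>(a, b). G a b) = mat n n (\<lambda>(a, b). \<Sum>c<n. F a c * G c b)"
  by (rule eq_matI) (auto simp: scalar_prod_def atLeast0LessThan)

lemma mat_cong:
  assumes "\<And>a b. a < n \<Longrightarrow> b < n \<Longrightarrow> F a b = G a b"
  shows "mat n n (\<lambda>(a, b). F a b) = mat n n (\<lambda>(a, b). G a b)"
  by (rule eq_matI) (auto simp: assms)

lemma sum_diag_left:
  fixes h :: "nat \<Rightarrow> 'r::comm_ring_1"
  assumes "a < n"
  shows "(\<Sum>c<n. (if a = c then x else 0) * h c) = x * h a"
proof -
  have "(\<Sum>c<n. (if a = c then x else 0) * h c) = (\<Sum>c<n. if c = a then x * h c else 0)"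
    by (intro sum.cong refl) auto
  then show ?thesis using assms by simp
qed

lemma sum_diag_right:
  fixes h :: "nat \<Rightarrow> 'r::comm_ring_1"
  assumes "b < n"
  shows "(\<Sum>c<n. h c * (if c = b then p c else 0)) = h b * p b"
proof -
  have "(\<Sum>c<n. h c * (if c = b then p c else 0)) = (\<Sum>c<n. if c = b then h c * p c else 0)"
    by (intro sum.cong refl) auto
  then show ?thesis using assms by simp
qed

text \<open>With \<open>T = 1 - t Z\<close>, \<open>Y = 1 - y Q\<close> and the all-ones matrix \<open>J\<close>, the relation \<open>[Q, Z] = J - 1\<close> says
  \<open>T Y - t y = Y T - t y J\<close>, so \<open>det (1 - t y T\<^sup>-\<^sup>1 Y\<^sup>-\<^sup>1)\<close> is the determinant of the rank one
  perturbation \<open>1 - t y Y\<^sup>-\<^sup>1 J T\<^sup>-\<^sup>1\<close>.\<close>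

lemma det_one_minus_inverses:
  fixes T U s :: "nat \<Rightarrow> 'r::comm_ring_1" and Y V :: "nat \<Rightarrow> nat \<Rightarrow> 'r"
  assumes TU: "\<And>a. T a * U a = 1"
    and YV: "\<And>a b. a < n \<Longrightarrow> b < n \<Longrightarrow> (\<Sum>c<n. Y a c * V c b) = of_bool (a = b)"
    and VY: "\<And>a b. a < n \<Longrightarrow> b < n \<Longrightarrow> (\<Sum>c<n. V a c * Y c b) = of_bool (a = b)"
    and comm: "\<And>a b. a < n \<Longrightarrow> b < n \<Longrightarrow> T a * Y a b - Y a b * T b = - (\<epsilon> * of_bool (a \<noteq> b))"
  shows "det (mat n n (\<lambda>(a, b). (if a = b then 1 else 0) - \<epsilon> * U a * V a b))
     = 1 - (\<Sum>a<n. \<Sum>b<n. \<epsilon> * U a * V a b)"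
proof -
  define mT where "mT = mat n n (\<lambda>(a, b). if a = b then T a else 0)"
  define mU where "mU = mat n n (\<lambda>(a, b). if a = b then U a else 0)"
  define mY where "mY = mat n n (\<lambda>(a, b). Y a b)"
  define mV where "mV = mat n n (\<lambda>(a, b). V a b)"
  define L where "L = mat n n (\<lambda>(a, b). (if a = b then 1 else 0) - \<epsilon> * U a * V a b)"
  define R where "R = mat n n (\<lambda>(a, b). (if a = b then 1 else 0) - (\<epsilon> * (\<Sum>c<n. V a c)) * U b)"
  have carr: "mT \<in> carrier_mat n n" "mU \<in> carrier_mat n n" "mY \<in> carrier_mat n n" "mV \<in> carrier_mat n n"
    "L \<in> carrier_mat n n" "R \<in> carrier_mat n n"
    by (simp_all add: mT_def mU_def mY_def mV_def L_def R_def)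
  have "mT * mU = 1\<^sub>m n"
    unfolding mT_def mU_def mat_mult_mat by (rule eq_matI) (auto simp: sum_diag_left TU)
  then have dTU: "det mT * det mU = 1" using det_mult[OF carr(1,2)] by simp
  have "mY * mV = 1\<^sub>m n"
    unfolding mY_def mV_def mat_mult_mat by (rule eq_matI) (auto simp: YV)
  then have dYV: "det mY * det mV = 1" using det_mult[OF carr(3,4)] by simp
  \<comment> \<open>Since L is 1 - \<epsilon> times the inverses of T and Y, this product is T Y -
    \<epsilon>. Likewise Y R T becomes Y T - \<epsilon> J in \<open>r1\<close>.\<close>
  have l1: "(mT * L) * mY = mat n n (\<lambda>(a, b). T a * Y a b - \<epsilon> * (if a = b then 1 else 0))"
  proof -
    have "mT * L = mat n n (\<lambda>(a, b). (if a = b then T a else 0) - \<epsilon> * V a b)"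
      unfolding mT_def L_def mat_mult_mat
    proof (rule mat_cong)
      fix a b assume a: "a < n" "b < n"
      have "(\<Sum>c<n. (if a = c then T a else 0) * ((if c = b then 1 else 0) - \<epsilon> * U c * V c b))
          = T a * ((if a = b then 1 else 0) - \<epsilon> * U a * V a b)"
        using a(1) by (rule sum_diag_left)
      also have "\<dots> = (if a = b then T a else 0) - \<epsilon> * (T a * U a) * V a b" by (simp add: algebra_simps)
      finally show "(\<Sum>c<n. (if a = c then T a else 0) * ((if c = b then 1 else 0) - \<epsilon> * U c * V c b))
        = (if a = b then T a else 0) - \<epsilon> * V a b" by (simp add: TU)
    qed
    then show ?thesis unfolding mY_def
    proof (simp only: mat_mult_mat, intro mat_cong)
      fix a b assume ab: "a < n" "b < n"
      have "(\<Sum>c<n. ((if a = c then T a else 0) - \<epsilon> * V a c) * Y c b)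
         = (\<Sum>c<n. (if a = c then T a else 0) * Y c b) - \<epsilon> * (\<Sum>c<n. V a c * Y c b)"
        by (simp only: left_diff_distrib sum_subtractf sum_distrib_left mult.assoc)
      also have "\<dots> = T a * Y a b - \<epsilon> * (if a = b then 1 else 0)"
        by (simp only: sum_diag_left[OF ab(1)] VY[OF ab]) simp
      finally show "(\<Sum>c<n. ((if a = c then T a else 0) - \<epsilon> * V a c) * Y c b)
        = T a * Y a b - \<epsilon> * (if a = b then 1 else 0)" .
    qed
  qed
  have r1: "(mY * R) * mT = mat n n (\<lambda>(a, b). Y a b * T b - \<epsilon>)"
  proof -
    have "mY * R = mat n n (\<lambda>(a, b). Y a b - \<epsilon> * U b)"
      unfolding mY_def R_def mat_mult_mat
    proof (rule mat_cong)
      fix a b assume ab: "a < n" "b < n"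
      have "(\<Sum>c<n. Y a c * ((if c = b then 1 else 0) - \<epsilon> * (\<Sum>e<n. V c e) * U b))
         = (\<Sum>c<n. Y a c * (if c = b then 1 else 0)) - \<epsilon> * (\<Sum>c<n. \<Sum>e<n. Y a c * V c e) * U b"
        by (simp add: right_diff_distrib sum_subtractf sum_distrib_left sum_distrib_right algebra_simps)
      also have "(\<Sum>c<n. \<Sum>e<n. Y a c * V c e) = (\<Sum>e<n. of_bool (a = e))"
        by (subst sum.swap) (simp add: YV ab)
      also have "\<dots> = 1" using ab by (simp add: of_bool_def)
      finally show "(\<Sum>c<n. Y a c * ((if c = b then 1 else 0) - \<epsilon> * (\<Sum>e<n. V c e) * U b)) = Y a b - \<epsilon> * U b"
        using ab by (simp add: sum_diag_right[of _ _ _ "\<lambda>_. 1"])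
    qed
    then show ?thesis unfolding mT_def
    proof (simp only: mat_mult_mat, intro mat_cong)
      fix a b assume ab: "a < n" "b < n"
      have "(\<Sum>c<n. (Y a c - \<epsilon> * U c) * (if c = b then T c else 0)) = (Y a b - \<epsilon> * U b) * T b"
        using ab(2) by (rule sum_diag_right)
      also have "\<dots> = Y a b * T b - \<epsilon> * (T b * U b)" by (simp add: algebra_simps)
      finally show "(\<Sum>c<n. (Y a c - \<epsilon> * U c) * (if c = b then T c else 0)) = Y a b * T b - \<epsilon>" by (simp add: TU)
    qed
  qed
  have "(mT * L) * mY = (mY * R) * mT"
    unfolding l1 r1
  proof (rule mat_cong)
    fix a b assume ab: "a < n" "b < n"
    have "T a * Y a b = Y a b * T b - \<epsilon> * of_bool (a \<noteq> b)" using comm[OF ab] by (simp add: algebra_simps)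
    then show "T a * Y a b - \<epsilon> * (if a = b then 1 else 0) = Y a b * T b - \<epsilon>" by simp
  qed
  then have "det mT * det L * det mY = det mY * det R * det mT"
    using carr by (simp flip: det_mult[of _ n])
  \<comment> \<open>The determinants of T and Y are units with inverses det U and det V; this
    replaces division in a general commutative ring.\<close>
  then have "(det mT * det mU) * (det mY * det mV) * det L = (det mT * det mU) * (det mY * det mV) * det R"
    by (metis (no_types, lifting) mult.assoc mult.commute)
  then have "det L = det R" by (simp add: dTU dYV)
  also have "det R = 1 - (\<Sum>a<n. U a * (\<epsilon> * (\<Sum>c<n. V a c)))"
    unfolding R_def by (rule det_one_minus_rank_one)
  also have "\<dots> = 1 - (\<Sum>a<n. \<Sum>b<n. \<epsilon> * U a * V a b)"
    by (simp add: sum_distrib_left mult.commute mult.left_commute)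
  finally show ?thesis by (simp add: L_def)
qed

lemma det_resolvents:
  fixes \<zeta> :: "nat \<Rightarrow> 'r::comm_ring_1" and Q :: "nat \<Rightarrow> nat \<Rightarrow> 'r"
  assumes Q: "\<And>a b. a < n \<Longrightarrow> b < n \<Longrightarrow> (\<zeta> b - \<zeta> a) * Q a b = of_bool (a \<noteq> b)"
  defines "M \<equiv> \<lambda>a b. Abs_fps (\<lambda>i. Abs_fps (\<lambda>j. if 1 \<le> i \<and> 1 \<le> j then \<zeta> a ^ (j - 1) * qpow n Q (i - 1) a b else 0))"
  shows "det (mat n n (\<lambda>(a, b). (if a = b then 1 else 0) - M a b)) = 1 - (\<Sum>a<n. \<Sum>b<n. M a b)"
proof -
  \<comment> \<open>The nesting follows \<open>bser\<close>: the outer variable is y = x^(-1) and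
    the inner one is t = u^(-1). In \<open>symb\<close> it is the other way round.\<close>
  define t y where "t = (fps_const fps_X :: 'r fps fps)" and "y = (fps_X :: 'r fps fps)"
  define C where "C = (\<lambda>x :: 'r. fps_const (fps_const x))"
  define T where "T = (\<lambda>a. 1 - t * C (\<zeta> a))"
  define U where "U = (\<lambda>a. fps_const (Abs_fps (\<lambda>j. \<zeta> a ^ j)))"
  define Y where "Y = (\<lambda>a b. of_bool (a = b) - y * C (Q a b))"
  define V where "V = (\<lambda>a b. Abs_fps (\<lambda>i. fps_const (qpow n Q i a b)))"
  have M: "M a b = t * y * U a * V a b" for a b
  proof -
    have "t * y * U a * V a b = y * (fps_const (fps_X * Abs_fps (\<lambda>j. \<zeta> a ^ j)) * V a b)"
      by (simp add: t_def U_def fps_const_mult[symmetric] ac_simps del: fps_const_mult)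
    also have "\<dots> = M a b"
      by (intro fps_ext) (auto simp: y_def V_def M_def fps_X_mult_nth fps_mult_right_const_nth)
    finally show ?thesis ..
  qed
  have TU: "T a * U a = 1" for a
  proof -
    have "(1 - fps_X * fps_const (\<zeta> a)) * Abs_fps (\<lambda>j. \<zeta> a ^ j) = 1"
    proof (rule fps_ext)
      fix j show "((1 - fps_X * fps_const (\<zeta> a)) * Abs_fps (\<lambda>j. \<zeta> a ^ j)) $ j = 1 $ j"
        by (cases j) (simp_all add: left_diff_distrib mult.assoc fps_X_mult_nth)
    qed
    then have "fps_const ((1 - fps_X * fps_const (\<zeta> a)) * Abs_fps (\<lambda>j. \<zeta> a ^ j)) = 1" by simp
    then show ?thesis
      by (simp add: T_def U_def t_def C_def fps_const_mult[symmetric] fps_const_sub[symmetric] del: fps_const_mult fps_const_sub)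
  qed
  have V_nth: "V a b $ i = fps_const (qpow n Q i a b)" for a b i
    by (simp add: V_def)
  have CV: "(\<Sum>c<n. C (Q a c) * V c b) $ i = fps_const (qpow n Q (Suc i) a b)" for a b i
    by (simp add: C_def V_def fps_sum_nth sum_fps_const)
  have VC: "(\<Sum>c<n. V a c * C (Q c b)) $ i = fps_const (qpow n Q (Suc i) a b)" if "a < n" "b < n" for a b i
    by (simp only: qpow_Suc_right[OF that]) (simp add: C_def V_def fps_sum_nth sum_fps_const)
  have YV: "(\<Sum>c<n. Y a c * V c b) = of_bool (a = b)" if "a < n" "b < n" for a b
  proof -
    have "(\<Sum>c<n. Y a c * V c b) = (\<Sum>c<n. (if a = c then 1 else 0) * V c b) - y * (\<Sum>c<n. C (Q a c) * V c b)"
      by (simp only: Y_def left_diff_distrib sum_subtractf sum_distrib_left mult.assoc of_bool_def)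
    also have "(\<Sum>c<n. (if a = c then 1 else 0) * V c b) = V a b" using sum_diag_left[OF that(1), of 1] by simp
    also have "V a b - y * (\<Sum>c<n. C (Q a c) * V c b) = of_bool (a = b)"
    proof (rule fps_ext)
      fix i show "(V a b - y * (\<Sum>c<n. C (Q a c) * V c b)) $ i = of_bool (a = b) $ i"
        by (cases i) (simp_all add: y_def fps_X_mult_nth CV V_nth of_bool_def del: qpow.simps(2))
    qed
    finally show ?thesis .
  qed
  have VY: "(\<Sum>c<n. V a c * Y c b) = of_bool (a = b)" if "a < n" "b < n" for a b
  proof -
    have "(\<Sum>c<n. V a c * Y c b) = (\<Sum>c<n. V a c * (if c = b then 1 else 0)) - y * (\<Sum>c<n. V a c * C (Q c b))"
      by (simp only: Y_def right_diff_distrib sum_subtractf sum_distrib_left mult.left_commute[of _ y] of_bool_def)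
    also have "(\<Sum>c<n. V a c * (if c = b then 1 else 0)) = V a b" using sum_diag_right[OF that(2), of _ "\<lambda>_. 1"] by simp
    also have "V a b - y * (\<Sum>c<n. V a c * C (Q c b)) = of_bool (a = b)"
    proof (rule fps_ext)
      fix i show "(V a b - y * (\<Sum>c<n. V a c * C (Q c b))) $ i = of_bool (a = b) $ i"
        by (cases i) (simp_all add: y_def fps_X_mult_nth VC[OF that] V_nth of_bool_def del: qpow.simps(2))
    qed
    finally show ?thesis .
  qed
  have comm: "T a * Y a b - Y a b * T b = - (t * y * of_bool (a \<noteq> b))" if "a < n" "b < n" for a b
  proof (cases "a = b")
    case False
    then have "T a * Y a b - Y a b * T b = - (t * y * ((C (\<zeta> b) - C (\<zeta> a)) * C (Q a b)))"
      by (simp add: T_def Y_def algebra_simps)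
    also have "(C (\<zeta> b) - C (\<zeta> a)) * C (Q a b) = C ((\<zeta> b - \<zeta> a) * Q a b)" by (simp add: C_def)
    finally show ?thesis using Q[OF that] False by (simp add: C_def)
  qed (simp add: mult.commute)
  show ?thesis unfolding M
    by (rule det_one_minus_inverses[OF TU YV VY comm])
qed

section \<open>The symbol of the row determinant\<close>

text \<open>Column \<open>g\<close> of the symbol, divided by the highest power of \<open>x\<close>; the outer series variable is
  \<open>u\<^sup>-\<^sup>1\<close> and the inner one is \<open>x\<^sup>-\<^sup>1\<close>.\<close>

definition symb :: "(nat \<Rightarrow> nat) \<Rightarrow> user list \<Rightarrow> (nat \<Rightarrow> nat) \<Rightarrow> complex fps fps" where
  "symb g P f = Abs_fps (\<lambda>j. Abs_fps (\<lambda>l. if l < length P then (P ! (length P - 1 - l)) j f g else 0))"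

text \<open>The expansion of 1/(u - z_a) at infinity.\<close>

definition cpole :: "(nat \<Rightarrow> complex) \<Rightarrow> nat \<Rightarrow> complex fps fps" where
  "cpole z a = Abs_fps (\<lambda>j. if j = 0 then 0 else fps_const (z a ^ (j - 1)))"

text \<open>In the variable w = u^(-1), the derivative d/du is - w^2 d/dw.\<close>

definition uderiv :: "complex fps fps \<Rightarrow> complex fps fps" where
  "uderiv p = - (fps_X\<^sup>2 * fps_deriv p)"

definition kap :: "complex \<Rightarrow> complex fps fps" where
  "kap c = fps_const (fps_const c)"

lemma kap_simps: "kap (x + y) = kap x + kap y" "kap (x - y) = kap x - kap y" "kap (x * y) = kap x * kap y" "kap 1 = 1" "kap 0 = 0"
  by (simp_all add: kap_def)

lemma cpole_mult: "cpole z a * (1 - kap (z a) * fps_X) = fps_X"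
proof -
  have "cpole z a = fps_X + kap (z a) * (fps_X * cpole z a)"
    by (intro fps_ext) (auto simp: cpole_def kap_def fps_X_mult_nth power_eq_if)
  then show ?thesis by (simp add: algebra_simps)
qed

text \<open>The explicit inverse G clears denominators in the next two lemmas.\<close>

lemma unit_cpole: "\<exists>G. (1 - kap (z a) * fps_X) * G = 1 \<and> cpole z a = fps_X * G"
proof -
  have "(1 - kap (z a) * fps_X) $ 0 * 1 = 1" by simp
  then have G: "(1 - kap (z a) * fps_X) * fps_right_inverse (1 - kap (z a) * fps_X) 1 = 1"
    by (rule fps_right_inverse)
  have "cpole z a = cpole z a * ((1 - kap (z a) * fps_X) * fps_right_inverse (1 - kap (z a) * fps_X) 1)"
    unfolding G by simp
  then show ?thesis using G cpole_mult[of z a] by (metis mult.assoc)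
qed

lemma uderiv_cpole: "uderiv (cpole z a) = - (cpole z a * cpole z a)"
proof -
  obtain G where G: "(1 - kap (z a) * fps_X) * G = 1" "cpole z a = fps_X * G" using unit_cpole by blast
  let ?s = "1 - kap (z a) * fps_X"
  have "fps_deriv ?s = - kap (z a)" by (simp add: kap_def)
  moreover have "fps_deriv (?s * G) = 0" unfolding G(1) by simp
  ultimately have 1: "?s * fps_deriv G = kap (z a) * G" by (simp only: fps_deriv_mult) simp
  have "fps_deriv (cpole z a) = fps_X * fps_deriv G + G" by (simp add: G(2))
  then have "?s * fps_deriv (cpole z a) = fps_X * (kap (z a) * G) + ?s * G"
    by (simp only: distrib_left mult.left_commute[of ?s fps_X] 1)
  also have "\<dots> = G" by (simp add: algebra_simps)
  finally have "G * ?s * fps_deriv (cpole z a) = G * G" by (simp only: mult.assoc)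
  moreover have "G * ?s = 1" using G(1) by (simp only: mult.commute)
  ultimately have "fps_deriv (cpole z a) = G * G" by (simp only: mult_1_left)
  then show ?thesis by (simp add: uderiv_def G(2) power2_eq_square algebra_simps)
qed

lemma cpole_cpole:
  assumes "z a \<noteq> z b"
  shows "cpole z a * cpole z b = kap (1 / (z a - z b)) * (cpole z a - cpole z b)"
proof -
  obtain A where A: "(1 - kap (z a) * fps_X) * A = 1" "cpole z a = fps_X * A" using unit_cpole by blast
  obtain B where B: "(1 - kap (z b) * fps_X) * B = 1" "cpole z b = fps_X * B" using unit_cpole by blast
  have "A - B = A * ((1 - kap (z b) * fps_X) * B) - ((1 - kap (z a) * fps_X) * A) * B" using A B by simp
  also have "\<dots> = (kap (z a) - kap (z b)) * fps_X * A * B" by (simp add: algebra_simps)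
  finally have "kap (1 / (z a - z b)) * (A - B) = kap (1 / (z a - z b) * (z a - z b)) * (fps_X * A * B)"
    by (simp only: kap_simps mult.assoc)
  then have "kap (1 / (z a - z b)) * (A - B) = fps_X * A * B" using assms by (simp add: kap_simps)
  then have H: "kap (1 / (z a - z b)) * (A - B) = fps_X * A * B" .
  have "kap (1 / (z a - z b)) * (fps_X * A - fps_X * B) = fps_X * (kap (1 / (z a - z b)) * (A - B))"
    by (simp add: algebra_simps)
  also have "\<dots> = fps_X * A * (fps_X * B)" unfolding H by (simp only: ac_simps)
  finally show ?thesis unfolding A(2) B(2) ..
qed

interpretation cap: capelli uderiv "fps_const fps_X" "\<lambda>i. fps_const (1 - fps_const (K i) * fps_X)" "cpole z" N n g
  for K z :: "nat \<Rightarrow> complex" and N n :: nat and g :: "nat \<Rightarrow> nat"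
proof
  show "uderiv (p * q) = uderiv p * q + p * uderiv q" for p q by (simp add: uderiv_def algebra_simps)
qed (simp_all add: uderiv_cpole, simp_all add: uderiv_def algebra_simps)

lemma sum_fun_apply: "(\<Sum>i\<in>I. A i) x = (\<Sum>i\<in>I. (A i x :: 'b::comm_monoid_add))"
  by (induction I rule: infinite_finite_induct) simp_all

lemma user_sum_apply: "(\<Sum>i\<in>I. (A i :: user)) k f g = (\<Sum>i\<in>I. A i k f g)"
  by (induction I rule: infinite_finite_induct) simp_all

lemma uscale_1: "uscale 1 A = A"
  by (simp add: uscale_def osc_def)

lemma dcomp_length: "P \<noteq> [] \<Longrightarrow> length (dcomp N n [A, B] P) = Suc (length P)"
  by (simp add: dcomp_def)

text \<open>The Leibniz rule for a first order operator A + B d/du: the derivative falls on a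
  coefficient or raises the order.\<close>

lemma dcomp_nth:
  assumes "P \<noteq> []" "m \<le> length P"
  shows "dcomp N n [A, B] P ! m = (if m < length P then umul N n A (P ! m) + umul N n B (uder (P ! m)) else 0)
     + (if 1 \<le> m then umul N n B (P ! (m - 1)) else 0)"
proof -
  have "[0..<Suc (length P)] ! m = m" using assms by (simp del: upt_Suc)
  then show ?thesis using assms
    by (cases m) (auto simp: dcomp_def numeral_2_eq_2 lessThan_Suc atMost_Suc uscale_1 simp del: upt_Suc)
qed

lemma ocomp_eq_vact: "ocomp N n A B f g = vact N n A (\<lambda>h. B h g) f"
  by (simp add: ocomp_def vact_def)

lemma ocomp_zero_left [simp]: "ocomp N n 0 B = 0"
  by (simp add: ocomp_def fun_eq_iff)

lemma umul_uconst: "umul N n (uconst c) B k = ocomp N n c (B k)"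
proof -
  have "umul N n (uconst c) B k = (\<Sum>p\<le>k. if p = 0 then ocomp N n c (B k) else 0)"
    unfolding umul_def uconst_def by (intro sum.cong refl) auto
  then show ?thesis by simp
qed

lemma umul_diff: "umul N n (A - A') B k f g = umul N n A B k f g - umul N n A' B k f g"
  by (simp add: umul_def op_sum_apply ocomp_def left_diff_distrib sum_subtractf)

lemma umul_ecur:
  assumes "f \<in> Idx N n" "i < N"
  shows "umul N n (ecur n z j i) B k f g
     = (\<Sum>a<n. if f a = j then \<Sum>p\<le>k. (if p = 0 then 0 else z a ^ (p - 1)) * B (k - p) (f(a := i)) g else 0)"
proof -
  have "ocomp N n (ecur n z j i p) C f g = (\<Sum>a<n. if f a = j then (if p = 0 then 0 else z a ^ (p - 1)) * C (f(a := i)) g else 0)" for p C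
  proof (cases "p = 0")
    case True
    then show ?thesis by (simp add: ecur_def cong: if_cong)
  next
    case False
    then have "ocomp N n (ecur n z j i p) C f g = (\<Sum>a<n. z a ^ (p - 1) * vact N n (Eop a j i) (\<lambda>h. C h g) f)"
      by (simp add: ecur_def ocomp_eq_vact vact_sum vact_osc)
    also have "\<dots> = (\<Sum>a<n. if f a = j then (if p = 0 then 0 else z a ^ (p - 1)) * C (f(a := i)) g else 0)"
      using False by (intro sum.cong refl) (auto simp: vact_Eop assms)
    finally show ?thesis .
  qed
  then have "umul N n (ecur n z j i) B k f g
     = (\<Sum>p\<le>k. \<Sum>a<n. if f a = j then (if p = 0 then 0 else z a ^ (p - 1)) * B (k - p) (f(a := i)) g else 0)"
    by (simp add: umul_def op_sum_apply)
  also have "\<dots> = (\<Sum>a<n. if f a = j then \<Sum>p\<le>k. (if p = 0 then 0 else z a ^ (p - 1)) * B (k - p) (f(a := i)) g else 0)"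
    by (subst sum.swap, rule sum.cong) auto
  finally show ?thesis .
qed

lemma uderiv_nth: "uderiv p $ k = - (of_nat (k - 1) * p $ (k - 1))"
proof -
  consider "k = 0" | "k = 1" | m where "k = Suc (Suc m)" by (metis One_nat_def not0_implies_Suc)
  then show ?thesis
    by cases (simp_all add: uderiv_def power2_eq_square mult.assoc fps_X_mult_nth)
qed

lemma symb_nth: "symb g P f $ j $ l = (if l < length P then (P ! (length P - 1 - l)) j f g else 0)"
  by (simp add: symb_def)

lemma fps_sum_atMost: "(p * q) $ k = (\<Sum>i\<le>k. p $ i * q $ (k - i))" for p q :: "'a::comm_ring_1 fps"
  by (simp add: fps_mult_nth atLeast0AtMost)

text \<open>The bridge from coefficient lists to the abstract rows. Composition raises the order by
  one; counted from the top, position l therefore combines position l of P, through d/du, with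
  position l - 1, through the other terms.\<close>

lemma symb_dcomp:
  assumes "f \<in> Idx N n" "i < N" "P \<noteq> []"
  shows "symb g (dcomp N n (mop n K z i j) P) f = cap.row K z n i j (symb g P) f"
proof (intro fps_ext)
  fix k l
  define A B where "A = uconst (if i = j then osc (- K i) oid else 0) - ecur n z j i" and "B = uconst (if i = j then oid else 0)"
  let ?F = "symb g P f $ k"
  have oid_act: "ocomp N n (osc c oid) D f g = c * D f g" "ocomp N n oid D f g = D f g" for c D
    using assms(1) by (simp_all add: ocomp_eq_vact vact_osc vact_oid)
  have A: "umul N n A D k f g = (if i = j then - K i * D k f g else 0)
     - (\<Sum>a<n. if f a = j then \<Sum>p\<le>k. (if p = 0 then 0 else z a ^ (p - 1)) * D (k - p) (f(a := i)) g else 0)" for D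
    unfolding A_def umul_diff by (simp add: umul_uconst oid_act umul_ecur[OF assms(1,2)])
  have B: "umul N n B D k f g = (if i = j then D k f g else 0)" for D
    unfolding B_def by (simp add: umul_uconst oid_act)
  have ud: "uder D k f g = - (of_nat (k - 1) * D (k - 1) f g)" for D
    by (cases k) (simp_all add: uder_def osc_def algebra_simps)
  have len: "1 \<le> length P" using assms(3) by (cases P) auto
  have poles: "(fps_const fps_X * cpole z a * symb g P (f(a := i))) $ k $ l
     = (if l = 0 then 0 else \<Sum>p\<le>k. (if p = 0 then 0 else z a ^ (p - 1)) * symb g P (f(a := i)) $ (k - p) $ (l - 1))" for a
  proof -
    have "(fps_const fps_X * cpole z a * symb g P (f(a := i))) $ k = fps_X * (cpole z a * symb g P (f(a := i))) $ k"
      by (simp only: mult.assoc fps_mult_left_const_nth)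
    also have "\<dots> = fps_X * (\<Sum>p\<le>k. cpole z a $ p * symb g P (f(a := i)) $ (k - p))"
      by (simp only: fps_sum_atMost)
    finally show ?thesis
      by (simp add: fps_X_mult_nth fps_sum_nth) (intro impI sum.cong refl, simp add: cpole_def)
  qed
  have row: "cap.row K z n i j (symb g P) f $ k $ l
     = (if i = j then ?F $ l - (if l = 0 then 0 else K i * ?F $ (l - 1))
         - (if l = 0 then 0 else of_nat (k - 1) * symb g P f $ (k - 1) $ (l - 1)) else 0)
       - (if l = 0 then 0 else \<Sum>a<n. if f a = j then \<Sum>p\<le>k. (if p = 0 then 0 else z a ^ (p - 1)) * symb g P (f(a := i)) $ (k - p) $ (l - 1) else 0)"
  proof -
    have 1: "(fps_const (1 - fps_const (K i) * fps_X) * symb g P f) $ k $ l = ?F $ l - (if l = 0 then 0 else K i * ?F $ (l - 1))"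
      by (simp add: left_diff_distrib mult.assoc fps_X_mult_nth)
    have 2: "(fps_const fps_X * uderiv (symb g P f)) $ k $ l = - (if l = 0 then 0 else of_nat (k - 1) * symb g P f $ (k - 1) $ (l - 1))"
      by (simp add: uderiv_nth fps_X_mult_nth fps_of_nat[symmetric])
    have 3: "(\<Sum>a<n. if f a = j then fps_const fps_X * cpole z a * symb g P (f(a := i)) else 0) $ k $ l
      = (if l = 0 then 0 else \<Sum>a<n. if f a = j then \<Sum>p\<le>k. (if p = 0 then 0 else z a ^ (p - 1)) * symb g P (f(a := i)) $ (k - p) $ (l - 1) else 0)"
      unfolding fps_sum_nth by (simp add: if_distrib[of "\<lambda>x. x $ k"] if_distrib[of "\<lambda>x. x $ l"] poles cong: if_cong)
    show ?thesis unfolding cap.row_def fps_sub_nth 3 using 1 2 by auto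
  qed
  show "symb g (dcomp N n (mop n K z i j) P) f $ k $ l = cap.row K z n i j (symb g P) f $ k $ l"
  proof (cases "l \<le> length P")
    case False
    then have "\<not> l - 1 < length P" "\<not> l < length P" by auto
    then show ?thesis unfolding row using False by (simp add: symb_nth mop_def dcomp_length[OF assms(3)] cong: if_cong)
  next
    case True
    have mop: "mop n K z i j = [A, B]" by (simp add: mop_def A_def B_def)
    have "symb g (dcomp N n (mop n K z i j) P) f $ k $ l = (dcomp N n [A, B] P ! (length P - l)) k f g"
      using True by (simp add: symb_nth mop dcomp_length[OF assms(3)])
    also have "\<dots> = (if l \<noteq> 0 then umul N n A (P ! (length P - l)) k f g + umul N n B (uder (P ! (length P - l))) k f g else 0)
       + (if l < length P then umul N n B (P ! (length P - l - 1)) k f g else 0)"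
      using True assms(3) len by (subst dcomp_nth) (auto simp: Suc_le_eq)
    also have "\<dots> = cap.row K z n i j (symb g P) f $ k $ l"
    proof (cases l)
      case 0
      then show ?thesis unfolding row using assms(3) by (simp add: B symb_nth)
    next
      case (Suc l')
      then have "length P - l = length P - 1 - l'" "l' < length P" using True by auto
      then show ?thesis unfolding row A B ud using Suc by (simp add: symb_nth cong: if_cong)
    qed
    finally show ?thesis .
  qed
qed

lemma row_cong_Idx:
  assumes "f \<in> Idx N n" "i < N" "\<And>h. h \<in> Idx N n \<Longrightarrow> F h = G h"
  shows "cap.row K z n i j F f = cap.row K z n i j G f"
  unfolding cap.row_def using assms by (auto intro!: arg_cong2[of _ _ _ _ "(-)"] sum.cong simp: Idx_upd)

text \<open>The length is tracked because every \<open>mop\<close> is a list of length two, with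
  zero top coefficient off the diagonal. So the products for all \<sigma> have equal length and are
  divided by the same power of x.\<close>

lemma symb_foldr:
  assumes "set is \<subseteq> {..<N}" "f \<in> Idx N n"
  shows "length (foldr (dcomp N n) (map (\<lambda>i. mop n K z i (\<sigma> i)) is) [uconst oid]) = Suc (length is) \<and>
     symb g (foldr (dcomp N n) (map (\<lambda>i. mop n K z i (\<sigma> i)) is) [uconst oid]) f
      = foldr (\<lambda>k. cap.row K z n k (\<sigma> k)) is (\<lambda>f. if f = g then 1 else 0) f"
  using assms
proof (induction "is" arbitrary: f)
  case Nil
  show ?case
    by (auto simp: symb_def uconst_def oid_def intro!: fps_ext)
next
  case (Cons i xs)
  let ?P = "foldr (dcomp N n) (map (\<lambda>i. mop n K z i (\<sigma> i)) xs) [uconst oid]"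
  have IH: "length ?P = Suc (length xs)" "\<And>h. h \<in> Idx N n \<Longrightarrow> symb g ?P h = foldr (\<lambda>k. cap.row K z n k (\<sigma> k)) xs (\<lambda>f. if f = g then 1 else 0) h"
    using Cons by auto
  have ne: "?P \<noteq> []" using IH(1) by auto
  have "symb g (dcomp N n (mop n K z i (\<sigma> i)) ?P) f = cap.row K z n i (\<sigma> i) (symb g ?P) f"
    by (rule symb_dcomp) (use Cons.prems ne in auto)
  also have "\<dots> = cap.row K z n i (\<sigma> i) (foldr (\<lambda>k. cap.row K z n k (\<sigma> k)) xs (\<lambda>f. if f = g then 1 else 0)) f"
    by (rule row_cong_Idx) (use Cons.prems IH(2) in auto)
  finally show ?case using IH(1) ne by (simp add: mop_def dcomp_length)
qed

definition Dsym :: "nat \<Rightarrow> nat \<Rightarrow> (nat \<Rightarrow> complex) \<Rightarrow> (nat \<Rightarrow> complex) \<Rightarrow> (nat \<Rightarrow> nat) \<Rightarrow> (nat \<Rightarrow> nat) \<Rightarrow> complex fps fps" where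
  "Dsym N n K z g f = (\<Sum>\<sigma>\<in>{\<sigma>. \<sigma> permutes {..<N}}. of_int (sign \<sigma>) * cap.rows K z n N \<sigma> (\<lambda>f. if f = g then 1 else 0) f)"

lemma of_int_fps_fps_nth: "(of_int c * p) $ j $ l = of_int c * p $ j $ l" for p :: "complex fps fps"
  by (simp add: fps_of_int[symmetric])

lemma Dsym_nth:
  assumes "f \<in> Idx N n"
  shows "Dsym N n K z g f $ j $ l = (if l \<le> N then Dcoef N n K z (N - l) j f g else 0)"
proof -
  let ?P = "\<lambda>\<sigma>. foldr (dcomp N n) (map (\<lambda>i. mop n K z i (\<sigma> i)) [0..<N]) [uconst oid]"
  have P: "length (?P \<sigma>) = Suc N" "symb g (?P \<sigma>) f = cap.rows K z n N \<sigma> (\<lambda>f. if f = g then 1 else 0) f" for \<sigma>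
    using symb_foldr[OF _ assms, of "[0..<N]" K z \<sigma> g] by (simp_all add: cap.rows_def lessThan_atLeast0)
  have "Dsym N n K z g f $ j $ l = (\<Sum>\<sigma>\<in>{\<sigma>. \<sigma> permutes {..<N}}. of_int (sign \<sigma>) * symb g (?P \<sigma>) f $ j $ l)"
    unfolding Dsym_def fps_sum_nth of_int_fps_fps_nth P(2) ..
  also have "\<dots> = (if l \<le> N then Dcoef N n K z (N - l) j f g else 0)"
    by (simp add: symb_nth P(1) Dcoef_def user_sum_apply uscale_def osc_def dcoef_def less_Suc_eq_le)
  finally show ?thesis .
qed

section \<open>From the row determinant to the series \<Psi>\<close>

text \<open>The product of these series over the K_i is the factor x^N \<Prod>(x - K_i)^(-1) in
  \<Psi>.\<close>

definition gs :: "complex \<Rightarrow> complex fps" where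
  "gs k = Abs_fps (\<lambda>t. k ^ t)"

lemma gs_mult: "gs k * (1 - fps_const k * fps_X) = 1"
proof (rule fps_ext)
  fix j show "(gs k * (1 - fps_const k * fps_X)) $ j = 1 $ j"
    by (cases j) (simp_all add: right_diff_distrib gs_def fps_mult_left_const_nth mult.left_commute[of _ "fps_const k"])
qed

lemma prod_fps_const: "(\<Prod>a\<in>A. fps_const (h a)) = fps_const (prod h A)"
  by (induction A rule: infinite_finite_induct) simp_all

lemma prod_nth_0: "(\<Prod>a\<in>A. h a) $ 0 = (\<Prod>a\<in>A. h a $ 0)" for h :: "'b \<Rightarrow> 'a::comm_ring_1 fps"
  by (induction A rule: infinite_finite_induct) simp_all

lemma X_gs: "fps_X * gs k = geo k"
  by (rule fps_ext) (simp add: gs_def geo_def)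

lemma alt_nonzero:
  assumes "alt B f g \<noteq> 0"
  obtains \<pi> where "\<pi> permutes B" "f = g \<circ> \<pi>"
proof -
  have "\<exists>\<pi>. \<pi> permutes B \<and> f = g \<circ> \<pi>"
  proof (rule ccontr)
    assume "\<not> ?thesis"
    then have "alt B f g = 0" unfolding alt_def by (intro sum.neutral) auto
    then show False using assms by simp
  qed
  then show thesis using that by blast
qed

text \<open>The normalising factors cancel the \<xi> of the idle rows and leave one for each row in
  g(B), which y turns into 1/(x - K). When the antisymmetrizer entry is nonzero, f is a
  rearrangement of g on B, so the product may be written with f.\<close>

lemma alt_wt:
  assumes B: "B \<subseteq> {..<n}" and g: "g ` {..<n} \<subseteq> {..<N}"
  shows "fps_const (\<Prod>i<N. gs (K i)) * (of_int (alt B f g) * cap.wt K z N g 0 B)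
     = of_int (alt B f g) * (\<Prod>b\<in>B. - (cpole z b * fps_const (geo (K (f b)))))"
proof (cases "alt B f g = 0")
  case False
  have fin: "finite B" using B by (auto intro: finite_subset)
  have inj: "inj_on g B" using False alt_eq_0_if_not_inj[OF fin] by blast
  obtain \<pi> where \<pi>: "\<pi> permutes B" "f = g \<circ> \<pi>" using alt_nonzero[OF False] .
  let ?x = "\<lambda>k. 1 - fps_const (K k) * fps_X"
  have gB: "g ` B \<subseteq> {..<N}" using B g by auto
  have "(\<Prod>i<N. gs (K i)) * (\<Prod>k\<in>{0..<N} - g ` B. ?x k)
      = (\<Prod>k\<in>g ` B. gs (K k)) * ((\<Prod>k\<in>{..<N} - g ` B. gs (K k)) * (\<Prod>k\<in>{..<N} - g ` B. ?x k))"
    using prod.subset_diff[OF gB, of "\<lambda>k. gs (K k)"] by (simp add: lessThan_atLeast0 ac_simps)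
  also have "(\<Prod>k\<in>{..<N} - g ` B. gs (K k)) * (\<Prod>k\<in>{..<N} - g ` B. ?x k) = 1"
    unfolding prod.distrib[symmetric] by (intro prod.neutral) (simp add: gs_mult)
  also have "(\<Prod>k\<in>g ` B. gs (K k)) = (\<Prod>b\<in>B. gs (K (g b)))"
    by (simp add: prod.reindex[OF inj])
  also have "\<dots> = (\<Prod>b\<in>B. gs (K (f b)))"
    using prod.permute[OF \<pi>(1), of "\<lambda>b. gs (K (g b))"] by (simp add: \<pi>(2) comp_def)
  finally have 1: "fps_const (\<Prod>i<N. gs (K i)) * (\<Prod>k\<in>{0..<N} - g ` B. fps_const (?x k)) = (\<Prod>b\<in>B. fps_const (gs (K (f b))))"
    by (simp add: prod_fps_const)
  have "fps_const (\<Prod>i<N. gs (K i)) * cap.wt K z N g 0 B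
     = (\<Prod>b\<in>B. - (fps_const fps_X * cpole z b)) * (fps_const (\<Prod>i<N. gs (K i)) * (\<Prod>k\<in>{0..<N} - g ` B. fps_const (?x k)))"
    unfolding cap.wt_def by (simp only: ac_simps)
  also have "\<dots> = (\<Prod>b\<in>B. - (fps_const fps_X * cpole z b) * fps_const (gs (K (f b))))"
    unfolding 1 by (simp only: prod.distrib)
  also have "\<dots> = (\<Prod>b\<in>B. - (cpole z b * fps_const (geo (K (f b)))))"
    by (intro prod.cong refl) (simp add: X_gs[symmetric] fps_const_mult[symmetric] ac_simps del: fps_const_mult)
  finally have "fps_const (\<Prod>i<N. gs (K i)) * cap.wt K z N g 0 B = (\<Prod>b\<in>B. - (cpole z b * fps_const (geo (K (f b)))))" .
  then show ?thesis by (simp only: mult.left_commute[of "fps_const _" "of_int _"])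
qed simp

lemma of_int_eq_kap: "of_int c = kap (of_int c)"
  by (simp add: kap_def fps_of_int)

lemma Psi_series:
  assumes g: "g ` {..<n} \<subseteq> {..<N}" and z: "inj_on z {..<n}"
  shows "fps_const (\<Prod>i<N. gs (K i)) * Dsym N n K z g f
      = of_bool (f = g) - (\<Sum>a<n. cpole z a * fps_const (resid n K z g a f))"
proof -
  define P where "P = (\<lambda>B. \<Prod>b\<in>B. geo (K (f b)))"
  define h where "h = (\<lambda>a B. kap ((- 1) ^ card B * pfc z a B * of_int (alt B f g)) * cpole z a * fps_const (P B))"
  have "fps_const (\<Prod>i<N. gs (K i)) * Dsym N n K z g f
     = (\<Sum>B\<in>Pow {..<n}. of_int (alt B f g) * (\<Prod>b\<in>B. - (cpole z b * fps_const (geo (K (f b))))))"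
    unfolding Dsym_def cap.sum_rows_eq[OF g] sum_distrib_left by (rule sum.cong[OF refl], rule alt_wt[OF _ g]) simp
  \<comment> \<open>The empty set has no partial fraction expansion; it gives the constant
    term.\<close>
  also have "\<dots> = (\<Sum>B\<in>Pow {..<n}. (if B = {} then of_bool (f = g) else 0) + (\<Sum>a\<in>B. h a B))"
  proof (rule sum.cong[OF refl])
    fix B assume "B \<in> Pow {..<n}"
    then have B: "finite B" "inj_on z B" using z by (auto intro: finite_subset inj_on_subset)
    show "of_int (alt B f g) * (\<Prod>b\<in>B. - (cpole z b * fps_const (geo (K (f b)))))
       = (if B = {} then of_bool (f = g) else 0) + (\<Sum>a\<in>B. h a B)"
    proof (cases "B = {}")
      case False
      have "(\<Prod>b\<in>B. cpole z b) = (\<Sum>a\<in>B. kap (pfc z a B) * cpole z a)"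
        by (rule prod_partial_fractions[OF B(1) False B(2)])
           (use B in \<open>auto simp: kap_simps inj_on_def intro!: cpole_cpole\<close>)
      moreover have "(\<Prod>b\<in>B. - (cpole z b * fps_const (geo (K (f b)))))
         = (- 1) ^ card B * ((\<Prod>b\<in>B. cpole z b) * fps_const (P B))"
        by (simp add: prod_uminus prod.distrib P_def prod_fps_const)
      ultimately have "of_int (alt B f g) * (\<Prod>b\<in>B. - (cpole z b * fps_const (geo (K (f b)))))
         = (\<Sum>a\<in>B. of_int (alt B f g) * ((- 1) ^ card B * (kap (pfc z a B) * cpole z a * fps_const (P B))))"
        by (simp only: sum_distrib_left sum_distrib_right)
      also have "\<dots> = (\<Sum>a\<in>B. h a B)"
      proof (rule sum.cong[OF refl])
        fix a
        have "(- 1) ^ card B = kap ((- 1) ^ card B)"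
          by (cases "even (card B)") (simp_all add: kap_def fps_const_neg[symmetric] del: fps_const_neg)
        then show "of_int (alt B f g) * ((- 1) ^ card B * (kap (pfc z a B) * cpole z a * fps_const (P B))) = h a B"
          unfolding h_def by (simp only: of_int_eq_kap kap_simps ac_simps)
      qed
      finally show ?thesis using False by simp
    qed (simp add: alt_empty)
  qed
  also have "\<dots> = of_bool (f = g) + (\<Sum>B\<in>Pow {..<n}. \<Sum>a\<in>B. h a B)"
    unfolding sum.distrib by (subst sum.delta) auto
  also have "(\<Sum>B\<in>Pow {..<n}. \<Sum>a\<in>B. h a B) = (\<Sum>a<n. \<Sum>C\<in>Pow ({..<n} - {a}). h a (insert a C))"
    by (rule sum_Pow_pick) simp
  also have "\<dots> = (\<Sum>a<n. - (cpole z a * fps_const (resid n K z g a f)))"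
  proof (rule sum.cong[OF refl])
    fix a
    have "(\<Sum>C\<in>Pow ({..<n} - {a}). h a (insert a C))
      = (\<Sum>C\<in>Pow ({..<n} - {a}). - cpole z a * fps_const (fps_const ((- 1) ^ card C * pfc z a (insert a C) * of_int (alt (insert a C) f g)) * P (insert a C)))"
    proof (rule sum.cong[OF refl])
      fix C assume "C \<in> Pow ({..<n} - {a})"
      then have "finite C" "a \<notin> C" by (auto intro: finite_subset)
      then have "(- 1 :: complex) ^ card (insert a C) = - ((- 1) ^ card C)" by simp
      then show "h a (insert a C) = - cpole z a * fps_const (fps_const ((- 1) ^ card C * pfc z a (insert a C) * of_int (alt (insert a C) f g)) * P (insert a C))"
        unfolding h_def kap_def by (simp add: fps_const_mult[symmetric] fps_const_neg[symmetric] ac_simps del: fps_const_mult fps_const_neg)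
    qed
    also have "\<dots> = - (cpole z a * fps_const (resid n K z g a f))"
      unfolding resid_def P_def sum_fps_const[symmetric] sum_distrib_left sum_negf[symmetric] by simp
    finally show "(\<Sum>C\<in>Pow ({..<n} - {a}). h a (insert a C)) = - (cpole z a * fps_const (resid n K z g a f))" .
  qed
  finally show ?thesis by (simp add: sum_negf)
qed

lemma PsiC_eq:
  assumes f: "f \<in> Idx N n" and g: "g \<in> Idx N n" and z: "inj_on z {..<n}"
  shows "PsiC N n K z i j f g = of_bool (i = 0 \<and> j = 0 \<and> f = g)
     - (if j = 0 then 0 else \<Sum>a<n. z a ^ (j - 1) * resid n K z g a f $ i)"
proof -
  let ?H = "\<Prod>i<N. gs (K i)" and ?D = "Dsym N n K z g f"
  have gN: "g ` {..<n} \<subseteq> {..<N}" using Idx_less[OF g] by auto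
  have ser: "?H * ?D $ j = (of_bool (f = g) - (\<Sum>a<n. cpole z a * fps_const (resid n K z g a f))) $ j"
    unfolding Psi_series[OF gN z, symmetric] by simp
  have ser_nth: "(?H * ?D $ j) $ i = of_bool (i = 0 \<and> j = 0 \<and> f = g)
     - (if j = 0 then 0 else \<Sum>a<n. z a ^ (j - 1) * resid n K z g a f $ i)" for i
    unfolding ser by (simp add: fps_sum_nth cpole_def)
  have H0: "?H $ 0 = 1" by (simp add: prod_nth_0 gs_def)
  \<comment> \<open>\<open>Bfull\<close> sets the leading coefficient to 1 by definition; this shows
    that the determinant agrees.\<close>
  have D0: "?D $ j $ 0 = of_bool (j = 0 \<and> f = g)"
    using ser_nth[of 0] by (simp add: H0 resid_nth_0)
  have Bf: "Bfull N n K z l j f g = ?D $ j $ l" if "l \<le> N" for l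
  proof (cases "l = 0")
    case True
    then show ?thesis using D0 by (auto simp: Bfull_def uconst_def oid_def)
  next
    case False
    then show ?thesis using that by (simp add: Bfull_def Bethe_def Dsym_nth[OF f])
  qed
  have "PsiC N n K z i j f g = (\<Sum>l\<le>min i N. ?H $ (i - l) * ?D $ j $ l)"
    unfolding PsiC_def op_sum_apply by (intro sum.cong refl) (simp add: osc_def hK_def Bf gs_def)
  also have "\<dots> = (\<Sum>l\<le>i. ?D $ j $ l * ?H $ (i - l))"
    \<comment> \<open>Terms with l > N vanish, as the determinant has order N.\<close>
    by (rule sum.mono_neutral_cong_left) (auto simp: Dsym_nth[OF f])
  also have "\<dots> = (?H * ?D $ j) $ i"
    by (subst mult.commute) (simp add: fps_sum_atMost)
  finally show ?thesis unfolding ser_nth .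
qed

section \<open>Residues as row sums of the powers of Q\<close>

lemma mpow_Suc: "mpow N n Q (Suc k) a b = (\<Sum>c<n. ocomp N n (Q a c) (mpow N n Q k c b))"
  by (simp add: mpow_def mmul_def)

lemma vact_Qmat:
  assumes "f \<in> Idx N n" "a < n"
  shows "(\<Sum>c<n. vact N n (Qmat N n K z a c) (F c) f)
      = hact n K z a (F a) f + (\<Sum>c\<in>{..<n} - {a}. 1 / (z c - z a) * F c f)"
proof -
  have "(\<Sum>c<n. vact N n (Qmat N n K z a c) (F c) f) = vact N n (Qmat N n K z a a) (F a) f
      + (\<Sum>c\<in>{..<n} - {a}. vact N n (Qmat N n K z a c) (F c) f)"
    using assms(2) by (subst sum.remove[of _ a]) auto
  also have "(\<Sum>c\<in>{..<n} - {a}. vact N n (Qmat N n K z a c) (F c) f) = (\<Sum>c\<in>{..<n} - {a}. 1 / (z c - z a) * F c f)"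
    by (intro sum.cong refl) (auto simp: Qmat_def vact_osc vact_oid assms(1))
  finally show ?thesis by (simp add: Qmat_def vact_gaudinH[OF assms])
qed

text \<open>Both sides obey the recursion of left multiplication by Q, starting from the all-ones
  vector. The shift by one is that of 1/(x - Q) = \<Sum> Q^k x^(-k-1).\<close>

lemma resid_eq_mpow:
  assumes z: "inj_on z {..<n}" and g: "g \<in> Idx N n" and "a < n" "f \<in> Idx N n"
  shows "resid n K z g a f $ Suc k = (\<Sum>b<n. mpow N n (Qmat N n K z) k a b f g)"
  using assms(3,4)
proof (induction k arbitrary: a f)
  case 0
  have "(\<Sum>b<n. mpow N n (Qmat N n K z) 0 a b f g) = (\<Sum>b<n. if b = a then of_bool (f = g) else 0)"
    by (intro sum.cong refl) (simp add: mpow_def mid_def oid_def)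
  then show ?case using 0 by (simp add: resid_nth_Suc[OF _ z] resid_nth_0 hact_def)
next
  case (Suc k)
  have "(\<Sum>b<n. mpow N n (Qmat N n K z) (Suc k) a b f g)
     = (\<Sum>b<n. \<Sum>c<n. vact N n (Qmat N n K z a c) (\<lambda>h. mpow N n (Qmat N n K z) k c b h g) f)"
    by (simp add: mpow_Suc op_sum_apply ocomp_eq_vact)
  also have "\<dots> = (\<Sum>c<n. vact N n (Qmat N n K z a c) (\<lambda>h. \<Sum>b<n. mpow N n (Qmat N n K z) k c b h g) f)"
    by (subst sum.swap) (simp add: vact_def sum_distrib_left, subst sum.swap, rule refl)
  also have "\<dots> = (\<Sum>c<n. vact N n (Qmat N n K z a c) (\<lambda>h. resid n K z g c h $ Suc k) f)"
    by (intro sum.cong refl vact_cong) (simp add: Suc.IH)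
  also have "\<dots> = resid n K z g a f $ Suc (Suc k)"
    by (simp add: vact_Qmat Suc.prems resid_nth_Suc[OF Suc.prems(1) z, of K g f "Suc k"])
  finally show ?case ..
qed

section \<open>Operators represented by polynomials\<close>

text \<open>The identity as default for a \<ge> n makes the family commute for all indices, as
  \<open>commuting_linear\<close> demands.\<close>

definition Hact :: "nat \<Rightarrow> (nat \<Rightarrow> complex) \<Rightarrow> (nat \<Rightarrow> complex) \<Rightarrow> nat \<Rightarrow> ((nat \<Rightarrow> nat) \<Rightarrow> complex) \<Rightarrow> (nat \<Rightarrow> nat) \<Rightarrow> complex" where
  "Hact n K z a F = (if a < n then hact n K z a F else F)"

lemma commuting_Hact: "inj_on z {..<n} \<Longrightarrow> commuting_linear (Hact n K z)"
proof
  assume z: "inj_on z {..<n}"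
  show "Hact n K z a (Hact n K z b F) = Hact n K z b (Hact n K z a F)" for a b F
    using hact_commute[OF _ _ z] by (simp add: Hact_def)
qed (auto simp: Hact_def hact_def fun_eq_iff algebra_simps sum.distrib sum_distrib_left add_divide_distrib)

locale gaudin =
  fixes N n :: nat and K z :: "nat \<Rightarrow> complex"
  assumes inj_z: "inj_on z {..<n}"

sublocale gaudin \<subseteq> commuting_linear "Hact n K z"
  using commuting_Hact[OF inj_z] .

context gaudin
begin

type_synonym hpoly = "nat multiset \<Rightarrow>\<^sub>0 complex"

definition pconst :: "complex \<Rightarrow> hpoly" where
  "pconst c = Poly_Mapping.single 0 c"

definition hvar :: "nat \<Rightarrow> hpoly" where
  "hvar a = Poly_Mapping.single {#a#} 1"

text \<open>An operator is represented by the polynomials in commuting variables \<open>h\<^sub>a\<close> that evaluate to it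
  at \<open>h\<^sub>a = H\<^sub>a\<close>; determinants are then computed in a commutative ring.\<close>

definition rep :: "op \<Rightarrow> hpoly \<Rightarrow> bool" where
  "rep A e \<longleftrightarrow> (\<forall>F. \<forall>f\<in>Idx N n. vact N n A F f = ev e F f)"

lemma rep_zero: "rep 0 0"
  by (simp add: rep_def vact_zero ev_zero)

lemma rep_one: "rep oid 1"
  by (simp add: rep_def vact_oid ev_one)

lemma rep_diff: "rep A e \<Longrightarrow> rep B e' \<Longrightarrow> rep (A - B) (e - e')"
  using vact_add[of N n A "- B"] by (simp add: rep_def vact_uminus ev_diff)

lemma rep_sum: "(\<And>i. i \<in> I \<Longrightarrow> rep (A i) (e i)) \<Longrightarrow> rep (\<Sum>i\<in>I. A i) (\<Sum>i\<in>I. e i)"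
  by (simp add: rep_def vact_sum ev_sum)

lemma ev_pconst: "ev (pconst c * e) F f = c * ev e F f"
  unfolding pconst_def ev_single_mult by simp

lemma rep_osc: "rep A e \<Longrightarrow> rep (osc c A) (pconst c * e)"
  by (simp add: rep_def vact_osc ev_pconst)

lemma rep_const: "rep (osc c oid) (pconst c)"
  using rep_osc[OF rep_one] by simp

lemma rep_ocomp:
  assumes "rep A e" "rep B e'"
  shows "rep (ocomp N n A B) (e * e')"
proof -
  have "vact N n (ocomp N n A B) F f = ev (e * e') F f" if f: "f \<in> Idx N n" for F f
  proof -
    have "vact N n A (vact N n B F) f = vact N n A (ev e' F) f"
      by (rule vact_cong) (use assms(2) in \<open>simp add: rep_def\<close>)
    then show ?thesis using assms(1) f by (simp add: vact_ocomp ev_mult rep_def)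
  qed
  then show ?thesis by (simp add: rep_def)
qed

lemma rep_gaudinH: "a < n \<Longrightarrow> rep (gaudinH N n K z a) (hvar a)"
  by (simp add: rep_def vact_gaudinH hvar_def ev_single Hact_def)

text \<open>Acting on the indicator function of g recovers column g.\<close>

lemma rep_entry:
  assumes "rep A e" "f \<in> Idx N n" "g \<in> Idx N n"
  shows "A f g = ev e (\<lambda>h. of_bool (h = g)) f"
  using assms vact_delta[of g N n A f] by (simp add: rep_def)

definition qmat :: "nat \<Rightarrow> nat \<Rightarrow> hpoly" where
  "qmat a b = (if a = b then hvar a else pconst (1 / (z b - z a)))"

lemma qmat_relation:
  assumes "a < n" "b < n"
  shows "(pconst (z b) - pconst (z a)) * qmat a b = of_bool (a \<noteq> b)"
proof (cases "a = b")
  case False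
  then have "z b - z a \<noteq> 0" using inj_z assms by (auto simp: inj_on_def)
  then show ?thesis using False
    by (simp add: qmat_def pconst_def single_diff[symmetric] mult_single)
qed simp

lemma rep_qpow: "a < n \<Longrightarrow> rep (mpow N n (Qmat N n K z) k a b) (qpow n qmat k a b)"
proof (induction k arbitrary: a)
  case 0
  then show ?case by (simp add: mpow_def mid_def rep_one rep_zero)
next
  case (Suc k)
  have "rep (Qmat N n K z a c) (qmat a c)" for c
    using Suc.prems by (simp add: Qmat_def qmat_def rep_gaudinH rep_const)
  then show ?case unfolding mpow_Suc qpow.simps by (intro rep_sum rep_ocomp Suc.IH) simp_all
qed

lemma sum_mpow_trace:
  assumes "f \<in> Idx N n" "g \<in> Idx N n"
  shows "(\<Sum>a<n. mpow N n (Qmat N n K z) k a a f g) = (\<Sum>a<n. \<Sum>b<n. mpow N n (Qmat N n K z) k a b f g)"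
proof -
  have "(\<Sum>a<n. \<Sum>b<n. qpow n qmat k a b) = (\<Sum>a<n. qpow n qmat k a a)"
    by (rule sum_qpow_eq_trace[where \<zeta> = "\<lambda>a. pconst (z a)"]) (rule qmat_relation)
  moreover have "(\<Sum>a<n. mpow N n (Qmat N n K z) k a a f g) = ev (\<Sum>a<n. qpow n qmat k a a) (\<lambda>h. of_bool (h = g)) f"
    unfolding ev_sum by (intro sum.cong refl rep_entry rep_qpow assms) simp
  moreover have "(\<Sum>a<n. \<Sum>b<n. mpow N n (Qmat N n K z) k a b f g) = ev (\<Sum>a<n. \<Sum>b<n. qpow n qmat k a b) (\<lambda>h. of_bool (h = g)) f"
    unfolding ev_sum by (intro sum.cong refl rep_entry rep_qpow assms) simp
  ultimately show ?thesis by simp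
qed

text \<open>The coefficient of x^(-k-1) in the trace formula. The sum of all entries of Q^k is a
  coefficient of the sum of the R_a, to which only singletons contribute, each with the diagonal
  operator 1/(x - K).\<close>

lemma trace_mpow:
  assumes f: "f \<in> Idx N n" and g: "g \<in> Idx N n"
  shows "(\<Sum>a<n. mpow N n (Qmat N n K z) k a a f g) = (\<Sum>i<N. \<Sum>a<n. osc (K i ^ k) (Eop a i i) f g)"
proof -
  have "(\<Sum>a<n. mpow N n (Qmat N n K z) k a a f g) = (\<Sum>a<n. resid n K z g a f $ Suc k)"
    unfolding sum_mpow_trace[OF assms] by (intro sum.cong refl) (simp add: resid_eq_mpow[OF inj_z g _ f])
  also have "\<dots> = (of_bool (f = g) * (\<Sum>a<n. geo (K (f a)))) $ Suc k"
    unfolding sum_resid[OF inj_z, symmetric] by (simp add: fps_sum_nth)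
  also have "\<dots> = (\<Sum>a<n. of_bool (f = g) * K (f a) ^ k)"
    by (simp add: geo_def fps_sum_nth)
  also have "\<dots> = (\<Sum>a<n. \<Sum>i<N. if i = f a then of_bool (f = g) * K i ^ k else 0)"
    using Idx_less[OF f] by simp
  also have "\<dots> = (\<Sum>a<n. \<Sum>i<N. osc (K i ^ k) (Eop a i i) f g)"
  proof -
    have "Eop a i i f g = of_bool (f = g \<and> i = f a)" for a i
    proof -
      have "f a = i \<and> g a = i \<and> (\<forall>b. b \<noteq> a \<longrightarrow> f b = g b) \<longleftrightarrow> f = g \<and> i = f a" by (metis ext)
      then show ?thesis by (simp add: Eop_def)
    qed
    then show ?thesis by (intro sum.cong refl) (auto simp: osc_def)
  qed
  finally show ?thesis by (subst sum.swap)
qed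

definition srep :: "bser \<Rightarrow> hpoly fps fps \<Rightarrow> bool" where
  "srep S e \<longleftrightarrow> (\<forall>i j. rep (S i j) (e $ i $ j))"

lemma srep_bone: "srep bone 1"
  by (auto simp: srep_def bone_def rep_one rep_zero)

lemma srep_zero: "srep 0 0"
  by (simp add: srep_def rep_zero)

lemma srep_diff: "srep S e \<Longrightarrow> srep T e' \<Longrightarrow> srep (S - T) (e - e')"
  by (simp add: srep_def rep_diff)

lemma srep_bmul: "srep S e \<Longrightarrow> srep T e' \<Longrightarrow> srep (bmul N n S T) (e * e')"
  by (simp add: srep_def bmul_def fps_sum_atMost fps_sum_nth rep_sum rep_ocomp)

definition mser :: "nat \<Rightarrow> nat \<Rightarrow> hpoly fps fps" where
  "mser a b = Abs_fps (\<lambda>i. Abs_fps (\<lambda>j. if 1 \<le> i \<and> 1 \<le> j then pconst (z a) ^ (j - 1) * qpow n qmat (i - 1) a b else 0))"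

lemma pconst_power: "pconst c ^ k = pconst (c ^ k)"
  by (induction k) (simp_all add: pconst_def mult_single)

lemma srep_Mser: "a < n \<Longrightarrow> srep (Mser N n K z a b) (mser a b)"
  by (simp add: srep_def Mser_def mser_def pconst_power rep_osc rep_qpow rep_zero)

lemma srep_foldr:
  assumes "\<And>a. a \<in> set xs \<Longrightarrow> srep (S a) (e a)"
  shows "srep (foldr (bmul N n) (map S xs) bone) (prod_list (map e xs))"
  using assms by (induction xs) (simp_all add: srep_bone srep_bmul)

text \<open>The ordered operator products of the Leibniz formula are represented by products in a
  commutative ring, where the sum is a genuine determinant and \<open>det_resolvents\<close>
  applies.\<close>

lemma srep_psiC: "srep (psiC N n K z) (1 - (\<Sum>a<n. \<Sum>b<n. mser a b))"
proof -
  let ?e = "\<lambda>a b. (if a = b then 1 else 0) - mser a b"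
  have row: "srep (foldr (bmul N n) (map (\<lambda>a. (if \<sigma> a = a then bone else 0) - Mser N n K z a (\<sigma> a)) [0..<n]) bone)
      (\<Prod>a<n. ?e a (\<sigma> a))" for \<sigma>
  proof -
    have "srep ((if \<sigma> a = a then bone else 0) - Mser N n K z a (\<sigma> a)) (?e a (\<sigma> a))" if "a < n" for a
    proof (rule srep_diff[OF _ srep_Mser[OF that]])
      show "srep (if \<sigma> a = a then bone else 0) (if a = \<sigma> a then 1 else 0)"
        using srep_bone srep_zero by (cases "\<sigma> a = a") (simp_all add: eq_commute[of a])
    qed
    then have "srep (foldr (bmul N n) (map (\<lambda>a. (if \<sigma> a = a then bone else 0) - Mser N n K z a (\<sigma> a)) [0..<n]) bone)
      (prod_list (map (\<lambda>a. ?e a (\<sigma> a)) [0..<n]))"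
      by (intro srep_foldr) simp
    also have "prod_list (map (\<lambda>a. ?e a (\<sigma> a)) [0..<n]) = (\<Prod>a<n. ?e a (\<sigma> a))"
      by (simp add: prod.list_conv_set_nth lessThan_atLeast0 prod.distinct_set_conv_list[symmetric])
    finally show ?thesis .
  qed
  have sgn: "(of_int c * p) $ i $ j = pconst (of_int c) * p $ i $ j" for c and p :: "hpoly fps fps" and i j
  proof -
    have "of_int c = pconst (of_int c)" by (simp add: pconst_def)
    then show ?thesis by (simp add: fps_of_int[symmetric])
  qed
  have "1 - (\<Sum>a<n. \<Sum>b<n. mser a b) = det (mat n n (\<lambda>(a, b). ?e a b))"
    unfolding mser_def by (rule det_resolvents[symmetric]) (rule qmat_relation)
  also have "\<dots> = (\<Sum>\<sigma>\<in>{\<sigma>. \<sigma> permutes {..<n}}. of_int (sign \<sigma>) * (\<Prod>a<n. ?e a (\<sigma> a)))"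
  proof -
    have "(\<Prod>a = 0..<n. mat n n (\<lambda>(a, b). ?e a b) $$ (a, \<sigma> a)) = (\<Prod>a<n. ?e a (\<sigma> a))" if "\<sigma> permutes {..<n}" for \<sigma>
      unfolding lessThan_atLeast0[symmetric]
      by (rule prod.cong[OF refl]) (use permutes_in_image[OF that] in auto)
    then show ?thesis by (subst det_def'[of _ n]) (simp_all add: lessThan_atLeast0)
  qed
  finally have eq: "1 - (\<Sum>a<n. \<Sum>b<n. mser a b) = (\<Sum>\<sigma>\<in>{\<sigma>. \<sigma> permutes {..<n}}. of_int (sign \<sigma>) * (\<Prod>a<n. ?e a (\<sigma> a)))" .
  show ?thesis unfolding srep_def eq psiC_def
  proof (intro allI)
    fix i j
    have "(\<Sum>\<sigma>\<in>{\<sigma>. \<sigma> permutes {..<n}}. (\<lambda>i j. osc (of_int (sign \<sigma>)) (foldr (bmul N n) (map (\<lambda>a. (if \<sigma> a = a then bone else 0) - Mser N n K z a (\<sigma> a)) [0..<n]) bone i j))) i j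
      = (\<Sum>\<sigma>\<in>{\<sigma>. \<sigma> permutes {..<n}}. osc (of_int (sign \<sigma>)) (foldr (bmul N n) (map (\<lambda>a. (if \<sigma> a = a then bone else 0) - Mser N n K z a (\<sigma> a)) [0..<n]) bone i j))"
      by (simp add: sum_fun_apply)
    moreover have "rep \<dots> ((\<Sum>\<sigma>\<in>{\<sigma>. \<sigma> permutes {..<n}}. of_int (sign \<sigma>) * (\<Prod>a<n. ?e a (\<sigma> a))) $ i $ j)"
      unfolding fps_sum_nth sgn by (intro rep_sum rep_osc) (use row in \<open>simp add: srep_def\<close>)
    ultimately show "rep ((\<Sum>\<sigma>\<in>{\<sigma>. \<sigma> permutes {..<n}}. (\<lambda>i j. osc (of_int (sign \<sigma>)) (foldr (bmul N n) (map (\<lambda>a. (if \<sigma> a = a then bone else 0) - Mser N n K z a (\<sigma> a)) [0..<n]) bone i j))) i j)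
      ((\<Sum>\<sigma>\<in>{\<sigma>. \<sigma> permutes {..<n}}. of_int (sign \<sigma>) * (\<Prod>a<n. ?e a (\<sigma> a))) $ i $ j)"
      by (simp only:)
  qed
qed

lemma psiC_eq:
  assumes f: "f \<in> Idx N n" and g: "g \<in> Idx N n"
  shows "psiC N n K z i j f g = of_bool (i = 0 \<and> j = 0 \<and> f = g)
     - (if i = 0 \<or> j = 0 then 0 else \<Sum>a<n. z a ^ (j - 1) * (\<Sum>b<n. mpow N n (Qmat N n K z) (i - 1) a b f g))"
proof -
  let ?d = "\<lambda>h. of_bool (h = g)"
  have "psiC N n K z i j f g = ev ((1 - (\<Sum>a<n. \<Sum>b<n. mser a b)) $ i $ j) ?d f"
    using srep_psiC rep_entry[OF _ f g] by (simp only: srep_def)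
  also have "\<dots> = ev ((1 :: hpoly fps fps) $ i $ j) ?d f - (\<Sum>a<n. \<Sum>b<n. ev (mser a b $ i $ j) ?d f)"
    by (simp only: fps_sub_nth fps_sum_nth ev_diff ev_sum)
  also have "ev ((1 :: hpoly fps fps) $ i $ j) ?d f = of_bool (i = 0 \<and> j = 0 \<and> f = g)"
    by (auto simp: ev_one ev_zero)
  also have "(\<Sum>a<n. \<Sum>b<n. ev (mser a b $ i $ j) ?d f) = (if i = 0 \<or> j = 0 then 0 else \<Sum>a<n. z a ^ (j - 1) * (\<Sum>b<n. mpow N n (Qmat N n K z) (i - 1) a b f g))"
    by (auto simp: mser_def ev_zero pconst_power ev_pconst sum_distrib_left rep_entry[OF rep_qpow f g] intro!: sum.cong)
  finally show ?thesis .
qed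

lemma PsiC_eq_psiC:
  assumes f: "f \<in> Idx N n" and g: "g \<in> Idx N n"
  shows "PsiC N n K z i j f g = psiC N n K z i j f g"
proof (cases i)
  case 0
  then show ?thesis by (simp add: PsiC_eq[OF assms inj_z] psiC_eq[OF assms] resid_nth_0)
next
  case (Suc k)
  have "(\<Sum>a<n. z a ^ (j - 1) * resid n K z g a f $ Suc k)
      = (\<Sum>a<n. z a ^ (j - 1) * (\<Sum>b<n. mpow N n (Qmat N n K z) k a b f g))"
    by (rule sum.cong[OF refl]) (simp only: resid_eq_mpow[OF inj_z g _ f] lessThan_iff)
  then show ?thesis
    using Suc by (simp add: PsiC_eq[OF assms inj_z] psiC_eq[OF assms])
qed

end

section \<open>The generated algebras\<close>

text \<open>Entries outside \<open>Idx\<close> carry no meaning, so membership is tested after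
  restriction; \<open>ingen_cong\<close> then allows any operator with the right entries on
  \<open>Idx\<close>.\<close>

definition ingen :: "nat \<Rightarrow> nat \<Rightarrow> op set \<Rightarrow> op \<Rightarrow> bool" where
  "ingen N n T A \<longleftrightarrow> ores N n A \<in> genalg N n T"

lemma ingen_cong:
  assumes "ingen N n T A" "\<And>f g. f \<in> Idx N n \<Longrightarrow> g \<in> Idx N n \<Longrightarrow> A f g = B f g"
  shows "ingen N n T B"
proof -
  have "ores N n A = ores N n B" using assms(2) by (auto simp: ores_def fun_eq_iff)
  then show ?thesis using assms(1) by (simp add: ingen_def)
qed

lemma ingen_mem: "A \<in> T \<Longrightarrow> ingen N n T A"
  by (simp add: ingen_def gen_gen)

lemma ingen_one: "ingen N n T oid"
  by (simp add: ingen_def gen_one)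

lemma ingen_add:
  assumes "ingen N n T A" "ingen N n T B"
  shows "ingen N n T (A + B)"
proof -
  have "ores N n (A + B) = ores N n A + ores N n B" by (auto simp: ores_def fun_eq_iff)
  then show ?thesis using assms by (simp add: ingen_def gen_add)
qed

lemma ingen_osc:
  assumes "ingen N n T A"
  shows "ingen N n T (osc c A)"
proof -
  have "ores N n (osc c A) = osc c (ores N n A)" by (auto simp: ores_def osc_def fun_eq_iff)
  then show ?thesis using assms by (simp add: ingen_def gen_scale)
qed

lemma ingen_zero: "ingen N n T 0"
  by (rule ingen_cong[OF ingen_osc[OF ingen_one, of _ _ _ 0]]) (simp add: osc_def)

lemma ingen_diff:
  assumes "ingen N n T A" "ingen N n T B"
  shows "ingen N n T (A - B)"
  by (rule ingen_cong[OF ingen_add[OF assms(1) ingen_osc[OF assms(2), of "- 1"]]]) (simp add: osc_def)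

lemma ingen_sum: "(\<And>i. i \<in> I \<Longrightarrow> ingen N n T (A i)) \<Longrightarrow> ingen N n T (\<Sum>i\<in>I. A i)"
  by (induction I rule: infinite_finite_induct) (simp_all add: ingen_zero ingen_add)

lemma ingen_ocomp:
  assumes "ingen N n T A" "ingen N n T B"
  shows "ingen N n T (ocomp N n A B)"
proof -
  have "ores N n (ocomp N n (ores N n A) (ores N n B)) = ores N n (ocomp N n A B)"
    by (auto simp: ores_def ocomp_def fun_eq_iff)
  then show ?thesis using assms unfolding ingen_def by (metis gen_mult)
qed

lemma genalg_subset:
  assumes "\<And>A. A \<in> S \<Longrightarrow> ingen N n T A"
  shows "genalg N n S \<subseteq> genalg N n T"
proof
  fix A assume "A \<in> genalg N n S"
  then show "A \<in> genalg N n T"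
  proof induction
    case (gen_gen A)
    then show ?case using assms by (simp add: ingen_def)
  qed (rule genalg.intros; assumption)+
qed

text \<open>The witness is the coefficient sequence of the Lagrange basis polynomial at the node
  z_a.\<close>

lemma lagrange_coefficients:
  fixes z :: "nat \<Rightarrow> complex"
  assumes "inj_on z {..<n}" "a < n"
  obtains c and d :: nat where "\<And>b. b < n \<Longrightarrow> (\<Sum>p\<le>d. c p * z b ^ p) = of_bool (b = a)"
proof -
  define L where "L = (\<Prod>b\<in>{..<n} - {a}. Polynomial.smult (1 / (z a - z b)) [:- z b, 1:])"
  have L: "poly L x = (\<Prod>b\<in>{..<n} - {a}. (x - z b) / (z a - z b))" for x
    by (simp add: L_def poly_prod diff_divide_distrib)
  have "poly L (z b) = of_bool (b = a)" if "b < n" for b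
  proof (cases "b = a")
    case True
    have "(z a - z e) / (z a - z e) = 1" if "e \<in> {..<n} - {a}" for e
      using assms that by (auto simp: inj_on_def)
    then show ?thesis using True by (simp add: L)
  next
    case False
    then show ?thesis unfolding L using that by (auto intro!: prod_zero bexI[of _ b])
  qed
  then show thesis using that[where c = "coeff L" and d = "degree L"] by (simp add: poly_altdef)
qed

context gaudin
begin

definition bethe_gens :: "op set" where
  "bethe_gens = {Bethe N n K z i j | i j. 1 \<le> i \<and> i \<le> N \<and> 1 \<le> j}"

definition gaudin_gens :: "op set" where
  "gaudin_gens = gaudinH N n K z ` {..<n}"

lemma ingen_mpow: "a < n \<Longrightarrow> ingen N n gaudin_gens (mpow N n (Qmat N n K z) k a b)"
proof (induction k arbitrary: a)
  case 0
  then show ?case by (simp add: mpow_def mid_def ingen_one ingen_zero)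
next
  case (Suc k)
  have "ingen N n gaudin_gens (Qmat N n K z a c)" for c
    using Suc.prems by (auto simp: Qmat_def gaudin_gens_def intro: ingen_mem ingen_osc ingen_one)
  then show ?case unfolding mpow_Suc by (intro ingen_sum ingen_ocomp Suc.IH) simp_all
qed

lemma PsiC_entry:
  assumes "f \<in> Idx N n" "g \<in> Idx N n" "1 \<le> j"
  shows "PsiC N n K z i j f g = (if i = 0 then 0
     else - (\<Sum>a<n. z a ^ (j - 1) * (\<Sum>b<n. mpow N n (Qmat N n K z) (i - 1) a b f g)))"
  using assms by (simp add: PsiC_eq_psiC psiC_eq)

lemma ingen_PsiC:
  assumes "1 \<le> j"
  shows "ingen N n gaudin_gens (PsiC N n K z i j)"
proof (cases "i = 0")
  case True
  then show ?thesis by (intro ingen_cong[OF ingen_zero]) (use assms in \<open>simp add: PsiC_entry\<close>)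
next
  case False
  have "ingen N n gaudin_gens (osc (- 1) (\<Sum>a<n. osc (z a ^ (j - 1)) (\<Sum>b<n. mpow N n (Qmat N n K z) (i - 1) a b)))"
    by (intro ingen_osc ingen_sum ingen_mpow) simp
  then show ?thesis
    by (rule ingen_cong) (use assms False in \<open>simp add: PsiC_entry osc_def op_sum_apply\<close>)
qed

text \<open>\<Psi> is the B-series times a scalar series in x^(-1) with constant term 1, so the
  passage is triangular and is inverted recursively in i.\<close>

lemma ingen_Bfull:
  assumes "1 \<le> j"
  shows "i \<le> N \<Longrightarrow> ingen N n gaudin_gens (Bfull N n K z i j)"
proof (induction i rule: less_induct)
  case (less i)
  have "ingen N n gaudin_gens (PsiC N n K z i j - (\<Sum>l<i. osc (hK N K (i - l)) (Bfull N n K z l j)))"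
    by (intro ingen_diff ingen_PsiC assms ingen_sum ingen_osc less.IH) (use less.prems in auto)
  moreover have "PsiC N n K z i j - (\<Sum>l<i. osc (hK N K (i - l)) (Bfull N n K z l j)) = Bfull N n K z i j"
  proof -
    have "hK N K 0 = 1" by (simp add: hK_def prod_nth_0)
    moreover have "{..i} = insert i {..<i}" by auto
    ultimately show ?thesis using less.prems by (simp add: PsiC_def osc_def min_absorb1)
  qed
  ultimately show ?case by simp
qed

text \<open>The coefficient of x^(-2) u^(-j) in \<Psi> is minus the sum over b of z_b^(j-1) times
  the sum of row b of Q. Lagrange interpolation over j isolates row a, whose only nonscalar entry is
  H_a.\<close>

lemma ingen_gaudinH:
  assumes a: "a < n"
  shows "ingen N n bethe_gens (gaudinH N n K z a)"
proof -
  have "ingen N n bethe_gens (Bfull N n K z l j)" if "1 \<le> j" "l \<le> N" for l j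
  proof (cases "l = 0")
    case True
    then show ?thesis using that by (simp add: Bfull_def uconst_def ingen_zero)
  next
    case False
    then have "Bethe N n K z l j \<in> bethe_gens"
      unfolding bethe_gens_def using that by (intro CollectI exI[of _ l] exI[of _ j]) auto
    then show ?thesis using False by (simp add: Bfull_def ingen_mem)
  qed
  then have Psi: "ingen N n bethe_gens (PsiC N n K z i j)" if "1 \<le> j" for i j
    unfolding PsiC_def using that by (intro ingen_sum ingen_osc) auto
  obtain c and d :: nat where c: "\<And>b. b < n \<Longrightarrow> (\<Sum>p\<le>d. c p * z b ^ p) = of_bool (b = a)"
    using lagrange_coefficients[OF inj_z a] by blast
  \<comment> \<open>The off-diagonal part of row a of Q, subtracted to leave H_a.\<close>
  let ?w = "\<Sum>b\<in>{..<n} - {a}. 1 / (z b - z a)"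
  have "ingen N n bethe_gens (osc (- 1) (\<Sum>p\<le>d. osc (c p) (PsiC N n K z 2 (Suc p))) - osc ?w oid)"
    by (intro ingen_diff ingen_osc ingen_sum Psi ingen_one) simp
  then show ?thesis
  proof (rule ingen_cong)
    fix f g assume fg: "f \<in> Idx N n" "g \<in> Idx N n"
    let ?S = "\<lambda>b. \<Sum>e<n. mpow N n (Qmat N n K z) 1 b e f g"
    have "(\<Sum>p\<le>d. c p * PsiC N n K z 2 (Suc p) f g) = - (\<Sum>p\<le>d. \<Sum>b<n. c p * z b ^ p * ?S b)"
      by (simp add: PsiC_entry[OF fg] sum_distrib_left sum_negf mult.assoc)
    also have "(\<Sum>p\<le>d. \<Sum>b<n. c p * z b ^ p * ?S b) = (\<Sum>b<n. (\<Sum>p\<le>d. c p * z b ^ p) * ?S b)"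
      unfolding sum_distrib_right by (rule sum.swap)
    also have "\<dots> = (\<Sum>b<n. if b = a then ?S b else 0)"
      by (rule sum.cong[OF refl]) (use c in auto)
    also have "\<dots> = ?S a" using a by simp
    also have "?S a = (\<Sum>e<n. \<Sum>b<n. vact N n (Qmat N n K z a b) (\<lambda>h. mid b e h g) f)"
      by (simp add: mpow_def mmul_def op_sum_apply ocomp_eq_vact)
    also have "\<dots> = (\<Sum>e<n. vact N n (Qmat N n K z a e) (\<lambda>h. oid h g) f)"
    proof (rule sum.cong[OF refl])
      fix e assume e: "e \<in> {..<n}"
      have "(\<Sum>b<n. vact N n (Qmat N n K z a b) (\<lambda>h. mid b e h g) f)
        = (\<Sum>b<n. if b = e then vact N n (Qmat N n K z a e) (\<lambda>h. oid h g) f else 0)"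
        by (rule sum.cong[OF refl]) (auto simp: mid_def vact_def)
      then show "(\<Sum>b<n. vact N n (Qmat N n K z a b) (\<lambda>h. mid b e h g) f) = vact N n (Qmat N n K z a e) (\<lambda>h. oid h g) f"
        using e by simp
    qed
    also have "\<dots> = (\<Sum>e<n. Qmat N n K z a e f g)"
      using vact_delta[OF fg(2)] by (intro sum.cong refl) (simp add: oid_def of_bool_def)
    also have "\<dots> = gaudinH N n K z a f g + ?w * oid f g"
      using a by (subst sum.remove[of _ a]) (auto simp: Qmat_def osc_def sum_distrib_right intro!: sum.cong)
    finally show "(osc (- 1) (\<Sum>p\<le>d. osc (c p) (PsiC N n K z 2 (Suc p))) - osc ?w oid) f g = gaudinH N n K z a f g"
      by (simp add: osc_def op_sum_apply)
  qed
qed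

lemma genalg_bethe_eq: "genalg N n bethe_gens = genalg N n gaudin_gens"
proof
  show "genalg N n bethe_gens \<subseteq> genalg N n gaudin_gens"
  proof (rule genalg_subset)
    fix A assume "A \<in> bethe_gens"
    then obtain i j where "A = Bethe N n K z i j" "1 \<le> i" "i \<le> N" "1 \<le> j" by (auto simp: bethe_gens_def)
    then show "ingen N n gaudin_gens A" using ingen_Bfull[of j i] by (simp add: Bfull_def)
  qed
  show "genalg N n gaudin_gens \<subseteq> genalg N n bethe_gens"
    by (rule genalg_subset) (auto simp: gaudin_gens_def ingen_gaudinH)
qed

end

theorem theorem3p2:
  fixes N n :: nat and K z :: "nat \<Rightarrow> complex"
  assumes "N \<ge> 1" and "n \<ge> 1" and "inj_on z {..<n}"
  shows "genalg N n {Bethe N n K z i j | i j. 1 \<le> i \<and> i \<le> N \<and> 1 \<le> j}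
           = genalg N n (gaudinH N n K z ` {..<n})
       \<and> (\<forall>i j. \<forall>f\<in>Idx N n. \<forall>g\<in>Idx N n. PsiC N n K z i j f g = psiC N n K z i j f g)
       \<and> (\<forall>k. \<forall>f\<in>Idx N n. \<forall>g\<in>Idx N n.
            (\<Sum>a<n. mpow N n (Qmat N n K z) k a a) f g
              = (\<Sum>i<N. \<Sum>a<n. osc (K i ^ k) (Eop a i i)) f g)"
proof -
  interpret gaudin N n K z by standard (rule assms(3))
  show ?thesis
    using genalg_bethe_eq PsiC_eq_psiC trace_mpow
    by (simp only: bethe_gens_def gaudin_gens_def op_sum_apply simp_thms ball_simps) blast
qed


end
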